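(* A Hamiltonian stationary Lagrangian cyclic surface of $\mathbb{C}^2$ of type II is locally congruent to a Cartesian product of two round circles $\mathbb{S}^1(r_1)\times\mathbb{S}^1(r_2)\subset\mathbb{C}\times\mathbb{C}$.
   Context: $\mathbb{C}^2\simeq\mathbb{R}^4$ carries its standard Euclidean inner product $\langle\cdot,\cdot\rangle$, complex structure $J$ (multiplication by $i$) and symplectic form $\omega=\langle\cdot,J\cdot\rangle$. A surface is Lagrangian if $\omega$ vanishes on its tangent planes, and cyclic if it is foliated by round circles. A Lagrangian cyclic surface is of type II if, up to congruence, it is locally parametrized by an immersion of the form $$Y(s,t)=c\,(\gamma_1(s)e^{it},\gamma_2(s)e^{it})+\int_{s_0}^s W(u)\,(\overline{\gamma_2}(u),-\overline{\gamma_1}(u))\,du,\qquad (s,t)\in I\times\mathbb{R}/2\pi\mathbb{Z},$$ where $\gamma=(\gamma_1,\gamma_2)$ is a Legendrian curve of the unit sphere $\mathbb{S}^3\subset\mathbb{C}^2$ (i.e. $\langle\gamma',J\gamma\rangle=0$; $\gamma$ may be constant), $c$ is a real constant and $W$ is a complex-valued function on the interval $I\ni s_0$. All objects are smooth. The Lagrangian angle function $\beta$ of a Lagrangian surface is defined (modulo $2\pi$) by $\det_{\mathbb{C}}(e_1,e_2)=e^{i\beta}$, where $(e_1,e_2)$ is a local orthonormal tangent frame. The surface is Hamiltonian stationary if it is a critical point of the area with respect to compactly supported Hamiltonian variations (those generated by vector fields $V$ such that $V\lrcorner\,\omega$ is exact); equivalently $\Delta\beta=0$, where $\Delta$ is the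 Laplacian of the induced metric. $\mathbb{S}^1(r)\subset\mathbb{C}$ denotes a circle of radius $r$.
   Formalization: The claim fails for the right cylinder (e^{it}, s) (γ=(1,0) constant, c=1, W=-1), a Hamiltonian stationary type II surface; the formal conclusion therefore also allows a product of a round circle and a straight line. *)

theory Defs
  imports "HOL-Analysis.Analysis"
begin

text \<open>
  The space C^2 is the type \<^typ>\<open>complex \<times> complex\<close>, whose library inner product is the
  standard Euclidean one of R^4.
\<close>

definition J :: "complex \<times> complex \<Rightarrow> complex \<times> complex" where
  "J p = (\<i> * fst p, \<i> * snd p)"

definition symp :: "complex \<times> complex \<Rightarrow> complex \<times> complex \<Rightarrow> real" where
  "symp p q = p \<bullet> J q"

definition detC :: "complex \<times> complex \<Rightarrow> complex \<times> complex \<Rightarrow> complex" where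
  "detC p q = fst p * snd q - snd p * fst q"

text \<open>
  Congruences are the isometries of C^2 that respect the complex structure, i.e. the elements of
  the group of affine unitary maps.
\<close>

definition congruence :: "(complex \<times> complex \<Rightarrow> complex \<times> complex) \<Rightarrow> bool" where
  "congruence g \<longleftrightarrow>
     (\<exists>A b. orthogonal_transformation A \<and> (\<forall>p. A (J p) = J (A p)) \<and> g = (\<lambda>p. A p + b))"

text \<open>Smoothness (of class C-infinity); used for open sets only.\<close>

primrec Ck_on :: "nat \<Rightarrow> 'a::real_normed_vector set \<Rightarrow> ('a \<Rightarrow> 'b::real_normed_vector) \<Rightarrow> bool" where
  "Ck_on 0 S f \<longleftrightarrow> continuous_on S f"
| "Ck_on (Suc k) S f \<longleftrightarrow>
     (\<forall>x\<in>S. f differentiable (at x)) \<and> (\<forall>v. Ck_on k S (\<lambda>x. frechet_derivative f (at x) v))"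

definition smooth_on :: "'a::real_normed_vector set \<Rightarrow> ('a \<Rightarrow> 'b::real_normed_vector) \<Rightarrow> bool" where
  "smooth_on S f \<longleftrightarrow> (\<forall>k. Ck_on k S f)"

definition diffeo_on ::
  "'a::real_normed_vector set \<Rightarrow> ('a \<Rightarrow> 'b::real_normed_vector) \<Rightarrow> bool" where
  "diffeo_on V \<phi> \<longleftrightarrow> smooth_on V \<phi> \<and> inj_on \<phi> V \<and>
     open (\<phi> ` V) \<and> smooth_on (\<phi> ` V) (inv_into V \<phi>)"

text \<open>
  A surface is given in a chart, as an immersion X of an open subset U of the plane. It need not
  be injective.
\<close>

definition immersion_on :: "(real \<times> real) set \<Rightarrow> (real \<times> real \<Rightarrow> complex \<times> complex) \<Rightarrow> bool" where
  "immersion_on U X \<longleftrightarrow> smooth_on U X \<and> (\<forall>p\<in>U. inj (frechet_derivative X (at p)))"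

definition lagrangian_on :: "(real \<times> real) set \<Rightarrow> (real \<times> real \<Rightarrow> complex \<times> complex) \<Rightarrow> bool" where
  "lagrangian_on U X \<longleftrightarrow>
     (\<forall>p\<in>U. \<forall>v w. symp (frechet_derivative X (at p) v) (frechet_derivative X (at p) w) = 0)"

definition pd1 :: "(real \<times> real \<Rightarrow> 'b::real_normed_vector) \<Rightarrow> real \<times> real \<Rightarrow> 'b" where
  "pd1 f p = frechet_derivative f (at p) (1, 0)"

definition pd2 :: "(real \<times> real \<Rightarrow> 'b::real_normed_vector) \<Rightarrow> real \<times> real \<Rightarrow> 'b" where
  "pd2 f p = frechet_derivative f (at p) (0, 1)"

text \<open>
  The coefficients of the induced metric, and its Laplacian in coordinates,
  div grad f = det(g)^(-1/2) * sum over i, j of d_i (det(g)^(1/2) * g^(ij) * d_j f),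
  where the inverse matrix (g^(ij)) is (G, -F; -F, E) / det(g).
\<close>

definition gE :: "(real \<times> real \<Rightarrow> complex \<times> complex) \<Rightarrow> real \<times> real \<Rightarrow> real" where
  "gE X p = pd1 X p \<bullet> pd1 X p"

definition gF :: "(real \<times> real \<Rightarrow> complex \<times> complex) \<Rightarrow> real \<times> real \<Rightarrow> real" where
  "gF X p = pd1 X p \<bullet> pd2 X p"

definition gG :: "(real \<times> real \<Rightarrow> complex \<times> complex) \<Rightarrow> real \<times> real \<Rightarrow> real" where
  "gG X p = pd2 X p \<bullet> pd2 X p"

definition area_density :: "(real \<times> real \<Rightarrow> complex \<times> complex) \<Rightarrow> real \<times> real \<Rightarrow> real" where
  "area_density X p = sqrt (gE X p * gG X p - (gF X p)\<^sup>2)"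

definition laplacian ::
  "(real \<times> real \<Rightarrow> complex \<times> complex) \<Rightarrow> (real \<times> real \<Rightarrow> real) \<Rightarrow> real \<times> real \<Rightarrow> real" where
  "laplacian X f p =
     (pd1 (\<lambda>q. (gG X q * pd1 f q - gF X q * pd2 f q) / area_density X q) p +
      pd2 (\<lambda>q. (gE X q * pd2 f q - gF X q * pd1 f q) / area_density X q) p) / area_density X p"

definition orthonormal_tangent_frame ::
  "(real \<times> real) set \<Rightarrow> (real \<times> real \<Rightarrow> complex \<times> complex) \<Rightarrow>
   (real \<times> real \<Rightarrow> complex \<times> complex) \<Rightarrow> (real \<times> real \<Rightarrow> complex \<times> complex) \<Rightarrow> bool" where
  "orthonormal_tangent_frame V X e1 e2 \<longleftrightarrow> smooth_on V e1 \<and> smooth_on V e2 \<and>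
     (\<forall>p\<in>V. e1 p \<in> range (frechet_derivative X (at p)) \<and>
             e2 p \<in> range (frechet_derivative X (at p)) \<and>
             norm (e1 p) = 1 \<and> norm (e2 p) = 1 \<and> e1 p \<bullet> e2 p = 0)"

text \<open>A smooth real-valued branch on V of the Lagrangian angle.\<close>

definition lagrangian_angle_on ::
  "(real \<times> real) set \<Rightarrow> (real \<times> real \<Rightarrow> complex \<times> complex) \<Rightarrow> (real \<times> real \<Rightarrow> real) \<Rightarrow> bool" where
  "lagrangian_angle_on V X \<beta> \<longleftrightarrow> smooth_on V \<beta> \<and>
     (\<exists>e1 e2. orthonormal_tangent_frame V X e1 e2 \<and> (\<forall>p\<in>V. detC (e1 p) (e2 p) = cis (\<beta> p)))"

text \<open>
  The angle is defined up to a multiple of 2*pi, and a change of the orientation of the frame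
  shifts it by pi, so its Laplacian does not depend on the local branch. Branches exist near
  every point of a Lagrangian immersion, so it is immaterial that the condition below asks for
  one harmonic branch near every point instead of the harmonicity of all branches.
\<close>

definition hamiltonian_stationary_on ::
  "(real \<times> real) set \<Rightarrow> (real \<times> real \<Rightarrow> complex \<times> complex) \<Rightarrow> bool" where
  "hamiltonian_stationary_on U X \<longleftrightarrow>
     (\<forall>p\<in>U. \<exists>V \<beta>. open V \<and> p \<in> V \<and> V \<subseteq> U \<and> lagrangian_angle_on V X \<beta> \<and>
        (\<forall>q\<in>V. laplacian X \<beta> q = 0))"

definition round_circle :: "(complex \<times> complex) set \<Rightarrow> bool" where
  "round_circle C \<longleftrightarrow>
     (\<exists>m u v r. r > 0 \<and> norm u = 1 \<and> norm v = 1 \<and> u \<bullet> v = 0 \<and>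
        C = range (\<lambda>t. m + (r * cos t) *\<^sub>R u + (r * sin t) *\<^sub>R v))"

text \<open>
  In a chart only arcs of the leaves are visible: locally there are coordinates \<open>\<phi>\<close> whose
  curves of constant first coordinate are mapped to arcs of round circles.
\<close>

definition cyclic_on :: "(real \<times> real) set \<Rightarrow> (real \<times> real \<Rightarrow> complex \<times> complex) \<Rightarrow> bool" where
  "cyclic_on U X \<longleftrightarrow>
     (\<forall>p\<in>U. \<exists>V (\<phi> :: real \<times> real \<Rightarrow> real \<times> real). open V \<and> p \<in> V \<and> V \<subseteq> U \<and> diffeo_on V \<phi> \<and>
        (\<forall>s. \<exists>C. round_circle C \<and> X ` {q\<in>V. fst (\<phi> q) = s} \<subseteq> C))"

definition legendrian_on :: "real set \<Rightarrow> (real \<Rightarrow> complex \<times> complex) \<Rightarrow> bool" where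
  "legendrian_on I \<gamma> \<longleftrightarrow> smooth_on I \<gamma> \<and>
     (\<forall>s\<in>I. norm (\<gamma> s) = 1 \<and> vector_derivative \<gamma> (at s) \<bullet> J (\<gamma> s) = 0)"

text \<open>The variable t is lifted to the real line; the map is 2*pi-periodic in t.\<close>

definition type_II_map ::
  "real \<Rightarrow> (real \<Rightarrow> complex \<times> complex) \<Rightarrow> (real \<Rightarrow> complex) \<Rightarrow> real \<Rightarrow>
   real \<times> real \<Rightarrow> complex \<times> complex" where
  "type_II_map c \<gamma> W s\<^sub>0 = (\<lambda>(s, t).
     c *\<^sub>R (fst (\<gamma> s) * cis t, snd (\<gamma> s) * cis t) +
     (LBINT u=ereal s\<^sub>0..ereal s. (W u * cnj (snd (\<gamma> u)), W u * - cnj (fst (\<gamma> u)))))"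

definition type_II_on :: "(real \<times> real) set \<Rightarrow> (real \<times> real \<Rightarrow> complex \<times> complex) \<Rightarrow> bool" where
  "type_II_on U X \<longleftrightarrow>
     (\<forall>p\<in>U. \<exists>V \<phi> g I s\<^sub>0 c \<gamma> W.
        open V \<and> p \<in> V \<and> V \<subseteq> U \<and>
        open I \<and> is_interval I \<and> s\<^sub>0 \<in> I \<and> legendrian_on I \<gamma> \<and> smooth_on I W \<and>
        immersion_on (I \<times> UNIV) (type_II_map c \<gamma> W s\<^sub>0) \<and>
        diffeo_on V \<phi> \<and> \<phi> ` V \<subseteq> I \<times> UNIV \<and> congruence g \<and>
        (\<forall>q\<in>V. X q = g (type_II_map c \<gamma> W s\<^sub>0 (\<phi> q))))"

text \<open>Every point of the surface has a neighbourhood congruent to an open piece of S.\<close>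

definition locally_congruent_on ::
  "(real \<times> real) set \<Rightarrow> (real \<times> real \<Rightarrow> complex \<times> complex) \<Rightarrow> (complex \<times> complex) set \<Rightarrow> bool" where
  "locally_congruent_on U X S \<longleftrightarrow>
     (\<forall>p\<in>U. \<exists>V g. open V \<and> p \<in> V \<and> V \<subseteq> U \<and> congruence g \<and>
        openin (top_of_set S) (g ` X ` V))"

text \<open>
  Straight lines have to be admitted as circles of infinite radius in the classification: the
  right cylinder (s, t) |-> (cis t, s) is \<open>type_II_map 1 (\<lambda>_. (1, 0)) (\<lambda>_. -1) 0\<close>, it is flat, and
  its angle t + const is harmonic, but no piece of it is congruent to a piece of a product of two
  circles of finite radii.
\<close>

end

theory Submission
  imports Defs "HOL-Computational_Algebra.Polynomial"
begin

text \<open>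
Write a type II surface as \<open>Y(s,t) = c e^{it} \<gamma>(s) + Z(s)\<close>. Since \<open>\<gamma>\<close> is a Legendrian curve of the
unit sphere, \<open>\<gamma>'\<close> is Hermitian orthogonal to \<open>\<gamma>\<close>, so \<open>c \<gamma>' = a n\<close> with a complex function \<open>a\<close> and
\<open>n = (cnj \<gamma>2, -cnj \<gamma>1)\<close>; by construction \<open>Z' = W n\<close>. With \<open>\<alpha> = a e^{it} + W\<close> this gives

  \<open>Y_s = \<alpha> n\<close>,  \<open>Y_t = i c e^{it} \<gamma>\<close>,  metric \<open>L ds^2 + c^2 dt^2\<close> with \<open>L = |\<alpha>|^2\<close>,  \<open>\<beta> = arg (\<alpha> e^{it}) + const\<close>,

so \<open>L\<close>, \<open>M = L \<beta>_s\<close> and \<open>N = L \<beta>_t\<close> are, for fixed \<open>s\<close>, trigonometric polynomials of degree one in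
\<open>t\<close>. Multiplied by a power of \<open>L\<close>, the equation \<open>\<Delta>\<beta> = 0\<close> becomes the vanishing of a trigonometric
polynomial of degree three on an interval of values of \<open>t\<close>. The part with derivatives in \<open>s\<close>
has degree two only, and the coefficient of \<open>e^{3it}\<close> is a nonzero multiple of \<open>q^3\<close>, where
\<open>q = a cnj W\<close> (lemmas \<open>stationary_equation\<close> and \<open>leading_trig_coefficient_zero\<close>). Hence \<open>a W = 0\<close>. As
\<open>Y\<close> is an immersion, \<open>a\<close> and \<open>W\<close> have no common zero, so by connectedness exactly one of them
vanishes on an interval, and what remains of the equation says that
\<open>Im (f' cnj f) / |f|^3\<close> is constant for the other one, \<open>f\<close>.

If \<open>a = 0\<close>, then \<open>\<gamma>\<close> is constant and the surface is the product of a circle of radius \<open>|c|\<close> with a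
plane curve of velocity \<open>W\<close> and of constant curvature, that is, a circle or a line
(\<open>normal_form_fixed_frame\<close>). If \<open>W = 0\<close>, the surface is, up to translation, \<open>c e^{it} \<gamma>(s)\<close>, and
constancy of the curvature turns the frame equations of \<open>(\<gamma>, n)\<close> into a linear system with constant
coefficients in the arc length; its two eigendirections are orthogonal and split the surface as a
product of two circles (\<open>normal_form_fixed_center\<close>).

These normal forms are local, and the radii must not depend on the chart. Two models that share an
open piece up to a congruence are themselves congruent, which follows again from independence of
trigonometric functions (\<open>model_unique\<close>); connectedness of the parameter domain then gives one model
for the whole surface (\<open>model_globally_constant\<close>).
\<close>

section \<open>Trigonometric polynomials on an arc\<close>

lemma inj_on_cis_short: "inj_on cis {a..a + 1}"
proof (rule inj_onI)
  fix x y :: real assume xy: "x \<in> {a..a + 1}" "y \<in> {a..a + 1}" "cis x = cis y"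
  have "cis (x - y) = 1" using xy(3) by (metis cis_divide cis_neq_zero divide_self)
  then have "cos (x - y) = 1" by (metis cis.sel(1) one_complex.sel(1))
  then obtain n :: int where n: "x - y = of_int n * 2 * pi" 
    using cos_one_2pi_int by auto
  have "\<bar>x - y\<bar> \<le> 1" using xy by auto
  then have "\<bar>of_int n :: real\<bar> * (2 * pi) \<le> 1" using n by (simp add: abs_mult)
  moreover have "2 * pi > 1" using pi_gt3 by simp
  ultimately have "\<bar>of_int n :: real\<bar> < 1"
    by (smt (verit) mult_le_cancel_right1 mult_less_cancel_right1)
  then have "n = 0" by linarith
  then show "x = y" using n by simp
qed

lemma poly_vanishing_on_arc:
  fixes P :: "complex poly"
  assumes "a < b" and "\<And>x. x \<in> {a<..<b} \<Longrightarrow> poly P (cis x) = 0"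
  shows "P = 0"
proof (rule ccontr)
  assume "P \<noteq> 0"
  then have fin: "finite {z. poly P z = 0}" by (rule poly_roots_finite)
  have sub: "{a<..<min b (a + 1)} \<subseteq> {a..a + 1}" by auto
  have "cis ` {a<..<min b (a + 1)} \<subseteq> {z. poly P z = 0}" using assms(2) by auto
  then have "finite (cis ` {a<..<min b (a + 1)})" using fin finite_subset by blast
  then have "finite {a<..<min b (a + 1)}"
    using finite_imageD inj_on_subset[OF inj_on_cis_short sub] by blast
  then show False using assms(1) infinite_Ioo[of a "min b (a + 1)"] by auto
qed

text \<open>
On the unit circle conjugation is inversion, so real trigonometric polynomials become rational
functions of \<open>cis x\<close> and fall under the previous lemma.
\<close>

lemma Re_mult_cis: "2 * complex_of_real (Re (w * cis x)) = w * cis x + cnj w / cis x"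
proof -
  have "inverse (cis x) = cnj (cis x)" by (simp add: cis_cnj)
  then have "w * cis x + cnj w / cis x = w * cis x + cnj (w * cis x)"
    by (simp add: divide_inverse)
  then show ?thesis by (simp only: complex_add_cnj of_real_mult of_real_numeral)
qed

lemma Re_cis_const_imp_zero:
  assumes "a < b" and "\<And>x. x \<in> {a<..<b} \<Longrightarrow> Re (w * cis x) = k"
  shows "w = 0"
proof -
  have "poly [:cnj w, - 2 * of_real k, w:] (cis x) = 0" if "x \<in> {a<..<b}" for x
  proof -
    have "w * cis x + cnj w / cis x = 2 * of_real k"
      using Re_mult_cis[of w x] unfolding assms(2)[OF that] by simp
    then have "w * cis x * cis x + cnj w = 2 * of_real k * cis x"
      by (simp add: field_simps cis_neq_zero)
    then show ?thesis by (simp add: algebra_simps)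
  qed
  then have "[:cnj w, - 2 * of_real k, w:] = 0" using poly_vanishing_on_arc assms(1) by blast
  then show "w = 0" by simp
qed

text \<open>
The shape of the equation \<open>\<Delta>\<beta> = 0\<close> along a circle of the foliation. The first two summands have
degree two, so only the third contributes to the frequency three; its coefficient there is a nonzero
multiple of \<open>q ^ 3\<close>.
\<close>

lemma leading_trig_coefficient_zero:
  fixes m1 n1 k1 q :: complex and m0 n0 k0 l0 d0 A B :: real
  assumes "a < b"
    and eq: "\<And>x. x \<in> {a<..<b} \<Longrightarrow>
      A * ((n0 + Re (n1 * cis x)) * (l0 + 2 * Re (q * cis x))) -
      B * ((m0 + Re (m1 * cis x)) * (k0 + Re (k1 * cis x))) +
      Re (\<i> * q * cis x) * (l0 + 2 * Re (q * cis x)) * (d0 + 3 * Re (q * cis x)) = 0"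
  shows "q = 0"
proof -
  \<comment> \<open>\<open>F r w\<close> represents \<open>2 z (r + Re (w z))\<close> on \<open>|z| = 1\<close>; the factor \<open>[:0, 2:]\<close> in \<open>P\<close> makes up for one factor fewer.\<close>
  define F where "F = (\<lambda>(r::real) (w::complex). [:cnj w, 2 * of_real r, w:])"
  define P where "P = [:0, 2:] * (smult (of_real A) (F n0 n1 * F l0 (2 * q)) - smult (of_real B) (F m0 m1 * F k0 k1))
     + F 0 (\<i> * q) * F l0 (2 * q) * F d0 (3 * q)"
  have F: "poly (F r w) (cis x) = 2 * cis x * of_real (r + Re (w * cis x))" for r w x
  proof -
    have "2 * complex_of_real (Re (w * cis x)) * cis x = w * cis x * cis x + cnj w"
      unfolding Re_mult_cis by (simp add: field_simps cis_neq_zero)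
    then show ?thesis by (simp add: F_def algebra_simps)
  qed
  have "poly P (cis x) = 0" if x: "x \<in> {a<..<b}" for x
  proof -
    define N M L K R D where "N = n0 + Re (n1 * cis x)" and "M = m0 + Re (m1 * cis x)"
      and "L = l0 + Re (2 * q * cis x)" and "K = k0 + Re (k1 * cis x)"
      and "R = 0 + Re (\<i> * q * cis x)" and "D = d0 + Re (3 * q * cis x)"
    note defs = this
    have L: "L = l0 + 2 * Re (q * cis x)" and D: "D = d0 + 3 * Re (q * cis x)"
      by (simp_all add: defs algebra_simps)
    have "poly P (cis x) = 8 * cis x ^ 3 * of_real (A * (N * L) - B * (M * K) + R * L * D)"
      unfolding P_def poly_add poly_mult poly_diff poly_smult F defs[symmetric]
      by (simp add: algebra_simps power3_eq_cube)
    also have "A * (N * L) - B * (M * K) + R * L * D = 0"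
      using eq[OF x] unfolding L D N_def M_def K_def R_def by simp
    finally show ?thesis by simp
  qed
  then have "P = 0" using poly_vanishing_on_arc assms(1) by blast
  then have "coeff P 6 = 0" by simp
  moreover have "coeff P 6 = 6 * \<i> * q ^ 3"
    by (simp add: P_def F_def numeral_eq_Suc coeff_pCons algebra_simps)
  ultimately show "q = 0" by simp
qed

section \<open>Partial derivatives of smooth maps\<close>

text \<open>
One half of the symmetry of second derivatives: by the mean value theorem the second difference of
\<open>f\<close> over a small square is \<open>h\<close> times an increment of the first partial derivative \<open>f1\<close>, which the
derivative of \<open>f1\<close> at \<open>p\<close> computes up to \<open>o(h)\<close>. The second difference is symmetric in the two
variables, so exchanging them gives the other half.
\<close>

lemma double_difference:
  fixes f f1 f2 :: "real \<times> real \<Rightarrow> real"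
  assumes V: "open V" "p \<in> V"
    and f: "\<And>q. q \<in> V \<Longrightarrow> (f has_derivative (\<lambda>h. fst h * f1 q + snd h * f2 q)) (at q)"
    and f1: "(f1 has_derivative f1') (at p)" and e: "e > 0"
  shows "\<exists>d>0. \<forall>h. 0 < h \<and> h < d \<longrightarrow>
     \<bar>f (p + (h, h)) - f (p + (h, 0)) - f (p + (0, h)) + f p - h\<^sup>2 * f1' (0, 1)\<bar> \<le> e * h\<^sup>2"
proof -
  obtain d1 where d1: "d1 > 0" "ball p d1 \<subseteq> V" using V openE by blast
  obtain d2 where d2: "d2 > 0"
    "\<And>q. norm (q - p) < d2 \<Longrightarrow> norm (f1 q - f1 p - f1' (q - p)) \<le> (e / 4) * norm (q - p)"
    using f1 e unfolding has_derivative_at_alt by (metis divide_pos_pos zero_less_numeral)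
  interpret f1': bounded_linear f1' using f1 by (rule has_derivative_bounded_linear)
  define d where "d = min d1 d2 / 2"
  show ?thesis
  proof (intro exI conjI allI impI)
    show "d > 0" using d1 d2 by (simp add: d_def)
    fix h assume h: "0 < h \<and> h < d"
    have nrm: "norm ((x, y) :: real \<times> real) \<le> 2 * h" if "0 \<le> x" "x \<le> h" "0 \<le> y" "y \<le> h" for x y
      using norm_Pair_le[of x y] that by simp
    have inV: "p + (x, y) \<in> V" if "0 \<le> x" "x \<le> h" "0 \<le> y" "y \<le> h" for x y
    proof -
      have "norm ((x, y) :: real \<times> real) < d1" using nrm[OF that] h by (simp add: d_def)
      then show ?thesis using d1(2) by (auto simp: dist_norm norm_prod_def)
    qed
    have partial: "((\<lambda>x. f (p + (x, y))) has_real_derivative f1 (p + (x, y))) (at x)"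
      if "0 \<le> x" "x \<le> h" "0 \<le> y" "y \<le> h" for x y
    proof -
      have "((\<lambda>x. p + (x, y)) has_derivative (\<lambda>k. (k, 0))) (at x)"
        by (auto intro!: derivative_eq_intros)
      from has_derivative_compose[OF this f[OF inV[OF that]]]
      show ?thesis by (simp add: has_field_derivative_def mult_commute_abs)
    qed
    define \<phi> where "\<phi> = (\<lambda>x. f (p + (x, h)) - f (p + (x, 0)))"
    have "\<exists>z. 0 < z \<and> z < h \<and> \<phi> h - \<phi> 0 = (h - 0) * (f1 (p + (z, h)) - f1 (p + (z, 0)))"
      using h unfolding \<phi>_def
      by (intro MVT2) (auto intro!: derivative_intros partial)
    then obtain z where z: "0 < z" "z < h"
      "\<phi> h - \<phi> 0 = h * (f1 (p + (z, h)) - f1 (p + (z, 0)))" by auto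
    have est: "\<bar>f1 (p + (z, y)) - f1 p - f1' (z, y)\<bar> \<le> e / 4 * (2 * h)" if "0 \<le> y" "y \<le> h" for y
    proof -
      have n: "norm ((z, y) :: real \<times> real) \<le> 2 * h" using nrm z that by simp
      then have "norm ((p + (z, y)) - p) < d2" using h by (simp add: d_def)
      from d2(2)[OF this] have "\<bar>f1 (p + (z, y)) - f1 p - f1' (z, y)\<bar> \<le> e / 4 * norm ((z, y) :: real \<times> real)"
        by simp
      also have "\<dots> \<le> e / 4 * (2 * h)" using n e by (intro mult_left_mono) auto
      finally show ?thesis .
    qed
    have lin: "f1' (z, h) - f1' (z, 0) = h * f1' (0, 1)"
      using f1'.diff[of "(z, h)" "(z, 0)"] f1'.scaleR[of h "(0, 1)"] by simp
    have "\<bar>f1 (p + (z, h)) - f1 (p + (z, 0)) - h * f1' (0, 1)\<bar> \<le> e * h"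
      using est[of h] est[of 0] lin h by linarith
    then have "h * \<bar>f1 (p + (z, h)) - f1 (p + (z, 0)) - h * f1' (0, 1)\<bar> \<le> h * (e * h)"
      using h by (intro mult_left_mono) auto
    moreover have eqn: "f (p + (h, h)) - f (p + (h, 0)) - f (p + (0, h)) + f p - h\<^sup>2 * f1' (0, 1) =
       h * (f1 (p + (z, h)) - f1 (p + (z, 0)) - h * f1' (0, 1))"
      using z(3) by (simp add: \<phi>_def power2_eq_square algebra_simps flip: zero_prod_def)
    ultimately show "\<bar>f (p + (h, h)) - f (p + (h, 0)) - f (p + (0, h)) + f p - h\<^sup>2 * f1' (0, 1)\<bar> \<le> e * h\<^sup>2"
      unfolding eqn using h by (simp add: abs_mult power2_eq_square mult.left_commute)
  qed
qed

lemma mixed_partials_commute: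
  fixes f f1 f2 :: "real \<times> real \<Rightarrow> real"
  assumes V: "open V" "p \<in> V"
    and f: "\<And>q. q \<in> V \<Longrightarrow> (f has_derivative (\<lambda>h. fst h * f1 q + snd h * f2 q)) (at q)"
    and f1: "(f1 has_derivative f1') (at p)" and f2: "(f2 has_derivative f2') (at p)"
  shows "f1' (0, 1) = f2' (1, 0)"
proof -
  have sw: "(prod.swap has_derivative prod.swap) (at q)" for q :: "real \<times> real"
    by (rule bounded_linear_imp_has_derivative) 
      (auto simp: prod.swap_def[abs_def] intro!: bounded_linear_Pair bounded_linear_snd bounded_linear_fst)
  have "prod.swap ` V = prod.swap -` V" by force
  then have swV: "open (prod.swap ` V)" "prod.swap p \<in> prod.swap ` V"
    using V open_vimage[OF V(1), of prod.swap]
    by (auto intro!: continuous_intros simp: prod.swap_def[abs_def])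
  have sf: "((\<lambda>q. f (prod.swap q)) has_derivative
      (\<lambda>h. fst h * f2 (prod.swap q) + snd h * f1 (prod.swap q))) (at q)"
    if "q \<in> prod.swap ` V" for q
  proof -
    have "prod.swap q \<in> V" using that by auto
    from has_derivative_compose[OF sw f[OF this]] show ?thesis
      by (simp add: add.commute)
  qed
  have sf2: "((\<lambda>q. f2 (prod.swap q)) has_derivative (\<lambda>h. f2' (prod.swap h))) (at (prod.swap p))"
    using has_derivative_compose[OF sw, of f2 f2' "prod.swap p"] f2 by simp
  have "\<bar>f1' (0, 1) - f2' (1, 0)\<bar> \<le> e" if e: "e > 0" for e
  proof -
    from double_difference[OF V f f1, of "e / 2"] e obtain d1 where d1: "d1 > 0"
      "\<And>h. 0 < h \<and> h < d1 \<Longrightarrow>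
     \<bar>f (p + (h, h)) - f (p + (h, 0)) - f (p + (0, h)) + f p - h\<^sup>2 * f1' (0, 1)\<bar> \<le> e / 2 * h\<^sup>2"
      by auto
    have "\<exists>d>0. \<forall>h. 0 < h \<and> h < d \<longrightarrow>
     \<bar>f (prod.swap (prod.swap p + (h, h))) - f (prod.swap (prod.swap p + (h, 0)))
      - f (prod.swap (prod.swap p + (0, h))) + f (prod.swap (prod.swap p))
      - h\<^sup>2 * f2' (prod.swap (0, 1))\<bar> \<le> e / 2 * h\<^sup>2"
      by (rule double_difference[OF swV sf sf2]) (use e in auto)
    then obtain d2 where d2: "d2 > 0"
      "\<And>h. 0 < h \<and> h < d2 \<Longrightarrow>
     \<bar>f (p + (h, h)) - f (p + (0, h)) - f (p + (h, 0)) + f p - h\<^sup>2 * f2' (1, 0)\<bar> \<le> e / 2 * h\<^sup>2"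
      by (cases p) auto
    define h where "h = min d1 d2 / 2"
    have h: "0 < h" "h < d1" "h < d2" using d1 d2 by (auto simp: h_def)
    have "\<bar>h\<^sup>2 * f1' (0, 1) - h\<^sup>2 * f2' (1, 0)\<bar> \<le> e * h\<^sup>2"
      using d1(2)[of h] d2(2)[of h] h by linarith
    then have "h\<^sup>2 * \<bar>f1' (0, 1) - f2' (1, 0)\<bar> \<le> h\<^sup>2 * e"
      by (simp add: abs_mult flip: right_diff_distrib) (simp add: mult.commute)
    then show ?thesis using h by simp
  qed
  then show ?thesis
    by (metis abs_ge_zero abs_le_zero_iff dense_ge eq_iff_diff_eq_0 order_antisym)
qed

text \<open>
The predicates on smoothness are stated through \<open>frechet_derivative\<close>; the next lemmas extract from
them derivatives in the relational form.
\<close>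

lemma smooth_on_differentiable: "smooth_on S f \<Longrightarrow> x \<in> S \<Longrightarrow> f differentiable (at x)"
  unfolding smooth_on_def by (metis Ck_on.simps(2))

lemma smooth_on_frechet_derivative:
  "smooth_on S f \<Longrightarrow> smooth_on S (\<lambda>x. frechet_derivative f (at x) v)"
  unfolding smooth_on_def by (metis Ck_on.simps(2))

lemma smooth_on_imp_continuous_on: "smooth_on S f \<Longrightarrow> continuous_on S f"
  unfolding smooth_on_def by (metis Ck_on.simps(1))

lemma smooth_on_has_vector_derivative:
  fixes f :: "real \<Rightarrow> 'a::real_normed_vector"
  assumes "smooth_on S f"
  obtains f' where "smooth_on S f'" "\<And>s. s \<in> S \<Longrightarrow> (f has_vector_derivative f' s) (at s)"
proof
  show "smooth_on S (\<lambda>s. frechet_derivative f (at s) 1)"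
    using assms by (rule smooth_on_frechet_derivative)
  show "(f has_vector_derivative frechet_derivative f (at s) 1) (at s)" if "s \<in> S" for s
  proof -
    let ?D = "frechet_derivative f (at s)"
    have D: "(f has_derivative ?D) (at s)"
      using smooth_on_differentiable[OF assms that] frechet_derivative_works by blast
    have "?D x = x *\<^sub>R ?D 1" for x
      using linear_cmul[OF has_derivative_linear[OF D], of x 1] by simp
    then have "?D = (\<lambda>x. x *\<^sub>R ?D 1)" by (rule ext)
    then show ?thesis using D unfolding has_vector_derivative_def by simp
  qed
qed

lemma linear_pair:
  fixes f :: "real \<times> real \<Rightarrow> 'b::real_vector"
  assumes "linear f"
  shows "f h = fst h *\<^sub>R f (1, 0) + snd h *\<^sub>R f (0, 1)"
proof -
  have "h = fst h *\<^sub>R (1, 0) + snd h *\<^sub>R (0, 1)" by (cases h) simp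
  then have "f h = f (fst h *\<^sub>R (1, 0) + snd h *\<^sub>R (0, 1))" by (rule arg_cong)
  also have "\<dots> = fst h *\<^sub>R f (1, 0) + snd h *\<^sub>R f (0, 1)"
    using assms by (simp only: linear_add linear_cmul)
  finally show ?thesis .
qed

lemma has_derivative_pd:
  assumes "f differentiable (at p)"
  shows "(f has_derivative (\<lambda>h. fst h *\<^sub>R pd1 f p + snd h *\<^sub>R pd2 f p)) (at p)"
proof -
  have "frechet_derivative f (at p) = (\<lambda>h. fst h *\<^sub>R pd1 f p + snd h *\<^sub>R pd2 f p)"
    unfolding pd1_def pd2_def by (intro ext linear_pair linear_frechet_derivative assms)
  then show ?thesis using assms frechet_derivative_works by metis
qed

lemma pd_eqI:
  assumes "(f has_derivative f') (at p)"
  shows "pd1 f p = f' (1, 0)" "pd2 f p = f' (0, 1)"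
  using frechet_derivative_at[OF assms] by (simp_all add: pd1_def pd2_def)

lemma smooth_on_pd: "smooth_on V f \<Longrightarrow> smooth_on V (pd1 f)" "smooth_on V f \<Longrightarrow> smooth_on V (pd2 f)"
  unfolding pd1_def pd2_def by (rule smooth_on_frechet_derivative, assumption)+

lemma pd_eq_on_open:
  assumes "open V" "p \<in> V" "(f has_derivative f') (at p)" "\<And>q. q \<in> V \<Longrightarrow> g q = f q"
  shows "pd1 g p = f' (1, 0)" "pd2 g p = f' (0, 1)"
proof -
  have "(g has_derivative f') (at p)"
    using has_derivative_transform_within_open[OF assms(3,1,2)] assms(4) by metis
  then show "pd1 g p = f' (1, 0)" "pd2 g p = f' (0, 1)" by (rule pd_eqI)+
qed

section \<open>The Laplacian and the Lagrangian angle in adapted coordinates\<close>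

text \<open>
The Laplacian is defined in the chart of \<open>X\<close>, whereas the metric is diagonal, \<open>E ds^2 + G dt^2\<close>, in the
coordinates \<open>\<phi> = (s, t)\<close>. Here \<open>e\<close> and \<open>f\<close> are the coordinate vector fields of \<open>\<phi>\<close> along the surface,
and \<open>b1\<close>, \<open>b2\<close> are the partial derivatives of \<open>\<beta>\<close> with respect to \<open>s\<close> and \<open>t\<close>. The flux through the
coordinate lines changes under \<open>\<phi>\<close> by the cofactor matrix of the Jacobian (Piola transformation),
and cofactor matrices are divergence free because second derivatives commute. The functions \<open>b1\<close> and
\<open>b2\<close> are prescribed on the target, so \<open>\<beta>\<close> need not be transported through \<open>\<phi>\<close>.
\<close>

lemma laplacian_orthogonal_coordinates:
  fixes \<phi> :: "real \<times> real \<Rightarrow> real \<times> real" and E G b1 b2 :: "real \<times> real \<Rightarrow> real"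
  assumes V: "open V" "p \<in> V" and sm: "smooth_on V \<phi>"
    and X: "\<And>q. q \<in> V \<Longrightarrow> (X has_derivative (\<lambda>h. fst (frechet_derivative \<phi> (at q) h) *\<^sub>R e q
                + snd (frechet_derivative \<phi> (at q) h) *\<^sub>R f q)) (at q)"
    and ef: "\<And>q. q \<in> V \<Longrightarrow> e q \<bullet> f q = 0" "\<And>q. q \<in> V \<Longrightarrow> e q \<bullet> e q = E (\<phi> q)"
       "\<And>q. q \<in> V \<Longrightarrow> f q \<bullet> f q = G (\<phi> q)"
    and pos: "\<And>q. q \<in> V \<Longrightarrow> E (\<phi> q) > 0" "\<And>q. q \<in> V \<Longrightarrow> G (\<phi> q) > 0"
    and \<beta>: "\<And>q. q \<in> V \<Longrightarrow> (\<beta> has_derivative (\<lambda>h. fst (frechet_derivative \<phi> (at q) h) * b1 (\<phi> q)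
                + snd (frechet_derivative \<phi> (at q) h) * b2 (\<phi> q))) (at q)"
    and inj: "inj (frechet_derivative X (at p))"
    and P: "((\<lambda>z. sqrt (G z / E z) * b1 z) has_derivative P') (at (\<phi> p))"
    and Q: "((\<lambda>z. sqrt (E z / G z) * b2 z) has_derivative Q') (at (\<phi> p))"
  shows "laplacian X \<beta> p = (P' (1, 0) + Q' (0, 1)) / sqrt (E (\<phi> p) * G (\<phi> p))"
proof -
  define P Q where "P = (\<lambda>z. sqrt (G z / E z) * b1 z)" and "Q = (\<lambda>z. sqrt (E z / G z) * b2 z)"
  define u1 u2 v1 v2 where "u1 = (\<lambda>q. fst (pd1 \<phi> q))" and "u2 = (\<lambda>q. fst (pd2 \<phi> q))"
    and "v1 = (\<lambda>q. snd (pd1 \<phi> q))" and "v2 = (\<lambda>q. snd (pd2 \<phi> q))"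
  note uv = this
  define j where "j = (\<lambda>q. u1 q * v2 q - u2 q * v1 q)"
  have d\<phi>: "(\<phi> has_derivative (\<lambda>h. fst h *\<^sub>R pd1 \<phi> q + snd h *\<^sub>R pd2 \<phi> q)) (at q)" if "q \<in> V" for q
    using has_derivative_pd smooth_on_differentiable[OF sm that] .
  have D: "frechet_derivative \<phi> (at q) h = (fst h * u1 q + snd h * u2 q, fst h * v1 q + snd h * v2 q)"
    if "q \<in> V" for q h
    using frechet_derivative_at[OF d\<phi>[OF that], symmetric] by (simp add: uv prod_eq_iff)
  have X1: "pd1 X q = u1 q *\<^sub>R e q + v1 q *\<^sub>R f q" and X2: "pd2 X q = u2 q *\<^sub>R e q + v2 q *\<^sub>R f q"
    if "q \<in> V" for q
    using pd_eqI[OF X[OF that]] D[OF that] by simp_all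
  have \<beta>1: "pd1 \<beta> q = u1 q * b1 (\<phi> q) + v1 q * b2 (\<phi> q)"
    and \<beta>2: "pd2 \<beta> q = u2 q * b1 (\<phi> q) + v2 q * b2 (\<phi> q)" if "q \<in> V" for q
    using pd_eqI[OF \<beta>[OF that]] D[OF that] by simp_all
  have gE: "gE X q = (u1 q)\<^sup>2 * E (\<phi> q) + (v1 q)\<^sup>2 * G (\<phi> q)"
    and gF: "gF X q = u1 q * u2 q * E (\<phi> q) + v1 q * v2 q * G (\<phi> q)"
    and gG: "gG X q = (u2 q)\<^sup>2 * E (\<phi> q) + (v2 q)\<^sup>2 * G (\<phi> q)" if "q \<in> V" for q
    unfolding gE_def gF_def gG_def X1[OF that] X2[OF that]
    using ef[OF that] by (simp_all add: inner_add_left inner_add_right inner_commute[of "f q" "e q"] power2_eq_square)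
  have det: "gE X q * gG X q - (gF X q)\<^sup>2 = (j q)\<^sup>2 * (E (\<phi> q) * G (\<phi> q))" if "q \<in> V" for q
    unfolding gE[OF that] gF[OF that] gG[OF that] j_def by algebra
  have area: "area_density X q = \<bar>j q\<bar> * sqrt (E (\<phi> q) * G (\<phi> q))" if "q \<in> V" for q
    unfolding area_density_def det[OF that] by (simp add: real_sqrt_mult)
  have rt: "G (\<phi> q) / sqrt (E (\<phi> q) * G (\<phi> q)) = sqrt (G (\<phi> q) / E (\<phi> q))"
      "E (\<phi> q) / sqrt (E (\<phi> q) * G (\<phi> q)) = sqrt (E (\<phi> q) / G (\<phi> q))" if "q \<in> V" for q
    using pos[OF that] real_sqrt_pow2[of "E (\<phi> q)"] real_sqrt_pow2[of "G (\<phi> q)"]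
    by (auto simp: real_sqrt_mult real_sqrt_divide field_simps power2_eq_square)
  have split: "k * (x * g * b - y * e * d) / (a * s) = (k / a) * (x * (g / s) * b - y * (e / s) * d)"
    for k x g b y e d a s :: real
    by (simp add: diff_divide_distrib right_diff_distrib mult_ac)
  have flux1: "(gG X q * pd1 \<beta> q - gF X q * pd2 \<beta> q) / area_density X q
       = sgn (j q) * (v2 q * P (\<phi> q) - u2 q * Q (\<phi> q))" if "q \<in> V" for q
  proof -
    have "gG X q * pd1 \<beta> q - gF X q * pd2 \<beta> q
        = j q * (v2 q * G (\<phi> q) * b1 (\<phi> q) - u2 q * E (\<phi> q) * b2 (\<phi> q))"
      unfolding gF[OF that] gG[OF that] \<beta>1[OF that] \<beta>2[OF that] j_def by algebra
    then have "(gG X q * pd1 \<beta> q - gF X q * pd2 \<beta> q) / area_density X q = (j q / \<bar>j q\<bar>) *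
        (v2 q * (G (\<phi> q) / sqrt (E (\<phi> q) * G (\<phi> q))) * b1 (\<phi> q)
         - u2 q * (E (\<phi> q) / sqrt (E (\<phi> q) * G (\<phi> q))) * b2 (\<phi> q))"
      unfolding area[OF that] by (simp only: split)
    then show ?thesis unfolding rt[OF that] P_def Q_def by (simp add: sgn_real_def abs_real_def)
  qed
  have flux2: "(gE X q * pd2 \<beta> q - gF X q * pd1 \<beta> q) / area_density X q
       = sgn (j q) * (u1 q * Q (\<phi> q) - v1 q * P (\<phi> q))" if "q \<in> V" for q
  proof -
    have "gE X q * pd2 \<beta> q - gF X q * pd1 \<beta> q
        = j q * (u1 q * E (\<phi> q) * b2 (\<phi> q) - v1 q * G (\<phi> q) * b1 (\<phi> q))"
      unfolding gF[OF that] gE[OF that] \<beta>1[OF that] \<beta>2[OF that] j_def by algebra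
    then have "(gE X q * pd2 \<beta> q - gF X q * pd1 \<beta> q) / area_density X q = (j q / \<bar>j q\<bar>) *
        (u1 q * (E (\<phi> q) / sqrt (E (\<phi> q) * G (\<phi> q))) * b2 (\<phi> q)
         - v1 q * (G (\<phi> q) / sqrt (E (\<phi> q) * G (\<phi> q))) * b1 (\<phi> q))"
      unfolding area[OF that] by (simp only: split)
    then show ?thesis unfolding rt[OF that] P_def Q_def by (simp add: sgn_real_def abs_real_def)
  qed
  have jp: "j p \<noteq> 0"
  proof
    assume "j p = 0"
    then have "frechet_derivative X (at p) (v2 p, - v1 p) = 0 \<and> frechet_derivative X (at p) (u2 p, - u1 p) = 0"
      using frechet_derivative_at[OF X[OF V(2)], symmetric] D[OF V(2)]
      by (simp add: j_def mult.commute)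
    moreover have "frechet_derivative X (at p) (0, 0) = 0"
      using frechet_derivative_at[OF X[OF V(2)], symmetric] D[OF V(2)] by simp
    ultimately have "(v2 p, - v1 p) = (0, 0)" "(u2 p, - u1 p) = (0, 0)"
      using inj by (metis injD)+
    then have "frechet_derivative X (at p) (1, 0) = 0"
      using frechet_derivative_at[OF X[OF V(2)], symmetric] D[OF V(2)] by simp
    then show False using \<open>frechet_derivative X (at p) (0, 0) = 0\<close> inj
      by (metis injD prod.inject zero_neq_one)
  qed
  note s1 = smooth_on_pd(1)[OF sm] and s2 = smooth_on_pd(2)[OF sm]
  have contj: "continuous_on V j"
    unfolding j_def uv
    by (intro continuous_intros smooth_on_imp_continuous_on[OF s1] smooth_on_imp_continuous_on[OF s2])
  \<comment> \<open>The sign of the Jacobian is constant near \<open>p\<close>, so it can be taken out of the derivatives.\<close>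
  define \<sigma> where "\<sigma> = sgn (j p)"
  define V' where "V' = V \<inter> j -` {x. sgn x = \<sigma>}"
  have "open {x::real. sgn x = \<sigma>}"
  proof (cases "j p > 0")
    case True
    then have "{x::real. sgn x = \<sigma>} = {0<..}" by (auto simp: \<sigma>_def sgn_real_def)
    then show ?thesis by simp
  next
    case False
    then have "{x::real. sgn x = \<sigma>} = {..<0}" using jp by (auto simp: \<sigma>_def sgn_real_def)
    then show ?thesis by simp
  qed
  then have V': "open V'" "p \<in> V'"
    using continuous_open_preimage[OF contj V(1), of "{x. sgn x = \<sigma>}"] V(2)
    unfolding V'_def by (simp_all add: \<sigma>_def)
  obtain u1' where u1': "(u1 has_derivative u1') (at p)"
    using smooth_on_differentiable[OF s1 V(2)] unfolding uv differentiable_def by (blast intro: has_derivative_fst)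
  obtain u2' where u2': "(u2 has_derivative u2') (at p)"
    using smooth_on_differentiable[OF s2 V(2)] unfolding uv differentiable_def by (blast intro: has_derivative_fst)
  obtain v1' where v1': "(v1 has_derivative v1') (at p)"
    using smooth_on_differentiable[OF s1 V(2)] unfolding uv differentiable_def by (blast intro: has_derivative_snd)
  obtain v2' where v2': "(v2 has_derivative v2') (at p)"
    using smooth_on_differentiable[OF s2 V(2)] unfolding uv differentiable_def by (blast intro: has_derivative_snd)
  have du: "((\<lambda>q. fst (\<phi> q)) has_derivative (\<lambda>h. fst h * u1 q + snd h * u2 q)) (at q)"
    and dv: "((\<lambda>q. snd (\<phi> q)) has_derivative (\<lambda>h. fst h * v1 q + snd h * v2 q)) (at q)"
    if "q \<in> V" for q
    using has_derivative_fst[OF d\<phi>[OF that]] has_derivative_snd[OF d\<phi>[OF that]]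
    by (simp_all add: uv)
  have u12: "u1' (0, 1) = u2' (1, 0)"
    by (rule mixed_partials_commute[OF V du u1' u2'])
  have v12: "v1' (0, 1) = v2' (1, 0)"
    by (rule mixed_partials_commute[OF V dv v1' v2'])
  have dP: "((\<lambda>q. P (\<phi> q)) has_derivative (\<lambda>h. P' (fst h *\<^sub>R pd1 \<phi> p + snd h *\<^sub>R pd2 \<phi> p))) (at p)"
    using has_derivative_compose[OF d\<phi>[OF V(2)]] P by (auto simp: P_def)
  have dQ: "((\<lambda>q. Q (\<phi> q)) has_derivative (\<lambda>h. Q' (fst h *\<^sub>R pd1 \<phi> p + snd h *\<^sub>R pd2 \<phi> p))) (at p)"
    using has_derivative_compose[OF d\<phi>[OF V(2)]] Q by (auto simp: Q_def)
  have P'lin: "P' z = fst z * P' (1, 0) + snd z * P' (0, 1)" for z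
    by (subst linear_pair[OF has_derivative_linear[OF P]]) simp
  have Q'lin: "Q' z = fst z * Q' (1, 0) + snd z * Q' (0, 1)" for z
    by (subst linear_pair[OF has_derivative_linear[OF Q]]) simp
  have fl1: "(gG X q * pd1 \<beta> q - gF X q * pd2 \<beta> q) / area_density X q
      = \<sigma> * (v2 q * P (\<phi> q) - u2 q * Q (\<phi> q))" 
    and fl2: "(gE X q * pd2 \<beta> q - gF X q * pd1 \<beta> q) / area_density X q
      = \<sigma> * (u1 q * Q (\<phi> q) - v1 q * P (\<phi> q))" if "q \<in> V'" for q
    using flux1[of q] flux2[of q] that unfolding V'_def by simp_all
  have pd\<phi>: "pd1 \<phi> p = (u1 p, v1 p)" "pd2 \<phi> p = (u2 p, v2 p)"
    by (simp_all add: uv)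
  have div1: "pd1 (\<lambda>q. (gG X q * pd1 \<beta> q - gF X q * pd2 \<beta> q) / area_density X q) p =
     \<sigma> * (v2 p * P' (u1 p, v1 p) + v2' (1, 0) * P (\<phi> p) - (u2 p * Q' (u1 p, v1 p) + u2' (1, 0) * Q (\<phi> p)))"
    using pd_eq_on_open(1)[OF V' has_derivative_mult_right[OF has_derivative_diff[OF
        has_derivative_mult[OF v2' dP] has_derivative_mult[OF u2' dQ]], of \<sigma>] fl1]
    by (simp add: pd\<phi>)
  have div2: "pd2 (\<lambda>q. (gE X q * pd2 \<beta> q - gF X q * pd1 \<beta> q) / area_density X q) p =
     \<sigma> * (u1 p * Q' (u2 p, v2 p) + u1' (0, 1) * Q (\<phi> p) - (v1 p * P' (u2 p, v2 p) + v1' (0, 1) * P (\<phi> p)))"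
    using pd_eq_on_open(2)[OF V' has_derivative_mult_right[OF has_derivative_diff[OF
        has_derivative_mult[OF u1' dQ] has_derivative_mult[OF v1' dP]], of \<sigma>] fl2]
    by (simp add: pd\<phi>)
  have "pd1 (\<lambda>q. (gG X q * pd1 \<beta> q - gF X q * pd2 \<beta> q) / area_density X q) p +
      pd2 (\<lambda>q. (gE X q * pd2 \<beta> q - gF X q * pd1 \<beta> q) / area_density X q) p
      = \<sigma> * (j p * (P' (1, 0) + Q' (0, 1)))"
    unfolding div1 div2 u12 v12 P'lin[of "(u1 p, v1 p)"] Q'lin[of "(u1 p, v1 p)"]
       P'lin[of "(u2 p, v2 p)"] Q'lin[of "(u2 p, v2 p)"] j_def fst_conv snd_conv
    by (simp add: algebra_simps)
  also have "\<sigma> * (j p * (P' (1, 0) + Q' (0, 1))) = \<bar>j p\<bar> * (P' (1, 0) + Q' (0, 1))"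
    by (simp add: \<sigma>_def sgn_real_def)
  finally show ?thesis
    unfolding laplacian_def area[OF V(2)] using jp by simp
qed

text \<open>
Up to a real factor and a constant, \<open>exp (i \<beta>)\<close> is the complex function \<open>\<zeta>\<close>. The real factor does
not contribute to the imaginary part of the logarithmic derivative, so \<open>d\<beta> = Im (d\<zeta> / \<zeta>)\<close>; in
particular neither the frame nor its orientation enters.
\<close>

lemma angle_derivative:
  fixes \<beta> :: "'a::real_normed_vector \<Rightarrow> real" and \<zeta> :: "'a \<Rightarrow> complex"
  assumes V: "open V" "p \<in> V" and \<beta>: "\<beta> differentiable (at p)"
    and \<zeta>: "(\<zeta> has_derivative \<zeta>') (at p)"
    and eq: "\<And>q. q \<in> V \<Longrightarrow> \<exists>r::real. cis (\<beta> q) = of_real r * K * \<zeta> q"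
  shows "(\<beta> has_derivative (\<lambda>h. Im (\<zeta>' h * cnj (\<zeta> p)) / (cmod (\<zeta> p))\<^sup>2)) (at p)"
proof -
  obtain \<beta>' where \<beta>': "(\<beta> has_derivative \<beta>') (at p)" using \<beta> unfolding differentiable_def by blast
  have dcis: "((\<lambda>q. cis (- \<beta> q)) has_derivative (\<lambda>h. - \<beta>' h *\<^sub>R (\<i> * cis (- \<beta> p)))) (at p)"
    by (rule derivative_eq_intros \<beta>' refl)+
  define F where "F = (\<lambda>q. Im (cis (- \<beta> q) * (K * \<zeta> q)))"
  have F0: "F q = 0 \<and> K * \<zeta> q \<noteq> 0" if qV: "q \<in> V" for q
  proof -
    obtain r where r: "cis (\<beta> q) = of_real r * K * \<zeta> q" using eq[OF qV] by blast
    have 1: "cis (- \<beta> q) * cis (\<beta> q) = 1" by (simp add: cis_mult)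
    have r0: "r \<noteq> 0" using r cis_neq_zero by (metis mult_zero_left of_real_0)
    have "of_real r * (cis (- \<beta> q) * (K * \<zeta> q)) = 1" using 1 r by (simp add: algebra_simps)
    then have "cis (- \<beta> q) * (K * \<zeta> q) = of_real (1 / r)" using r0 by (simp add: field_simps)
    then show ?thesis using r r0 unfolding F_def by auto
  qed
  have dF: "(F has_derivative (\<lambda>h. Im (cis (- \<beta> p) * (K * \<zeta>' h) + (- \<beta>' h *\<^sub>R (\<i> * cis (- \<beta> p))) * (K * \<zeta> p)))) (at p)"
    
    unfolding F_def by (intro has_derivative_Im has_derivative_mult dcis has_derivative_mult_right \<zeta>)
  have "(F has_derivative (\<lambda>h. 0)) (at p)"
    by (rule has_derivative_transform_within_open[OF has_derivative_const[of 0] V]) (simp add: F0)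
  from fun_cong[OF has_derivative_unique[OF dF this]] have zero: "Im (cis (- \<beta> p) * (K * \<zeta>' h) + (- \<beta>' h *\<^sub>R (\<i> * cis (- \<beta> p))) * (K * \<zeta> p)) = 0" for h
    by blast
  define r where "r = Re (cis (- \<beta> p) * (K * \<zeta> p))"
  have r: "cis (- \<beta> p) * (K * \<zeta> p) = of_real r" "r \<noteq> 0"
  proof -
    show 1: "cis (- \<beta> p) * (K * \<zeta> p) = of_real r"
      using F0[OF V(2)] unfolding F_def r_def by (intro complex_eqI) simp_all
    have "cis (- \<beta> p) * (K * \<zeta> p) \<noteq> 0" using F0[OF V(2)] cis_neq_zero[of "- \<beta> p"] by simp
    then show "r \<noteq> 0" unfolding 1 by simp
  qed
  have z0: "\<zeta> p \<noteq> 0" using F0[OF V(2)] by auto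
  have "\<beta>' h = Im (\<zeta>' h * cnj (\<zeta> p)) / (cmod (\<zeta> p))\<^sup>2" for h
  proof -
    define w where "w = \<zeta>' h / \<zeta> p"
    have "cis (- \<beta> p) * (K * \<zeta>' h) = of_real r * w"
      using z0 r(1) by (simp add: field_simps w_def)
    moreover have "(- \<beta>' h *\<^sub>R (\<i> * cis (- \<beta> p))) * (K * \<zeta> p) = - \<i> * of_real (\<beta>' h) * of_real r"
      using r(1) by (simp add: scaleR_conv_of_real algebra_simps)
    ultimately have "Im (of_real r * w + - \<i> * of_real (\<beta>' h) * of_real r) = 0"
      using zero[of h] by (simp only:)
    then have "r * (Im w - \<beta>' h) = 0" by (simp add: algebra_simps)
    then have "\<beta>' h = Im (\<zeta>' h / \<zeta> p)" using r(2) by (simp add: w_def)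
    also have "\<dots> = Im (\<zeta>' h * cnj (\<zeta> p)) / (cmod (\<zeta> p))\<^sup>2"
      by (subst complex_div_cnj) (simp add: Im_divide_of_real flip: of_real_power)
    finally show ?thesis .
  qed
  then have "\<beta>' = (\<lambda>h. Im (\<zeta>' h * cnj (\<zeta> p)) / (cmod (\<zeta> p))\<^sup>2)" by blast
  then show ?thesis using \<beta>' by simp
qed

section \<open>Hermitian geometry of the complex plane C^2\<close>

definition cscale :: "complex \<Rightarrow> complex \<times> complex \<Rightarrow> complex \<times> complex" where
  "cscale z p = (z * fst p, z * snd p)"

text \<open>
The Hermitian product, conjugate linear in the second argument.
\<close>

definition hprod :: "complex \<times> complex \<Rightarrow> complex \<times> complex \<Rightarrow> complex" where
  "hprod p q = fst p * cnj (fst q) + snd p * cnj (snd q)"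

text \<open>
Multiplication by the quaternion unit \<open>j\<close>, up to conventions: a real linear isometry which sends
every vector to a vector spanning its Hermitian orthogonal complement.
\<close>

definition hperp :: "complex \<times> complex \<Rightarrow> complex \<times> complex" where
  "hperp p = (cnj (snd p), - cnj (fst p))"

lemma cscale_simps [simp]: "fst (cscale z p) = z * fst p" "snd (cscale z p) = z * snd p"
  by (simp_all add: cscale_def)

lemma cscale_add_right: "cscale z (p + q) = cscale z p + cscale z q"
  and cscale_add_left: "cscale (z + w) p = cscale z p + cscale w p"
  and cscale_cscale: "cscale z (cscale w p) = cscale (z * w) p"
  and cscale_scaleR_left: "cscale (r *\<^sub>R z) p = r *\<^sub>R cscale z p"
  and cscale_scaleR_right: "cscale z (r *\<^sub>R p) = r *\<^sub>R cscale z p"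
  by (simp_all add: cscale_def prod_eq_iff algebra_simps)

lemma inner_eq_hprod: "p \<bullet> q = Re (hprod p q)"
  by (cases p; cases q) (simp add: hprod_def inner_complex_def)

lemma norm_cscale: "norm (cscale z p) = cmod z * norm p"
  by (simp add: cscale_def norm_prod_def norm_mult power_mult_distrib
        flip: distrib_left add: real_sqrt_mult)

lemma bounded_bilinear_cscale: "bounded_bilinear cscale"
  by (rule bounded_bilinear.intro)
     (auto simp: cscale_add_right cscale_add_left cscale_scaleR_left cscale_scaleR_right norm_cscale
        intro!: exI[of _ 1])

lemmas has_vector_derivative_cscale = bounded_bilinear.has_vector_derivative[OF bounded_bilinear_cscale]
lemmas has_derivative_cscale = bounded_bilinear.FDERIV[OF bounded_bilinear_cscale]

lemma hprod_self: "hprod p p = of_real ((norm p)\<^sup>2)"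
  by (simp add: hprod_def norm_prod_def complex_mult_cnj cmod_power2 flip: of_real_power)

lemma hprod_hperp [simp]: "hprod p (hperp p) = 0" "hprod (hperp p) p = 0"
  by (simp_all add: hprod_def hperp_def)

lemma norm_hperp [simp]: "norm (hperp p) = norm p"
  by (simp add: hperp_def norm_prod_def add.commute)

lemma hprod_cscale: "hprod (cscale z p) q = z * hprod p q" "hprod p (cscale z q) = cnj z * hprod p q"
  by (simp_all add: hprod_def algebra_simps)

lemma hprod_add: "hprod (p + p') q = hprod p q + hprod p' q" "hprod p (q + q') = hprod p q + hprod p q'"
  by (simp_all add: hprod_def algebra_simps)

text \<open>
This produces the coefficient of \<open>\<gamma>'\<close> along \<open>hperp \<gamma>\<close> for a Legendrian curve \<open>\<gamma>\<close>. The coefficient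
is a polynomial in the coordinates and hence as smooth as \<open>\<gamma>'\<close>.
\<close>

lemma orthogonal_complement_line:
  assumes "norm p = 1" "hprod q p = 0"
  shows "q = cscale (fst q * snd p - snd q * fst p) (hperp p)"
proof -
  have 1: "fst p * cnj (fst p) + snd p * cnj (snd p) = 1"
    using hprod_self[of p] assms(1) by (simp add: hprod_def)
  have 2: "fst q * cnj (fst p) + snd q * cnj (snd p) = 0" using assms(2) by (simp add: hprod_def)
  have "fst q = (fst q * snd p - snd q * fst p) * cnj (snd p)" using 1 2 by algebra
  moreover have "snd q = (fst q * snd p - snd q * fst p) * (- cnj (fst p))" using 1 2 by algebra
  ultimately show ?thesis by (simp add: prod_eq_iff hperp_def)
qed

section \<open>Legendrian curves and trigonometric forms\<close>

lemma has_vector_derivative_fst': "(f has_vector_derivative f') F \<Longrightarrow> ((\<lambda>x. fst (f x)) has_vector_derivative fst f') F"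
  and has_vector_derivative_snd': "(f has_vector_derivative f') F \<Longrightarrow> ((\<lambda>x. snd (f x)) has_vector_derivative snd f') F"
  by (auto simp: has_vector_derivative_def dest: has_derivative_fst has_derivative_snd)

text \<open>
The condition \<open>\<gamma>' \<bullet> J \<gamma> = 0\<close> and the constant norm of \<open>\<gamma>\<close> are the imaginary and the real part of one
Hermitian orthogonality relation. Two derivatives of the coefficient are recorded since the
stationary equation is of second order in it.
\<close>

lemma legendrian_frame:
  assumes I: "open I" and leg: "legendrian_on I \<gamma>"
  obtains a a' a'' where
    "\<And>s. s \<in> I \<Longrightarrow> (\<gamma> has_vector_derivative cscale (a s) (hperp (\<gamma> s))) (at s)"
    "\<And>s. s \<in> I \<Longrightarrow> (a has_vector_derivative a' s) (at s)"
    "\<And>s. s \<in> I \<Longrightarrow> (a' has_vector_derivative a'' s) (at s)"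
proof -
  have sm: "smooth_on I \<gamma>" using leg by (simp add: legendrian_on_def)
  obtain g1 where g1: "smooth_on I g1" "\<And>s. s \<in> I \<Longrightarrow> (\<gamma> has_vector_derivative g1 s) (at s)"
    using smooth_on_has_vector_derivative[OF sm] by blast
  obtain g2 where g2: "smooth_on I g2" "\<And>s. s \<in> I \<Longrightarrow> (g1 has_vector_derivative g2 s) (at s)"
    using smooth_on_has_vector_derivative[OF g1(1)] by blast
  obtain g3 where g3: "\<And>s. s \<in> I \<Longrightarrow> (g2 has_vector_derivative g3 s) (at s)"
    using smooth_on_has_vector_derivative[OF g2(1)] by blast
  define a where "a = (\<lambda>s. fst (g1 s) * snd (\<gamma> s) - snd (g1 s) * fst (\<gamma> s))"
  define a' where "a' = (\<lambda>s. fst (g2 s) * snd (\<gamma> s) - snd (g2 s) * fst (\<gamma> s))"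
  define a'' where "a'' = (\<lambda>s. fst (g2 s) * snd (g1 s) + fst (g3 s) * snd (\<gamma> s)
     - (snd (g2 s) * fst (g1 s) + snd (g3 s) * fst (\<gamma> s)))"
  note d = has_vector_derivative_fst' has_vector_derivative_snd' has_vector_derivative_mult
     has_vector_derivative_diff
  show ?thesis
  proof
    fix s assume s: "s \<in> I"
    have n: "norm (\<gamma> s) = 1" and "vector_derivative \<gamma> (at s) \<bullet> J (\<gamma> s) = 0"
      using leg s by (auto simp: legendrian_on_def)
    then have lj: "g1 s \<bullet> J (\<gamma> s) = 0" using vector_derivative_at[OF g1(2)[OF s]] by simp
    have "((\<lambda>x. \<gamma> x \<bullet> \<gamma> x) has_derivative (\<lambda>h. \<gamma> s \<bullet> (h *\<^sub>R g1 s) + (h *\<^sub>R g1 s) \<bullet> \<gamma> s)) (at s)"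
      by (rule has_derivative_inner[OF g1(2)[OF s, unfolded has_vector_derivative_def]
            g1(2)[OF s, unfolded has_vector_derivative_def]])
    moreover have "((\<lambda>x. \<gamma> x \<bullet> \<gamma> x) has_derivative (\<lambda>h. 0)) (at s)"
      by (rule has_derivative_transform_within_open[OF has_derivative_const[of 1] I s])
         (use leg in \<open>simp add: legendrian_on_def dot_square_norm\<close>)
    ultimately have "(\<lambda>h. \<gamma> s \<bullet> (h *\<^sub>R g1 s) + (h *\<^sub>R g1 s) \<bullet> \<gamma> s) = (\<lambda>h. 0)"
      by (rule has_derivative_unique)
    from fun_cong[OF this, of 1] have "\<gamma> s \<bullet> g1 s + g1 s \<bullet> \<gamma> s = 0" by simp
    then have "Re (hprod (g1 s) (\<gamma> s)) = 0" by (simp add: inner_commute flip: inner_eq_hprod)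
    moreover have "Im (hprod (g1 s) (\<gamma> s)) = 0"
      using lj unfolding inner_eq_hprod by (simp add: hprod_def J_def algebra_simps)
    ultimately have "hprod (g1 s) (\<gamma> s) = 0" by (simp add: complex_eq_iff)
    then have "g1 s = cscale (a s) (hperp (\<gamma> s))"
      using orthogonal_complement_line[OF n] by (simp add: a_def)
    then show "(\<gamma> has_vector_derivative cscale (a s) (hperp (\<gamma> s))) (at s)" using g1(2)[OF s] by simp
    have "(a has_vector_derivative (fst (g1 s) * snd (g1 s) + fst (g2 s) * snd (\<gamma> s)
       - (snd (g1 s) * fst (g1 s) + snd (g2 s) * fst (\<gamma> s)))) (at s)"
      unfolding a_def by (intro d g1 g2 s)
    then show "(a has_vector_derivative a' s) (at s)" by (simp add: a'_def algebra_simps)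
    show "(a' has_vector_derivative a'' s) (at s)"
      unfolding a'_def a''_def by (intro d g1 g2 g3 s)
  qed
qed

text \<open>
The base point \<open>s0\<close> can lie on either side of \<open>s\<close>, hence the fundamental theorem of calculus is
applied on an interval that contains both in its interior.
\<close>

lemma type_II_integral_derivative:
  assumes I: "open I" "is_interval I" "s0 \<in> I" "s \<in> I" and f: "continuous_on I f"
  shows "((\<lambda>s. LBINT u=ereal s0..ereal s. (f u :: complex \<times> complex)) has_vector_derivative f s) (at s)"
proof -
  have mm: "min s0 s \<in> I" "max s0 s \<in> I" using I by (auto simp: min_def max_def)
  obtain d1 where d1: "d1 > 0" "cball (min s0 s) d1 \<subseteq> I" using I(1) mm open_contains_cball by blast
  obtain d2 where d2: "d2 > 0" "cball (max s0 s) d2 \<subseteq> I" using I(1) mm open_contains_cball by blast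
  define l r where "l = min s0 s - d1" and "r = max s0 s + d2"
  have "l \<in> cball (min s0 s) d1" "r \<in> cball (max s0 s) d2"
    using d1 d2 by (simp_all add: l_def r_def dist_real_def)
  then have lr: "l \<in> I" "r \<in> I" using d1 d2 by blast+
  have sub: "{l..r} \<subseteq> I" using mem_is_interval_1_I[OF I(2) lr] by auto
  have "((\<lambda>u. LBINT y=s0..u. f y) has_vector_derivative f s) (at s within {l..r})"
    by (rule interval_integral_FTC2)
       (use d1 d2 continuous_on_subset[OF f sub] in \<open>auto simp: l_def r_def\<close>)
  moreover have "at s within {l..r} = at s"
    by (rule at_within_interior) (use d1 d2 in \<open>auto simp: l_def r_def interior_atLeastAtMost_real\<close>)
  ultimately show ?thesis by simp
qed

lemma trig_form_derivative:
  assumes "(r has_vector_derivative r') (at (fst z))" "(w has_vector_derivative w') (at (fst z))"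
  shows "((\<lambda>z. r (fst z) + Re (w (fst z) * cis (snd z))) has_derivative
     (\<lambda>h. fst h * (r' + Re (w' * cis (snd z))) + snd h * Re (\<i> * w (fst z) * cis (snd z)))) (at z)"
proof -
  have f: "(fst has_derivative fst) (at z)" and s: "(snd has_derivative snd) (at z)"
    by (auto intro: derivative_eq_intros)
  have r: "((\<lambda>z. r (fst z)) has_derivative (\<lambda>h. fst h *\<^sub>R r')) (at z)"
    using has_derivative_compose[OF f assms(1)[unfolded has_vector_derivative_def]] .
  have w: "((\<lambda>z. w (fst z)) has_derivative (\<lambda>h. fst h *\<^sub>R w')) (at z)"
    using has_derivative_compose[OF f assms(2)[unfolded has_vector_derivative_def]] .
  have c: "((\<lambda>z. cis (snd z)) has_derivative (\<lambda>h. snd h *\<^sub>R (\<i> * cis (snd z)))) (at z)"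
    by (rule has_derivative_cis[OF s])
  show ?thesis
    by (rule has_derivative_eq_rhs[OF has_derivative_add[OF r has_derivative_Re[OF has_derivative_mult[OF w c]]]])
       (simp add: fun_eq_iff algebra_simps)
qed

text \<open>
With \<open>E = L\<close>, \<open>G = C\<close>, \<open>b1 = M / L\<close> and \<open>b2 = N / L\<close> these are the two fluxes whose divergence is the
Laplacian of the angle. Their derivatives are brought to the common denominators \<open>L^{5/2}\<close> and
\<open>L^{3/2}\<close>, which leaves polynomials in the forms and their derivatives.
\<close>

lemma flux_derivative_1:
  assumes "(M has_derivative M') (at z)" "(L has_derivative L') (at z)" "L z > 0" "C > 0"
  shows "((\<lambda>z. sqrt (C / L z) * (M z / L z)) has_derivative
     (\<lambda>h. sqrt C * (M' h * L z - 3/2 * M z * L' h) / ((L z)\<^sup>2 * sqrt (L z)))) (at z)"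
proof -
  define S where "S = sqrt (L z)"
  have S: "S > 0" "L z = S * S" using assms by (auto simp: S_def)
  have dS: "((\<lambda>z. sqrt (L z)) has_derivative (\<lambda>h. L' h / (2 * S))) (at z)"
    by (rule has_derivative_eq_rhs[OF has_derivative_real_sqrt[OF assms(3,2)]]) 
       (simp add: S_def divide_simps fun_eq_iff)
  have "sqrt C * ((M' h * (L z * sqrt (L z)) - M z * (L z * (L' h / (2 * S)) + L' h * sqrt (L z)))
        / (L z * sqrt (L z) * (L z * sqrt (L z))))
     = sqrt C * (M' h * L z - 3/2 * M z * L' h) / ((L z)\<^sup>2 * sqrt (L z))" for h
    using S(1) assms(4) unfolding S_def[symmetric] S(2) by (simp add: field_simps power2_eq_square)
  moreover have L0: "L z * sqrt (L z) \<noteq> 0" using assms(3) by simp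
  ultimately have "((\<lambda>z. sqrt C * (M z / (L z * sqrt (L z)))) has_derivative
     (\<lambda>h. sqrt C * (M' h * L z - 3/2 * M z * L' h) / ((L z)\<^sup>2 * sqrt (L z)))) (at z)"
    using has_derivative_mult_right[OF has_derivative_divide'[OF assms(1) has_derivative_mult[OF assms(2) dS] L0],
       of "sqrt C"] by (simp only:)
  moreover have "(\<lambda>z. sqrt (C / L z) * (M z / L z)) = (\<lambda>z. sqrt C * (M z / (L z * sqrt (L z))))"
    by (rule ext) (simp add: real_sqrt_divide divide_simps)
  ultimately show ?thesis by (simp only:)
qed

lemma flux_derivative_2:
  assumes "(N has_derivative N') (at z)" "(L has_derivative L') (at z)" "L z > 0" "C > 0"
  shows "((\<lambda>z. sqrt (L z / C) * (N z / L z)) has_derivative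
     (\<lambda>h. (N' h * L z - 1/2 * N z * L' h) / (sqrt C * L z * sqrt (L z)))) (at z)"
proof -
  define S where "S = sqrt (L z)"
  have S: "S > 0" "L z = S * S" using assms by (auto simp: S_def)
  have dS: "((\<lambda>z. sqrt (L z)) has_derivative (\<lambda>h. L' h / (2 * S))) (at z)"
    by (rule has_derivative_eq_rhs[OF has_derivative_real_sqrt[OF assms(3,2)]]) 
       (simp add: S_def divide_simps fun_eq_iff)
  have "inverse (sqrt C) * (sqrt (L z) * ((N' h * L z - N z * L' h) / (L z * L z)) + L' h / (2 * S) * (N z / L z))
     = (N' h * L z - 1/2 * N z * L' h) / (sqrt C * L z * sqrt (L z))" for h
    using S(1) assms(4) unfolding S_def[symmetric] S(2) by (simp add: field_simps)
  moreover have L0: "L z \<noteq> 0" using assms(3) by simp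
  ultimately have "((\<lambda>z. inverse (sqrt C) * (sqrt (L z) * (N z / L z))) has_derivative
     (\<lambda>h. (N' h * L z - 1/2 * N z * L' h) / (sqrt C * L z * sqrt (L z)))) (at z)"
    using has_derivative_mult_right[OF has_derivative_mult[OF dS has_derivative_divide'[OF assms(1,2) L0]],
       of "inverse (sqrt C)"] by (simp only:)
  moreover have "(\<lambda>z. sqrt (L z / C) * (N z / L z)) = (\<lambda>z. inverse (sqrt C) * (sqrt (L z) * (N z / L z)))"
    by (rule ext) (simp add: real_sqrt_divide divide_simps)
  ultimately show ?thesis by (simp only:)
qed

section \<open>Type II surfaces: metric, angle and the stationary equation\<close>

lemma congruence_cscale:
  assumes "congruence g"
  obtains A b where "g = (\<lambda>p. A p + b)" "orthogonal_transformation A" "\<And>z p. A (cscale z p) = cscale z (A p)"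
proof -
  obtain A b where A: "orthogonal_transformation A" "\<And>p. A (J p) = J (A p)" "g = (\<lambda>p. A p + b)"
    using assms unfolding congruence_def by blast
  interpret linear A using A(1) orthogonal_transformation_linear by blast
  have dec: "cscale z p = Re z *\<^sub>R p + Im z *\<^sub>R J p" for z p
    by (simp add: cscale_def J_def prod_eq_iff complex_eq_iff)
  have "A (cscale z p) = cscale z (A p)" for z p
    unfolding dec by (simp add: add scaleR A(2))
  with A that show ?thesis by blast
qed

text \<open>
A congruence changes \<open>detC\<close> by a constant factor only, and a change of basis of a tangent plane by a
real one (next lemma). Both are harmless in \<open>angle_derivative\<close>.
\<close>

lemma detC_complex_linear:
  assumes "linear A" "\<And>z p. A (cscale z p) = cscale z (A p)"
  shows "detC (A p) (A q) = detC (A (1, 0)) (A (0, 1)) * detC p q"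
proof -
  have A: "A p = cscale (fst p) (A (1, 0)) + cscale (snd p) (A (0, 1))" for p
  proof -
    have "p = cscale (fst p) (1, 0) + cscale (snd p) (0, 1)" by (simp add: cscale_def prod_eq_iff)
    then have "A p = A (cscale (fst p) (1, 0) + cscale (snd p) (0, 1))" by (rule arg_cong)
    then show ?thesis using assms by (simp only: linear_add)
  qed
  show ?thesis by (subst A[of p], subst A[of q]) (simp add: detC_def algebra_simps)
qed

lemma detC_real_combination:
  "detC (x *\<^sub>R e + y *\<^sub>R f) (z *\<^sub>R e + w *\<^sub>R f) = of_real (x * w - y * z) * detC e f"
  by (simp add: detC_def scaleR_conv_of_real algebra_simps)

lemma fst_derivative: "(f has_vector_derivative f') (at (fst z)) \<Longrightarrow>
    ((\<lambda>z. f (fst z)) has_derivative (\<lambda>h. fst h *\<^sub>R f')) (at z)"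
  unfolding has_vector_derivative_def
  by (rule has_derivative_compose[where f = fst]) (auto intro: derivative_eq_intros)

lemma cis_snd_derivative: "((\<lambda>z. cis (snd z)) has_derivative (\<lambda>h. snd h *\<^sub>R (\<i> * cis (snd z)))) (at z)"
  by (rule has_derivative_cis) (auto intro: derivative_eq_intros)

text \<open>
The data of a type II surface: the Legendrian curve \<open>\<gamma>\<close> with the coefficient \<open>b\<close> of its velocity, the
translation part \<open>Z\<close> and its coefficient \<open>W\<close>, with two derivatives each. Nondegeneracy is kept apart
from this locale because it is a consequence of the immersion property of the surface \<open>Y\<close> built here.
\<close>

locale legendrian_profile =
  fixes I :: "real set" and c :: real and \<gamma> Z :: "real \<Rightarrow> complex \<times> complex"
    and b b' b'' W W' W'' :: "real \<Rightarrow> complex"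
  assumes norm_\<gamma>: "\<And>s. s \<in> I \<Longrightarrow> norm (\<gamma> s) = 1"
    and d\<gamma>_b: "\<And>s. s \<in> I \<Longrightarrow> (\<gamma> has_vector_derivative cscale (b s) (hperp (\<gamma> s))) (at s)"
    and dZ: "\<And>s. s \<in> I \<Longrightarrow> (Z has_vector_derivative cscale (W s) (hperp (\<gamma> s))) (at s)"
    and db: "\<And>s. s \<in> I \<Longrightarrow> (b has_vector_derivative b' s) (at s)"
    and db': "\<And>s. s \<in> I \<Longrightarrow> (b' has_vector_derivative b'' s) (at s)"
    and dW: "\<And>s. s \<in> I \<Longrightarrow> (W has_vector_derivative W' s) (at s)"
    and dW': "\<And>s. s \<in> I \<Longrightarrow> (W' has_vector_derivative W'' s) (at s)"
begin

definition Y :: "real \<times> real \<Rightarrow> complex \<times> complex" where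
  "Y z = cscale (c * cis (snd z)) (\<gamma> (fst z)) + Z (fst z)"

definition a :: "real \<Rightarrow> complex" where "a s = c * b s"
definition a' :: "real \<Rightarrow> complex" where "a' s = c * b' s"

definition \<alpha> :: "real \<times> real \<Rightarrow> complex" where
  "\<alpha> z = a (fst z) * cis (snd z) + W (fst z)"

lemma Y_derivative:
  assumes "fst z \<in> I"
  shows "(Y has_derivative (\<lambda>h. fst h *\<^sub>R cscale (\<alpha> z) (hperp (\<gamma> (fst z)))
     + snd h *\<^sub>R cscale (\<i> * c * cis (snd z)) (\<gamma> (fst z)))) (at z)"
proof -
  have "((\<lambda>z. cscale (c * cis (snd z)) (\<gamma> (fst z)) + Z (fst z)) has_derivative (\<lambda>h.
      cscale (c * cis (snd z)) (fst h *\<^sub>R cscale (b (fst z)) (hperp (\<gamma> (fst z))))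
      + cscale (c * (snd h *\<^sub>R (\<i> * cis (snd z)))) (\<gamma> (fst z))
      + fst h *\<^sub>R cscale (W (fst z)) (hperp (\<gamma> (fst z))))) (at z)"
    by (intro has_derivative_add has_derivative_cscale has_derivative_mult_right
         fst_derivative cis_snd_derivative d\<gamma>_b dZ assms)
  then show ?thesis unfolding Y_def[abs_def]
    by (rule has_derivative_eq_rhs)
       (simp add: fun_eq_iff prod_eq_iff \<alpha>_def a_def scaleR_conv_of_real algebra_simps)
qed

lemma immersion_nondegenerate:
  assumes imm: "immersion_on (I \<times> UNIV) Y" and s: "s \<in> I"
  shows "c \<noteq> 0" "a s * cis t + W s \<noteq> 0"
proof -
  have s': "fst (s, t) \<in> I" using s by simp
  have "inj (frechet_derivative Y (at (s, t)))" using imm s by (simp add: immersion_on_def)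
  then have inj: "inj (\<lambda>h. fst h *\<^sub>R cscale (\<alpha> (s, t)) (hperp (\<gamma> s))
     + snd h *\<^sub>R cscale (\<i> * c * cis t) (\<gamma> s))"
    using frechet_derivative_at[OF Y_derivative[OF s']] by simp
  show "c \<noteq> 0"
    using injD[OF inj, of "(0, 1)" "(0, 0)"] by (auto simp: cscale_def zero_prod_def)
  show "a s * cis t + W s \<noteq> 0"
    using injD[OF inj, of "(1, 0)" "(0, 0)"] by (auto simp: cscale_def zero_prod_def \<alpha>_def)
qed

end

locale type_II_frame = legendrian_profile +
  assumes c: "c \<noteq> 0" and nz: "\<And>s t. s \<in> I \<Longrightarrow> a s * cis t + W s \<noteq> 0"
begin

lemma d\<gamma>: "s \<in> I \<Longrightarrow> (\<gamma> has_vector_derivative cscale (a s / c) (hperp (\<gamma> s))) (at s)"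
  using d\<gamma>_b[of s] c by (simp add: a_def)

lemma da: "s \<in> I \<Longrightarrow> (a has_vector_derivative a' s) (at s)"
  unfolding a_def[abs_def] a'_def by (intro has_vector_derivative_mult_right db)

lemma da': "s \<in> I \<Longrightarrow> (a' has_vector_derivative c * b'' s) (at s)"
  unfolding a'_def[abs_def] by (intro has_vector_derivative_mult_right db')

text \<open>
The coefficients of the three trigonometric forms \<open>L = |\<alpha>|^2\<close>, \<open>M = Im (\<alpha>_s cnj \<alpha>)\<close> and
\<open>N = L + Re (a e^{it} cnj \<alpha>)\<close>, where \<open>M / L\<close> and \<open>N / L\<close> are the partial derivatives of the angle. The
forms \<open>L\<close> and \<open>N\<close> both have their frequency one part governed by the same function \<open>q\<close>, which is what
makes the leading coefficient of the stationary equation a power of \<open>q\<close>.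
\<close>

definition q :: "real \<Rightarrow> complex" where "q s = a s * cnj (W s)"
definition l0 :: "real \<Rightarrow> real" where "l0 s = Re (a s * cnj (a s) + W s * cnj (W s))"
definition n0 :: "real \<Rightarrow> real" where "n0 s = Re (2 * a s * cnj (a s) + W s * cnj (W s))"
definition m0 :: "real \<Rightarrow> real" where "m0 s = Im (a' s * cnj (a s) + W' s * cnj (W s))"
definition m1 :: "real \<Rightarrow> complex" where "m1 s = \<i> * (a s * cnj (W' s) - a' s * cnj (W s))"

definition L where "L z = l0 (fst z) + Re (2 * q (fst z) * cis (snd z))"
definition M where "M z = m0 (fst z) + Re (m1 (fst z) * cis (snd z))"
definition N where "N z = n0 (fst z) + Re (3 * q (fst z) * cis (snd z))"

lemma norm_\<alpha>: "(cmod (\<alpha> z))\<^sup>2 = L z"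
proof -
  have "complex_of_real ((cmod (\<alpha> z))\<^sup>2) = \<alpha> z * cnj (\<alpha> z)" by (simp only: complex_norm_square)
  then have "(cmod (\<alpha> z))\<^sup>2 = Re (\<alpha> z * cnj (\<alpha> z))" by (metis Re_complex_of_real)
  also have "\<dots> = L z"
  proof -
    have cc: "cis (snd z) * cnj (cis (snd z)) = 1" by (simp add: cis_cnj cis_mult)
    have "\<alpha> z * cnj (\<alpha> z) = a (fst z) * cnj (a (fst z)) * (cis (snd z) * cnj (cis (snd z)))
        + W (fst z) * cnj (W (fst z)) + (q (fst z) * cis (snd z) + cnj (q (fst z) * cis (snd z)))"
      by (simp add: \<alpha>_def q_def algebra_simps)
    then show ?thesis unfolding cc L_def l0_def by simp
  qed
  finally show ?thesis .
qed

lemma \<alpha>_nonzero: "fst z \<in> I \<Longrightarrow> \<alpha> z \<noteq> 0"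
  using nz unfolding \<alpha>_def by blast

lemma L_pos: "fst z \<in> I \<Longrightarrow> L z > 0"
  unfolding norm_\<alpha>[symmetric] using \<alpha>_nonzero by simp

text \<open>
The determinant of the coordinate tangent vectors of \<open>Y\<close>, up to the constant \<open>i c\<close>; its argument is
therefore the Lagrangian angle up to a constant.
\<close>

definition \<zeta> :: "real \<times> real \<Rightarrow> complex" where "\<zeta> z = \<alpha> z * cis (snd z)"

lemma \<zeta>_derivative:
  assumes "fst z \<in> I"
  shows "(\<zeta> has_derivative (\<lambda>h. \<alpha> z * (snd h *\<^sub>R (\<i> * cis (snd z))) +
      (a (fst z) * (snd h *\<^sub>R (\<i> * cis (snd z))) + (fst h *\<^sub>R a' (fst z)) * cis (snd z)
         + fst h *\<^sub>R W' (fst z)) * cis (snd z))) (at z)"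
  unfolding \<zeta>_def[abs_def] unfolding \<alpha>_def
  by (intro has_derivative_add has_derivative_mult fst_derivative cis_snd_derivative da dW assms)

lemma \<zeta>_log_derivative:
  "Im ((\<alpha> z * (snd h *\<^sub>R (\<i> * cis (snd z))) +
      (a (fst z) * (snd h *\<^sub>R (\<i> * cis (snd z))) + (fst h *\<^sub>R a' (fst z)) * cis (snd z)
         + fst h *\<^sub>R W' (fst z)) * cis (snd z)) * cnj (\<zeta> z)) = fst h * M z + snd h * N z"
proof -
  obtain s t where z: "z = (s, t)" by (cases z)
  have cc: "cis t * cnj (cis t) = 1" by (simp add: cis_cnj cis_mult)
  have Re_cnj: "Re (x * cnj y) = Re (y * cnj x)" for x y by simp
  have 1: "(\<alpha> z * (snd h *\<^sub>R (\<i> * cis t)) +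
      (a s * (snd h *\<^sub>R (\<i> * cis t)) + (fst h *\<^sub>R a' s) * cis t
         + fst h *\<^sub>R W' s) * cis t) * cnj (\<zeta> z)
     = of_real (fst h) * ((a' s * cis t + W' s) * cnj (\<alpha> z)) * (cis t * cnj (cis t))
       + of_real (snd h) * (\<i> * (\<alpha> z * cnj (\<alpha> z) + a s * cis t * cnj (\<alpha> z))) * (cis t * cnj (cis t))"
    by (simp add: \<zeta>_def z scaleR_conv_of_real algebra_simps)
  have 2: "(a' s * cis t + W' s) * cnj (\<alpha> z) = a' s * cnj (a s) * (cis t * cnj (cis t)) + W' s * cnj (W s)
      + a' s * cnj (W s) * cis t + W' s * cnj (a s) * cnj (cis t)"
    by (simp add: \<alpha>_def z algebra_simps)
  have 3: "Im ((a' s * cis t + W' s) * cnj (\<alpha> z)) = M z"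
    unfolding 2 cc M_def m0_def m1_def by (simp add: z algebra_simps)
  have 4: "a s * cis t * cnj (\<alpha> z) = a s * cnj (a s) * (cis t * cnj (cis t)) + q s * cis t"
    by (simp add: \<alpha>_def z q_def algebra_simps)
  have 5: "Re (\<alpha> z * cnj (\<alpha> z)) = L z"
    using norm_\<alpha>[of z] complex_norm_square[of "\<alpha> z"] by (metis Re_complex_of_real)
  have 6: "Re (\<alpha> z * cnj (\<alpha> z) + a s * cis t * cnj (\<alpha> z)) = N z"
    unfolding plus_complex.sel 5 4 cc L_def N_def l0_def n0_def by (simp add: z algebra_simps)
  have "Im (of_real (fst h) * ((a' s * cis t + W' s) * cnj (\<alpha> z)) * (cis t * cnj (cis t))
       + of_real (snd h) * (\<i> * (\<alpha> z * cnj (\<alpha> z) + a s * cis t * cnj (\<alpha> z))) * (cis t * cnj (cis t)))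
     = fst h * Im ((a' s * cis t + W' s) * cnj (\<alpha> z)) + snd h * Re (\<alpha> z * cnj (\<alpha> z) + a s * cis t * cnj (\<alpha> z))"
    unfolding cc by (simp only: mult_1_right plus_complex.sel Im_complex_of_real Re_complex_of_real
        times_complex.sel imaginary_unit.sel) simp
  then show ?thesis unfolding 3 6 1[symmetric] by (simp add: z)
qed

lemma hperp_orthogonal: "cscale u (hperp p) \<bullet> cscale v p = 0"
  unfolding inner_eq_hprod hprod_cscale by simp

text \<open>
The equation \<open>\<Delta>\<beta> = 0\<close>, multiplied by \<open>c^2 L^3\<close>. The terms in \<open>t\<close> combine to
\<open>L (N_t L - N L_t / 2)\<close>; since \<open>L_t\<close> and \<open>N_t\<close> are \<open>2\<close> and \<open>3\<close> times \<open>Re (i q e^{it})\<close>, this is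
\<open>L (3 L - N) Re (i q e^{it})\<close>, a product of three forms of degree one.
\<close>

lemma stationary_equation:
  assumes V: "open V" "p \<in> V" and \<phi>: "smooth_on V \<phi>" "\<phi> ` V \<subseteq> I \<times> UNIV"
    and g: "congruence g" and X: "\<And>x. x \<in> V \<Longrightarrow> X x = g (Y (\<phi> x))"
    and imm: "\<And>x. x \<in> V \<Longrightarrow> inj (frechet_derivative X (at x))"
    and ang: "lagrangian_angle_on V X \<beta>" and lap: "laplacian X \<beta> p = 0"
    and pz: "\<phi> p = (s, t)"
    and l0': "(l0 has_vector_derivative l0') (at s)" and q': "(q has_vector_derivative q') (at s)"
    and m0': "(m0 has_vector_derivative m0') (at s)" and m1': "(m1 has_vector_derivative m1') (at s)"
    and n0': "(n0 has_vector_derivative n0') (at s)"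
  shows "c\<^sup>2 * ((m0' + Re (m1' * cis t)) * (l0 s + 2 * Re (q s * cis t))) -
      3/2 * c\<^sup>2 * ((m0 s + Re (m1 s * cis t)) * (l0' + Re (2 * q' * cis t))) +
      Re (\<i> * q s * cis t) * (l0 s + 2 * Re (q s * cis t)) * (3 * l0 s - n0 s + 3 * Re (q s * cis t)) = 0"
proof -
  obtain A b where A: "g = (\<lambda>p. A p + b)" "orthogonal_transformation A" "\<And>z p. A (cscale z p) = cscale z (A p)"
    using congruence_cscale[OF g] by blast
  have linA: "linear A" and isoA: "\<And>u v. A u \<bullet> A v = u \<bullet> v"
    using A(2) by (auto simp: orthogonal_transformation_def)
  have blA: "bounded_linear A" using linA linear_conv_bounded_linear by blast
  have \<phi>I: "fst (\<phi> x) \<in> I" if "x \<in> V" for x using \<phi>(2) that by (metis imageI mem_Times_iff subsetD)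
  define D where "D = (\<lambda>x. frechet_derivative \<phi> (at x))"
  have dX: "(X has_derivative (\<lambda>h. fst (D x h) *\<^sub>R A (cscale (\<alpha> (\<phi> x)) (hperp (\<gamma> (fst (\<phi> x)))))
       + snd (D x h) *\<^sub>R A (cscale (\<i> * c * cis (snd (\<phi> x))) (\<gamma> (fst (\<phi> x)))))) (at x)"
    if x: "x \<in> V" for x
  proof -
    have "(\<phi> has_derivative D x) (at x)"
      using smooth_on_differentiable[OF \<phi>(1) x] frechet_derivative_works unfolding D_def by blast
    from has_derivative_add[OF bounded_linear.has_derivative[OF blA has_derivative_compose[OF this Y_derivative[OF \<phi>I[OF x]]]]
        has_derivative_const[of b]]
    have "((\<lambda>x. g (Y (\<phi> x))) has_derivative (\<lambda>h. fst (D x h) *\<^sub>R A (cscale (\<alpha> (\<phi> x)) (hperp (\<gamma> (fst (\<phi> x)))))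
       + snd (D x h) *\<^sub>R A (cscale (\<i> * c * cis (snd (\<phi> x))) (\<gamma> (fst (\<phi> x)))))) (at x)"
      by (simp add: A(1) linear_add[OF linA] linear_cmul[OF linA])
    then show ?thesis
      by (rule has_derivative_transform_within_open[OF _ V(1) x]) (simp add: X)
  qed
  obtain e1 e2 where sm\<beta>: "smooth_on V \<beta>"
    and fr: "\<And>x. x \<in> V \<Longrightarrow> e1 x \<in> range (frechet_derivative X (at x))"
      "\<And>x. x \<in> V \<Longrightarrow> e2 x \<in> range (frechet_derivative X (at x))"
    and det: "\<And>x. x \<in> V \<Longrightarrow> detC (e1 x) (e2 x) = cis (\<beta> x)"
    using ang unfolding lagrangian_angle_on_def orthonormal_tangent_frame_def by blast
  define K where "K = detC (A (1, 0)) (A (0, 1)) * (\<i> * c)"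
  have cisb: "\<exists>r::real. cis (\<beta> x) = of_real r * K * \<zeta> (\<phi> x)" if x: "x \<in> V" for x
  proof -
    note fd = frechet_derivative_at[OF dX[OF x], symmetric]
    obtain h1 h2 where h: "e1 x = frechet_derivative X (at x) h1" "e2 x = frechet_derivative X (at x) h2"
      using fr[OF x] by blast
    have dd: "detC (hperp (\<gamma> (fst (\<phi> x)))) (\<gamma> (fst (\<phi> x))) = 1"
      using hprod_self[of "\<gamma> (fst (\<phi> x))"] norm_\<gamma>[OF \<phi>I[OF x]]
      by (simp add: detC_def hperp_def hprod_def algebra_simps)
    have "cis (\<beta> x) = of_real (fst (D x h1) * snd (D x h2) - snd (D x h1) * fst (D x h2)) *
        (detC (A (1, 0)) (A (0, 1)) * detC (cscale (\<alpha> (\<phi> x)) (hperp (\<gamma> (fst (\<phi> x)))))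
           (cscale (\<i> * c * cis (snd (\<phi> x))) (\<gamma> (fst (\<phi> x)))))"
      unfolding det[OF x, symmetric] h fd detC_real_combination
      by (subst detC_complex_linear[OF linA A(3)]) simp
    also have "detC (cscale (\<alpha> (\<phi> x)) (hperp (\<gamma> (fst (\<phi> x))))) (cscale (\<i> * c * cis (snd (\<phi> x))) (\<gamma> (fst (\<phi> x))))
       = \<i> * c * \<zeta> (\<phi> x) * detC (hperp (\<gamma> (fst (\<phi> x)))) (\<gamma> (fst (\<phi> x)))"
      by (simp add: detC_def \<zeta>_def algebra_simps)
    finally show ?thesis unfolding dd K_def
      by (intro exI[of _ "fst (D x h1) * snd (D x h2) - snd (D x h1) * fst (D x h2)"])
         (simp only: mult_1_right mult_1_left mult_ac)
  qed
  have d\<beta>: "(\<beta> has_derivative (\<lambda>h. fst (D x h) * (M (\<phi> x) / L (\<phi> x)) + snd (D x h) * (N (\<phi> x) / L (\<phi> x)))) (at x)"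
    if x: "x \<in> V" for x
  proof -
    have "(\<phi> has_derivative D x) (at x)"
      using smooth_on_differentiable[OF \<phi>(1) x] frechet_derivative_works unfolding D_def by blast
    from angle_derivative[OF V(1) x smooth_on_differentiable[OF sm\<beta> x] has_derivative_compose[OF this \<zeta>_derivative[OF \<phi>I[OF x]]] cisb]
    have "(\<beta> has_derivative (\<lambda>h. (fst (D x h) * M (\<phi> x) + snd (D x h) * N (\<phi> x)) / (cmod (\<zeta> (\<phi> x)))\<^sup>2)) (at x)"
      unfolding \<zeta>_log_derivative .
    moreover have "(cmod (\<zeta> (\<phi> x)))\<^sup>2 = L (\<phi> x)" unfolding \<zeta>_def norm_\<alpha>[symmetric] by (simp add: norm_mult)
    ultimately show ?thesis by (simp add: add_divide_distrib)
  qed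
  have dL: "(L has_derivative (\<lambda>h. fst h * (l0' + Re (2 * q' * cis t)) + snd h * Re (\<i> * (2 * q s) * cis t))) (at (\<phi> p))"
    unfolding L_def[abs_def] pz
    using trig_form_derivative[of l0 l0' "(s, t)" "\<lambda>s. 2 * q s" "2 * q'"] l0'
      has_vector_derivative_mult_right[OF q', of 2] by simp
  have dM: "(M has_derivative (\<lambda>h. fst h * (m0' + Re (m1' * cis t)) + snd h * Re (\<i> * m1 s * cis t))) (at (\<phi> p))"
    unfolding M_def[abs_def] pz
    using trig_form_derivative[of m0 m0' "(s, t)" m1 m1'] m0' m1' by simp
  have dN: "(N has_derivative (\<lambda>h. fst h * (n0' + Re (3 * q' * cis t)) + snd h * Re (\<i> * (3 * q s) * cis t))) (at (\<phi> p))"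
    unfolding N_def[abs_def] pz
    using trig_form_derivative[of n0 n0' "(s, t)" "\<lambda>s. 3 * q s" "3 * q'"] n0'
      has_vector_derivative_mult_right[OF q', of 3] by simp
  have c2: "c\<^sup>2 > 0" using c by simp
  note dP = flux_derivative_1[OF dM dL L_pos[OF \<phi>I[OF V(2)]] c2]
  note dQ = flux_derivative_2[OF dN dL L_pos[OF \<phi>I[OF V(2)]] c2]
  have ef: "A (cscale (\<alpha> (\<phi> x)) (hperp (\<gamma> (fst (\<phi> x))))) \<bullet> A (cscale (\<i> * c * cis (snd (\<phi> x))) (\<gamma> (fst (\<phi> x)))) = 0"
    for x unfolding isoA hperp_orthogonal ..
  have ee: "A (cscale (\<alpha> (\<phi> x)) (hperp (\<gamma> (fst (\<phi> x))))) \<bullet> A (cscale (\<alpha> (\<phi> x)) (hperp (\<gamma> (fst (\<phi> x))))) = L (\<phi> x)"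
    if "x \<in> V" for x
    unfolding isoA unfolding dot_square_norm norm_cscale using norm_\<gamma>[OF \<phi>I[OF that]] norm_\<alpha>[of "\<phi> x"] by simp
  have ff: "A (cscale (\<i> * c * cis (snd (\<phi> x))) (\<gamma> (fst (\<phi> x)))) \<bullet> A (cscale (\<i> * c * cis (snd (\<phi> x))) (\<gamma> (fst (\<phi> x)))) = c\<^sup>2"
    if "x \<in> V" for x
    unfolding isoA unfolding dot_square_norm norm_cscale using norm_\<gamma>[OF \<phi>I[OF that]] by (simp add: norm_mult)
  from laplacian_orthogonal_coordinates[OF V \<phi>(1), of X _ _ L "\<lambda>_. c\<^sup>2" \<beta> "\<lambda>z. M z / L z" "\<lambda>z. N z / L z",
      OF _ ef ee ff L_pos[OF \<phi>I] _ _ _ dP dQ] dX d\<beta> imm[OF V(2)] c2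
  have "laplacian X \<beta> p = (
     sqrt (c\<^sup>2) * ((m0' + Re (m1' * cis t)) * L (s, t) - 3/2 * M (s, t) * (l0' + Re (2 * q' * cis t)))
        / ((L (s, t))\<^sup>2 * sqrt (L (s, t)))
    + (Re (\<i> * (3 * q s) * cis t) * L (s, t) - 1/2 * N (s, t) * Re (\<i> * (2 * q s) * cis t))
        / (sqrt (c\<^sup>2) * L (s, t) * sqrt (L (s, t)))) / sqrt (L (s, t) * c\<^sup>2)"
    unfolding D_def pz by simp
  moreover have "L (s, t) > 0" using L_pos[OF \<phi>I[OF V(2)]] pz by simp
  moreover define k B S where "k = sqrt (c\<^sup>2)" and "B = (m0' + Re (m1' * cis t)) * L (s, t) - 3/2 * M (s, t) * (l0' + Re (2 * q' * cis t))"
    and "S = sqrt (L (s, t))"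
  moreover define Q where "Q = Re (\<i> * (3 * q s) * cis t) * L (s, t) - 1/2 * N (s, t) * Re (\<i> * (2 * q s) * cis t)"
  ultimately have eq: "k * B / ((L (s, t))\<^sup>2 * S) + Q / (k * L (s, t) * S) = 0" and pos: "k > 0" "S > 0" "L (s, t) > 0"
    using lap c by simp_all
  have "k * B / ((L (s, t))\<^sup>2 * S) + Q / (k * L (s, t) * S) = (k\<^sup>2 * B + L (s, t) * Q) / (k * (L (s, t))\<^sup>2 * S)"
    using pos by (simp add: field_simps power2_eq_square)
  then have "k\<^sup>2 * B + L (s, t) * Q = 0" using eq pos by simp
  then have "c\<^sup>2 * B + L (s, t) * Q = 0" by (simp add: k_def)
  moreover have "Re (\<i> * (3 * q s) * cis t) = 3 * Re (\<i> * q s * cis t)"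
     "Re (\<i> * (2 * q s) * cis t) = 2 * Re (\<i> * q s * cis t)" by simp_all
  moreover have "L (s, t) = l0 s + 2 * Re (q s * cis t)" "M (s, t) = m0 s + Re (m1 s * cis t)"
    "N (s, t) = n0 s + 3 * Re (q s * cis t)"
    by (simp_all add: L_def M_def N_def)
  ultimately show ?thesis unfolding B_def Q_def by algebra
qed

end

lemma hprod_minus: "hprod (p - p') q = hprod p q - hprod p' q" "hprod p (q - q') = hprod p q - hprod p q'"
  by (simp_all add: hprod_def algebra_simps)

section \<open>Congruences, unitary normal forms and curves of constant curvature\<close>

lemma congruence_compose:
  assumes "congruence g" "congruence h"
  shows "congruence (\<lambda>p. g (h p))"
proof -
  obtain A b where A: "orthogonal_transformation A" "\<And>p. A (J p) = J (A p)" "g = (\<lambda>p. A p + b)"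
    using assms(1) unfolding congruence_def by blast
  obtain B d where B: "orthogonal_transformation B" "\<And>p. B (J p) = J (B p)" "h = (\<lambda>p. B p + d)"
    using assms(2) unfolding congruence_def by blast
  interpret A: linear A using A(1) orthogonal_transformation_linear by blast
  have "(\<lambda>p. g (h p)) = (\<lambda>p. (A \<circ> B) p + (A d + b))"
    by (simp add: A B A.add add.assoc)
  moreover have "orthogonal_transformation (A \<circ> B)"
    using A(1) B(1) by (rule orthogonal_transformation_compose)
  moreover have "(A \<circ> B) (J p) = J ((A \<circ> B) p)" for p by (simp add: A(2) B(2))
  ultimately show ?thesis unfolding congruence_def by blast
qed

lemma congruence_inverse:
  assumes "congruence g"
  obtains h where "congruence h" "\<And>p. h (g p) = p" "\<And>p. g (h p) = p"
proof -
  obtain A b where A: "orthogonal_transformation A" "\<And>p. A (J p) = J (A p)" "g = (\<lambda>p. A p + b)"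
    using assms(1) unfolding congruence_def by blast
  interpret A: linear A using A(1) orthogonal_transformation_linear by blast
  have surj: "A (inv A p) = p" and inj: "inv A (A p) = p" for p
    using orthogonal_transformation_bij[OF A(1)] by (simp_all add: bij_is_surj bij_is_inj surj_f_inv_f)
  have iA: "orthogonal_transformation (inv A)" using A(1) by (rule orthogonal_transformation_inv)
  interpret B: linear "inv A" using iA orthogonal_transformation_linear by blast
  have "inv A (J p) = J (inv A p)" for p by (metis A(2) surj inj)
  then have "congruence (\<lambda>p. inv A p + inv A (- b))" using iA unfolding congruence_def by blast
  moreover have "inv A (g p) + inv A (- b) = p" for p
    by (simp add: A(3) inj flip: B.add)
  moreover have "g (inv A p + inv A (- b)) = p" for p
    by (simp add: A(3) surj flip: B.add)
  ultimately show ?thesis using that by blast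
qed

text \<open>
Coordinates with respect to the unitary basis obtained by normalizing \<open>u1\<close> and \<open>u2\<close>, after a
translation by \<open>-m\<close>. All local normal forms below reduce to this.
\<close>

lemma unitary_normal_form:
  assumes "u1 \<noteq> 0" "u2 \<noteq> 0" "hprod u1 u2 = 0"
  shows "\<exists>k. congruence k \<and>
    (\<forall>z w. k (m + cscale z u1 + cscale w u2) = (of_real (norm u1) * z, of_real (norm u2) * w))"
proof -
  define e1 e2 where "e1 = (1 / norm u1) *\<^sub>R u1" and "e2 = (1 / norm u2) *\<^sub>R u2"
  have hs: "hprod p (x *\<^sub>R v) = of_real x * hprod p v" "hprod (x *\<^sub>R v) p = of_real x * hprod v p" for p v x
    by (simp_all add: hprod_def scaleR_conv_of_real algebra_simps)
  have n: "norm e1 = 1" "norm e2 = 1" using assms by (simp_all add: e1_def e2_def)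
  have u21: "hprod u2 u1 = 0"
    using arg_cong[OF assms(3), of cnj] by (simp add: hprod_def mult.commute)
  then have "hprod e2 e1 = 0" by (simp add: e1_def e2_def hs)
  from orthogonal_complement_line[OF n(1) this] obtain \<theta> where \<theta>: "e2 = cscale \<theta> (hperp e1)" by blast
  then have n\<theta>: "cmod \<theta> = 1" using n by (simp add: norm_cscale)
  define A where "A = (\<lambda>p. (hprod p e1, hprod p e2))"
  have "linear A"
    by (rule linearI) (simp_all add: A_def hprod_add hs scaleR_conv_of_real)
  moreover have "norm (A p) = norm p" for p
  proof -
    have "(cmod (hprod p e2))\<^sup>2 = (cmod (hprod p (hperp e1)))\<^sup>2"
      unfolding \<theta> hprod_cscale by (simp add: norm_mult n\<theta>)
    moreover have "(cmod (hprod p e1))\<^sup>2 + (cmod (hprod p (hperp e1)))\<^sup>2 = (norm p)\<^sup>2 * (norm e1)\<^sup>2"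
    proof -
      have "complex_of_real ((cmod (hprod p e1))\<^sup>2 + (cmod (hprod p (hperp e1)))\<^sup>2) =
         hprod p p * hprod e1 e1"
        unfolding of_real_add complex_norm_square hprod_def hperp_def by (simp add: algebra_simps)
      also have "\<dots> = of_real ((norm p)\<^sup>2 * (norm e1)\<^sup>2)" by (simp add: hprod_self)
      finally show ?thesis by (simp only: of_real_eq_iff)
    qed
    ultimately have "(norm (A p))\<^sup>2 = (norm p)\<^sup>2" using n by (simp add: A_def norm_prod_def)
    then show ?thesis by simp
  qed
  ultimately have "orthogonal_transformation A" by (simp add: orthogonal_transformation)
  moreover have "A (J p) = J (A p)" for p by (simp add: A_def J_def hprod_def algebra_simps)
  ultimately have "congruence (\<lambda>p. A p + A (- m))" unfolding congruence_def by blast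
  moreover have "A (m + cscale z u1 + cscale w u2) + A (- m) = (of_real (norm u1) * z, of_real (norm u2) * w)" for z w
  proof -
    have "A (m + cscale z u1 + cscale w u2) + A (- m) = A (cscale z u1 + cscale w u2)"
      by (simp add: \<open>linear A\<close> flip: linear_add)
    also have "\<dots> = (of_real (norm u1) * z, of_real (norm u2) * w)"
      using assms u21 by (simp add: A_def hprod_add hprod_cscale e1_def e2_def hs hprod_self power2_eq_square)
    finally show ?thesis .
  qed
  ultimately show ?thesis by blast
qed

text \<open>
A plane curve with velocity \<open>f\<close> has curvature \<open>Im (f' cnj f) / |f|^3\<close>. If this is a constant \<open>\<kappa>\<close>, the
unit tangent rotates at the constant rate \<open>\<kappa>\<close> with respect to the arc length \<open>l\<close>.
\<close>

lemma constant_curvature: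
  fixes f :: "real \<Rightarrow> complex"
  assumes uv: "u < v" and f: "\<And>s. s \<in> {u<..<v} \<Longrightarrow> (f has_vector_derivative f' s) (at s)"
    and nz: "\<And>s. s \<in> {u<..<v} \<Longrightarrow> f s \<noteq> 0"
    and curv: "\<And>s. s \<in> {u<..<v} \<Longrightarrow> Im (f' s * cnj (f s)) = \<kappa> * cmod (f s) ^ 3"
  obtains l T where "cmod T = 1" "\<And>s. s \<in> {u<..<v} \<Longrightarrow> (l has_vector_derivative cmod (f s)) (at s)"
    "\<And>s. s \<in> {u<..<v} \<Longrightarrow> f s = of_real (cmod (f s)) * (T * cis (\<kappa> * l s))"
proof -
  have cont: "isCont (\<lambda>s. cmod (f s)) s" if "s \<in> {u<..<v}" for s
    using has_vector_derivative_continuous[OF f[OF that]] by (intro continuous_intros)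
  have "\<exists>l. \<forall>s::real. ereal u < s \<longrightarrow> s < ereal v \<longrightarrow> (l has_vector_derivative cmod (f s)) (at s)"
    by (rule einterval_antiderivative) (use uv cont in auto)
  then obtain l where l: "\<And>s. s \<in> {u<..<v} \<Longrightarrow> (l has_vector_derivative cmod (f s)) (at s)" by auto
  define G where "G = (\<lambda>s. cis (- (\<kappa> * l s)) * (f s / of_real (cmod (f s))))"
  have "(G has_vector_derivative 0) (at s within {u<..<v})" if s: "s \<in> {u<..<v}" for s
  proof -
    define R where "R = cmod (f s)"
    have R: "R > 0" using nz[OF s] by (simp add: R_def)
    have ff: "f s * cnj (f s) = of_real (R\<^sup>2)" unfolding R_def by (rule complex_norm_square[symmetric])
    have dn: "((\<lambda>s. cmod (f s)) has_vector_derivative Re (f' s * cnj (f s)) / R) (at s)"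
    proof -
      have "((\<lambda>s. cmod (f s)) has_derivative (\<lambda>h. (h *\<^sub>R f' s) \<bullet> sgn (f s))) (at s)"
        by (rule has_derivative_compose[OF f[OF s, unfolded has_vector_derivative_def]
              has_derivative_norm[OF nz[OF s]]])
      moreover have "(h *\<^sub>R f' s) \<bullet> sgn (f s) = h *\<^sub>R (Re (f' s * cnj (f s)) / R)" for h
        by (simp add: sgn_div_norm inner_complex_def R_def divide_inverse algebra_simps)
      ultimately show ?thesis unfolding has_vector_derivative_def by simp
    qed
    have dl: "((\<lambda>s. cis (- (\<kappa> * l s))) has_vector_derivative (- (\<kappa> * R)) *\<^sub>R (\<i> * cis (- (\<kappa> * l s)))) (at s)"
    proof -
      have "((\<lambda>s. - (\<kappa> * l s)) has_derivative (\<lambda>h. - (\<kappa> * (h *\<^sub>R R)))) (at s)"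
        using l[OF s] unfolding has_vector_derivative_def R_def by (intro derivative_intros)
      from has_derivative_cis[OF this] show ?thesis
        unfolding has_vector_derivative_def by (simp add: mult_ac)
    qed
    have dq: "((\<lambda>s. f s / of_real (cmod (f s))) has_vector_derivative
        (f' s * of_real R - f s * of_real (Re (f' s * cnj (f s)) / R)) / of_real (R * R)) (at s)"
    proof -
      have dR: "((\<lambda>s. complex_of_real (cmod (f s))) has_derivative (\<lambda>h. of_real (h *\<^sub>R (Re (f' s * cnj (f s)) / R)))) (at s)"
        using dn unfolding has_vector_derivative_def by (rule has_derivative_of_real)
      show ?thesis unfolding has_vector_derivative_def
        by (rule has_derivative_eq_rhs[OF has_derivative_divide'[OF f[OF s, unfolded has_vector_derivative_def] dR]])
           (use R in \<open>auto simp: R_def fun_eq_iff scaleR_conv_of_real field_simps\<close>)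
    qed
    have "f' s * of_real R - f s * of_real (Re (f' s * cnj (f s)) / R) = \<i> * of_real (\<kappa> * R\<^sup>2) * f s"
    proof -
      have c: "f' s * cnj (f s) = of_real (Re (f' s * cnj (f s))) + \<i> * of_real (\<kappa> * R ^ 3)"
        using curv[OF s] unfolding R_def by (simp only: complex_eq_iff) simp
      have "of_real (R\<^sup>2) * f' s = f s * (f' s * cnj (f s))" using ff by (simp add: algebra_simps)
      also have "\<dots> = f s * (of_real (Re (f' s * cnj (f s))) + \<i> * of_real (\<kappa> * R ^ 3))" using c by (simp only:)
      finally have "of_real (R\<^sup>2) * f' s - f s * of_real (Re (f' s * cnj (f s))) = \<i> * of_real (\<kappa> * R ^ 3) * f s"
        by (simp add: algebra_simps)
      then show ?thesis using R by (simp add: field_simps power2_eq_square power3_eq_cube)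
    qed
    then have "(G has_vector_derivative 0) (at s)"
      unfolding G_def using has_vector_derivative_mult[OF dl dq] R
      by (simp add: R_def[symmetric] scaleR_conv_of_real field_simps power2_eq_square)
    then show ?thesis by (rule has_vector_derivative_at_within)
  qed
  from has_vector_derivative_zero_constant[OF convex_real_interval(8) this]
  obtain T where T: "\<And>s. s \<in> {u<..<v} \<Longrightarrow> G s = T" by blast
  have fT: "f s = of_real (cmod (f s)) * (T * cis (\<kappa> * l s))" if s: "s \<in> {u<..<v}" for s
  proof -
    have "T * cis (\<kappa> * l s) = (cis (- (\<kappa> * l s)) * cis (\<kappa> * l s)) * (f s / of_real (cmod (f s)))"
      unfolding T[OF s, symmetric] G_def by (simp only: mult_ac)
    also have "\<dots> = f s / of_real (cmod (f s))" by (simp add: cis_mult)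
    finally show ?thesis using nz[OF s] by simp
  qed
  have mid: "(u + v) / 2 \<in> {u<..<v}" using uv by auto
  have "cmod T = 1"
    using fT[OF mid] nz[OF mid] by (metis norm_cis norm_mult mult_cancel_left1 mult.right_neutral norm_eq_zero norm_of_real abs_norm_cancel)
  with l fT that show ?thesis by blast
qed

lemma positive_derivative_inj:
  fixes l :: "real \<Rightarrow> real"
  assumes "\<And>s. s \<in> {u<..<v} \<Longrightarrow> (l has_vector_derivative l' s) (at s)" "\<And>s. s \<in> {u<..<v} \<Longrightarrow> l' s > 0"
  shows "inj_on l {u<..<v}" "continuous_on {u<..<v} l"
proof -
  have lt: "l x < l y" if "x \<in> {u<..<v}" "y \<in> {u<..<v}" "x < y" for x y
  proof (rule DERIV_pos_imp_increasing[OF that(3)])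
    fix z assume "x \<le> z" "z \<le> y"
    then have z: "z \<in> {u<..<v}" using that by auto
    show "\<exists>d. (l has_real_derivative d) (at z) \<and> 0 < d"
      unfolding has_real_derivative_iff_has_vector_derivative using assms[OF z] by blast
  qed
  show "inj_on l {u<..<v}"
    by (rule inj_onI) (metis lt less_irrefl linorder_neqE_linordered_idom)
  show "continuous_on {u<..<v} l"
    using assms(1) by (intro continuous_at_imp_continuous_on) (blast intro: has_vector_derivative_continuous)
qed

lemma has_vector_derivative_vanishing:
  assumes "open S" "s \<in> S" "(f has_vector_derivative f') (at s)" "\<And>x. x \<in> S \<Longrightarrow> f x = 0"
  shows "f' = 0"
proof -
  have "(f has_vector_derivative 0) (at s)"
    using has_vector_derivative_transform_within_open[OF has_vector_derivative_const[of 0] assms(1,2)] assms(4)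
    by metis
  then show ?thesis using assms(3) vector_derivative_unique_at by blast
qed

section \<open>Local normal forms of stationary type II surfaces\<close>

definition torus_map :: "real \<Rightarrow> real \<Rightarrow> real \<times> real \<Rightarrow> complex \<times> complex" where
  "torus_map r1 r2 z = (of_real r1 * cis (fst z), of_real r2 * cis (snd z))"

definition cylinder_map :: "real \<Rightarrow> real \<times> real \<Rightarrow> complex \<times> complex" where
  "cylinder_map r z = (of_real r * cis (fst z), of_real (snd z))"

definition product_model :: "(real \<times> real \<Rightarrow> complex \<times> complex) \<Rightarrow> bool" where
  "product_model \<Phi> \<longleftrightarrow> (\<exists>r1>0. \<exists>r2>0. \<Phi> = torus_map r1 r2) \<or> (\<exists>r>0. \<Phi> = cylinder_map r)"

lemma hperp_vector_derivative:
  assumes "(f has_vector_derivative f') (at s)"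
  shows "((\<lambda>s. hperp (f s)) has_vector_derivative hperp f') (at s)"
proof -
  have "bounded_linear hperp"
    unfolding hperp_def[abs_def]
    by (intro bounded_linear_Pair bounded_linear_minus bounded_linear_compose[OF bounded_linear_cnj]
         bounded_linear_fst bounded_linear_snd)
  then show ?thesis using assms by (rule bounded_linear.has_vector_derivative)
qed

context type_II_frame
begin

lemma coefficients_differentiable:
  assumes s: "s \<in> I"
  shows "(q has_vector_derivative vector_derivative q (at s)) (at s)"
    "(l0 has_vector_derivative vector_derivative l0 (at s)) (at s)"
    "(n0 has_vector_derivative vector_derivative n0 (at s)) (at s)"
    "(m0 has_vector_derivative vector_derivative m0 (at s)) (at s)"
    "(m1 has_vector_derivative vector_derivative m1 (at s)) (at s)"
proof -
  note d = da[OF s] da'[OF s] dW[OF s] dW'[OF s]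
  note r = has_vector_derivative_mult has_vector_derivative_cnj has_vector_derivative_add
    has_vector_derivative_diff has_vector_derivative_const
    bounded_linear.has_vector_derivative[OF bounded_linear_Re]
    bounded_linear.has_vector_derivative[OF bounded_linear_Im]
  have "q differentiable (at s)"
    unfolding q_def[abs_def] by (rule differentiableI_vector) (rule r d)+
  moreover have "l0 differentiable (at s)"
    unfolding l0_def[abs_def] by (rule differentiableI_vector) (rule r d)+
  moreover have "n0 differentiable (at s)"
    unfolding n0_def[abs_def] by (rule differentiableI_vector) (rule r d)+
  moreover have "m0 differentiable (at s)"
    unfolding m0_def[abs_def] by (rule differentiableI_vector) (rule r d)+
  moreover have "m1 differentiable (at s)"
    unfolding m1_def[abs_def] by (rule differentiableI_vector) (rule r d)+
  ultimately show
    "(q has_vector_derivative vector_derivative q (at s)) (at s)"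
    "(l0 has_vector_derivative vector_derivative l0 (at s)) (at s)"
    "(n0 has_vector_derivative vector_derivative n0 (at s)) (at s)"
    "(m0 has_vector_derivative vector_derivative m0 (at s)) (at s)"
    "(m1 has_vector_derivative vector_derivative m1 (at s)) (at s)"
    by (simp_all only: vector_derivative_works)
qed

text \<open>
The conclusion of \<open>stationary_equation\<close> with the derivatives of the coefficients named, so that for
fixed \<open>s\<close> it is a trigonometric identity in \<open>t\<close>.
\<close>

definition balanced :: "real \<Rightarrow> real \<Rightarrow> bool" where
  "balanced s t \<longleftrightarrow>
     c\<^sup>2 * ((vector_derivative m0 (at s) + Re (vector_derivative m1 (at s) * cis t)) * (l0 s + 2 * Re (q s * cis t))) -
      3/2 * c\<^sup>2 * ((m0 s + Re (m1 s * cis t)) * (vector_derivative l0 (at s) + Re (2 * vector_derivative q (at s) * cis t))) +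
      Re (\<i> * q s * cis t) * (l0 s + 2 * Re (q s * cis t)) * (3 * l0 s - n0 s + 3 * Re (q s * cis t)) = 0"

lemma balanced_imp_q_zero:
  assumes "t0 < t1" "\<And>t. t \<in> {t0<..<t1} \<Longrightarrow> balanced s t"
  shows "q s = 0"
  using leading_trig_coefficient_zero[OF assms(1)] assms(2) unfolding balanced_def by blast

text \<open>
The surface need only be stationary over a small rectangle of parameters; the conclusions hold on the
whole strip above \<open>{u<..<v}\<close>.
\<close>

context
  fixes u v t0 t1 :: real
  assumes uv: "u < v" and t01: "t0 < t1" and sub: "{u<..<v} \<subseteq> I"
    and bal: "\<And>s t. s \<in> {u<..<v} \<Longrightarrow> t \<in> {t0<..<t1} \<Longrightarrow> balanced s t"
begin

lemma inI: "s \<in> {u<..<v} \<Longrightarrow> s \<in> I"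
  using sub by blast

lemma q_zero: "s \<in> {u<..<v} \<Longrightarrow> q s = 0"
  using balanced_imp_q_zero[OF t01 bal] .

lemma l0_pos: "s \<in> {u<..<v} \<Longrightarrow> l0 s > 0"
  using L_pos[of "(s, 0)"] q_zero[of s] inI[of s] by (simp add: L_def)

lemma a_or_W_vanishes:
  "(\<forall>s\<in>{u<..<v}. a s = 0 \<and> W s \<noteq> 0) \<or> (\<forall>s\<in>{u<..<v}. W s = 0 \<and> a s \<noteq> 0)"
proof -
  have dich: "(a s = 0 \<and> W s \<noteq> 0) \<or> (W s = 0 \<and> a s \<noteq> 0)" if "s \<in> {u<..<v}" for s
    using q_zero[OF that] nz[OF inI[OF that], of 0] by (auto simp: q_def)
  have ca: "continuous_on {u<..<v} a" and cW: "continuous_on {u<..<v} W"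
    using has_vector_derivative_continuous[OF da[OF inI]] has_vector_derivative_continuous[OF dW[OF inI]]
    by (intro continuous_at_imp_continuous_on ballI; simp)+
  define A where "A = {u<..<v} \<inter> a -` (- {0})"
  define B where "B = {u<..<v} \<inter> W -` (- {0})"
  have "open A" "open B"
    unfolding A_def B_def using continuous_open_preimage[OF ca, of "- {0}"]
      continuous_open_preimage[OF cW, of "- {0}"] by auto
  moreover have "{u<..<v} \<subseteq> A \<union> B" "A \<inter> B \<inter> {u<..<v} = {}"
    using dich unfolding A_def B_def by blast+
  ultimately have "A \<inter> {u<..<v} = {} \<or> B \<inter> {u<..<v} = {}"
    using connectedD[OF connected_Ioo[of u v], of A B] by blast
  then show ?thesis using dich unfolding A_def B_def by blast
qed

lemma m1_zero: "s \<in> {u<..<v} \<Longrightarrow> m1 s = 0"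
proof -
  assume s: "s \<in> {u<..<v}"
  from a_or_W_vanishes show "m1 s = 0"
  proof
    assume z: "\<forall>s\<in>{u<..<v}. a s = 0 \<and> W s \<noteq> 0"
    then have "a' s = 0" using has_vector_derivative_vanishing[OF _ s da[OF inI[OF s]]] by auto
    then show ?thesis using z s by (simp add: m1_def)
  next
    assume z: "\<forall>s\<in>{u<..<v}. W s = 0 \<and> a s \<noteq> 0"
    then have "W' s = 0" using has_vector_derivative_vanishing[OF _ s dW[OF inI[OF s]]] by auto
    then show ?thesis using z s by (simp add: m1_def)
  qed
qed

text \<open>
With \<open>q\<close> and \<open>m1\<close> equal to zero, the stationary equation reduces to \<open>m0' l0 = 3/2 m0 l0'\<close>, that is, to
constancy of \<open>m0 / l0^{3/2}\<close>. This is the curvature of a plane curve with velocity \<open>W\<close> if \<open>a\<close>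
vanishes, and of one with velocity \<open>a\<close> if \<open>W\<close> vanishes.
\<close>

lemma curvature_constant: "\<exists>\<kappa>. \<forall>s\<in>{u<..<v}. m0 s = \<kappa> * sqrt (l0 s) ^ 3"
proof -
  define k where "k = (\<lambda>s. sqrt (1 / l0 s) * (m0 s / l0 s))"
  have "(k has_derivative (\<lambda>h. 0)) (at s within {u<..<v})" if s: "s \<in> {u<..<v}" for s
  proof -
    note d = coefficients_differentiable[OF inI[OF s]]
    have z: "vector_derivative q (at s) = 0" "vector_derivative m1 (at s) = 0"
      using has_vector_derivative_vanishing[OF _ s d(1) q_zero]
        has_vector_derivative_vanishing[OF _ s d(5) m1_zero] by auto
    have mid: "(t0 + t1) / 2 \<in> {t0<..<t1}" using t01 by auto
    have "c\<^sup>2 * (vector_derivative m0 (at s) * l0 s - 3/2 * m0 s * vector_derivative l0 (at s)) = 0"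
      using bal[OF s mid] unfolding balanced_def z q_zero[OF s] m1_zero[OF s] by (simp add: algebra_simps)
    then have e: "vector_derivative m0 (at s) * l0 s - 3/2 * m0 s * vector_derivative l0 (at s) = 0"
      using c by simp
    have "(k has_derivative (\<lambda>h. sqrt 1 * ((h *\<^sub>R vector_derivative m0 (at s)) * l0 s
         - 3/2 * m0 s * (h *\<^sub>R vector_derivative l0 (at s))) / ((l0 s)\<^sup>2 * sqrt (l0 s)))) (at s)"
      unfolding k_def
      by (rule flux_derivative_1[OF d(4)[unfolded has_vector_derivative_def]
            d(2)[unfolded has_vector_derivative_def] l0_pos[OF s]]) simp
    moreover have e2: "(h *\<^sub>R vector_derivative m0 (at s)) * l0 s
         - 3/2 * m0 s * (h *\<^sub>R vector_derivative l0 (at s)) = 0" for h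
      using arg_cong[OF e, of "\<lambda>x. h * x"] by (simp add: algebra_simps)
    ultimately have "(k has_derivative (\<lambda>h. 0)) (at s)" by (simp only: e2 mult_zero_right div_0)
    then show ?thesis by (rule has_derivative_at_withinI)
  qed
  from has_derivative_zero_constant[OF convex_real_interval(8) this]
  obtain \<kappa> where \<kappa>: "\<And>s. s \<in> {u<..<v} \<Longrightarrow> k s = \<kappa>" by blast
  have "m0 s = \<kappa> * sqrt (l0 s) ^ 3" if s: "s \<in> {u<..<v}" for s
  proof -
    define S where "S = sqrt (l0 s)"
    have S: "S > 0" "l0 s = S * S" using l0_pos[OF s] by (auto simp: S_def)
    have "\<kappa> = (1 / S) * (m0 s / (S * S))"
      unfolding \<kappa>[OF s, symmetric] k_def by (simp add: S(1) real_sqrt_divide flip: S_def) (simp add: S(2))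
    then show ?thesis unfolding S_def[symmetric] using S(1) by (simp add: power3_eq_cube)
  qed
  then show ?thesis by blast
qed

lemma Z_determined_by_derivative:
  assumes "\<And>s. s \<in> {u<..<v} \<Longrightarrow> (f has_vector_derivative cscale (W s) (hperp (\<gamma> s))) (at s)"
  obtains m where "\<And>s. s \<in> {u<..<v} \<Longrightarrow> Z s = f s + m"
proof -
  have "((\<lambda>s. Z s - f s) has_vector_derivative 0) (at s within {u<..<v})" if "s \<in> {u<..<v}" for s
    using has_vector_derivative_diff[OF dZ[OF inI[OF that]] assms[OF that]]
    by (simp add: has_vector_derivative_at_within)
  from has_vector_derivative_zero_constant[OF convex_real_interval(8) this]
  obtain m where "\<And>s. s \<in> {u<..<v} \<Longrightarrow> Z s - f s = m" by blast
  then show ?thesis using that by (metis add.commute diff_add_cancel)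
qed

text \<open>
For \<open>a = 0\<close> the frame \<open>(\<gamma>, hperp \<gamma>)\<close> is constant, and \<open>Z\<close> is a curve of constant curvature \<open>\<kappa>\<close> in the
complex line spanned by \<open>hperp \<gamma>\<close>: a straight line if \<open>\<kappa> = 0\<close>, an arc of radius \<open>1 / |\<kappa>|\<close> otherwise.
\<close>

lemma normal_form_fixed_frame:
  assumes z: "\<And>s. s \<in> {u<..<v} \<Longrightarrow> a s = 0 \<and> W s \<noteq> 0"
  shows "\<exists>k H \<Phi>. congruence k \<and> product_model \<Phi> \<and> continuous_on ({u<..<v} \<times> UNIV) H \<and>
    inj_on H ({u<..<v} \<times> UNIV) \<and> (\<forall>x\<in>{u<..<v} \<times> UNIV. k (Y x) = \<Phi> (H x))"
proof -
  have "(\<gamma> has_vector_derivative 0) (at s within {u<..<v})" if s: "s \<in> {u<..<v}" for s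
    using d\<gamma>[OF inI[OF s]] z[OF s] by (simp add: cscale_def has_vector_derivative_at_within zero_prod_def)
  from has_vector_derivative_zero_constant[OF convex_real_interval(8) this]
  obtain g0 where g0: "\<And>s. s \<in> {u<..<v} \<Longrightarrow> \<gamma> s = g0" by blast
  have mid: "(u + v) / 2 \<in> {u<..<v}" using uv by auto
  have ng: "norm g0 = 1" using norm_\<gamma>[OF inI[OF mid]] g0[OF mid] by simp
  obtain \<kappa> where \<kappa>: "\<And>s. s \<in> {u<..<v} \<Longrightarrow> m0 s = \<kappa> * sqrt (l0 s) ^ 3" using curvature_constant by blast
  have curv: "Im (W' s * cnj (W s)) = \<kappa> * cmod (W s) ^ 3" if s: "s \<in> {u<..<v}" for s
  proof -
    have "complex_of_real (l0 s) = W s * cnj (W s)" using z[OF s] by (simp add: l0_def complex_eq_iff)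
    then have "l0 s = (cmod (W s))\<^sup>2" unfolding complex_norm_square[symmetric] by (simp only: of_real_eq_iff)
    then have "sqrt (l0 s) = cmod (W s)" by simp
    then show ?thesis using \<kappa>[OF s] z[OF s] by (simp add: m0_def)
  qed
  obtain T l where l: "cmod T = 1" "\<And>s. s \<in> {u<..<v} \<Longrightarrow> (l has_vector_derivative cmod (W s)) (at s)"
    "\<And>s. s \<in> {u<..<v} \<Longrightarrow> W s = of_real (cmod (W s)) * (T * cis (\<kappa> * l s))"
  proof (rule constant_curvature[OF uv dW[OF inI] conjunct2[OF z] curv])
  qed (assumption | rule that)+
  have li: "inj_on l {u<..<v}" "continuous_on {u<..<v} l"
    using positive_derivative_inj[OF l(2)] z by auto
  have cf: "continuous_on ({u<..<v} \<times> UNIV) (\<lambda>x::real\<times>real. l (fst x))"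
    by (rule continuous_on_compose2[OF li(2) continuous_on_fst]) auto
  define u1 where "u1 = cscale c g0"
  have nu1: "norm u1 = \<bar>c\<bar>" using ng by (simp add: u1_def norm_cscale)
  with c have u1: "norm u1 = \<bar>c\<bar>" "u1 \<noteq> 0" by auto
  show ?thesis
  proof (cases "\<kappa> = 0")
    case True
    define u2 where "u2 = cscale T (hperp g0)"
    have nu2: "norm u2 = 1" using ng l(1) by (simp add: u2_def norm_cscale)
    then have u2: "norm u2 = 1" "u2 \<noteq> 0" by auto
    have "((\<lambda>s. cscale (of_real (l s)) u2) has_vector_derivative cscale (W s) (hperp (\<gamma> s))) (at s)"
      if s: "s \<in> {u<..<v}" for s
      using has_vector_derivative_cscale[OF has_vector_derivative_of_real[OF
          l(2)[OF s, folded has_real_derivative_iff_has_vector_derivative]] has_vector_derivative_const[of u2]]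
        l(3)[OF s] True g0[OF s] by (simp add: u2_def cscale_cscale) (simp add: cscale_def zero_prod_def)
    then obtain m where m: "\<And>s. s \<in> {u<..<v} \<Longrightarrow> Z s = cscale (of_real (l s)) u2 + m"
      using Z_determined_by_derivative by blast
    have "hprod u1 u2 = 0" by (simp add: u1_def u2_def hprod_cscale)
    then obtain k where k: "congruence k"
      "\<And>z w. k (m + cscale z u1 + cscale w u2) = (of_real (norm u1) * z, of_real (norm u2) * w)"
      using unitary_normal_form[OF u1(2) u2(2)] by blast
    define H where "H = (\<lambda>x::real\<times>real. (snd x, l (fst x)))"
    have "k (Y x) = cylinder_map \<bar>c\<bar> (H x)" if x: "x \<in> {u<..<v} \<times> UNIV" for x
    proof -
      have s: "fst x \<in> {u<..<v}" using x by auto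
      have "Y x = m + cscale (cis (snd x)) u1 + cscale (of_real (l (fst x))) u2"
        unfolding Y_def m[OF s] g0[OF s] by (simp add: u1_def cscale_cscale mult.commute)
      then show ?thesis using u1 u2 by (simp add: k(2) cylinder_map_def H_def)
    qed
    moreover have "continuous_on ({u<..<v} \<times> UNIV) H"
      unfolding H_def by (intro continuous_intros cf)
    moreover have "inj_on H ({u<..<v} \<times> UNIV)"
      using li(1) by (auto simp: H_def inj_on_def)
    moreover have "product_model (cylinder_map \<bar>c\<bar>)" 
      using c unfolding product_model_def by (intro disjI2 exI[of _ "\<bar>c\<bar>"] conjI) auto
    ultimately show ?thesis using k(1) by blast
  next
    case False
    \<comment> \<open>The radius vector of the circular arc, turned back by the angle \<open>\<kappa> l\<close>.\<close>
    define u2 where "u2 = cscale (- \<i> * T / \<kappa>) (hperp g0)"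
    have nu2: "norm u2 = 1 / \<bar>\<kappa>\<bar>" using ng l(1) by (auto simp: u2_def norm_cscale norm_mult norm_divide)
    then have u2: "u2 \<noteq> 0" using False by auto
    have "((\<lambda>s. cscale (cis (\<kappa> * l s)) u2) has_vector_derivative cscale (W s) (hperp (\<gamma> s))) (at s)"
      if s: "s \<in> {u<..<v}" for s
    proof -
      have dc: "((\<lambda>s. cis (\<kappa> * l s)) has_vector_derivative (\<kappa> * cmod (W s)) *\<^sub>R (\<i> * cis (\<kappa> * l s))) (at s)"
        using has_derivative_cis[OF has_derivative_mult_right[OF l(2)[OF s, unfolded has_vector_derivative_def], of \<kappa>]]
        unfolding has_vector_derivative_def by (simp add: mult_ac)
      have "cscale ((\<kappa> * cmod (W s)) *\<^sub>R (\<i> * cis (\<kappa> * l s))) u2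
          = cscale (of_real (cmod (W s)) * (T * cis (\<kappa> * l s))) (hperp g0)"
        using False by (simp add: u2_def cscale_cscale scaleR_conv_of_real mult_ac)
      also have "\<dots> = cscale (W s) (hperp (\<gamma> s))" using l(3)[OF s] g0[OF s] by simp
      finally show ?thesis
        using has_vector_derivative_cscale[OF dc has_vector_derivative_const[of u2]]
        by (simp add: cscale_def zero_prod_def)
    qed
    then obtain m where m: "\<And>s. s \<in> {u<..<v} \<Longrightarrow> Z s = cscale (cis (\<kappa> * l s)) u2 + m"
      using Z_determined_by_derivative by blast
    have "hprod u1 u2 = 0" by (simp add: u1_def u2_def hprod_cscale)
    then obtain k where k: "congruence k"
      "\<And>z w. k (m + cscale z u1 + cscale w u2) = (of_real (norm u1) * z, of_real (norm u2) * w)"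
      using unitary_normal_form[OF u1(2) u2] by blast
    define H where "H = (\<lambda>x::real\<times>real. (snd x, \<kappa> * l (fst x)))"
    have "k (Y x) = torus_map \<bar>c\<bar> (1 / \<bar>\<kappa>\<bar>) (H x)" if x: "x \<in> {u<..<v} \<times> UNIV" for x
    proof -
      have s: "fst x \<in> {u<..<v}" using x by auto
      have "Y x = m + cscale (cis (snd x)) u1 + cscale (cis (\<kappa> * l (fst x))) u2"
        unfolding Y_def m[OF s] g0[OF s] by (simp add: u1_def cscale_cscale mult.commute)
      then show ?thesis using u1 nu2 by (simp add: k(2) torus_map_def H_def)
    qed
    moreover have "continuous_on ({u<..<v} \<times> UNIV) H"
      unfolding H_def by (intro continuous_intros cf)
    moreover have "inj_on H ({u<..<v} \<times> UNIV)"
      using li(1) False by (auto simp: H_def inj_on_def)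
    moreover have "product_model (torus_map \<bar>c\<bar> (1 / \<bar>\<kappa>\<bar>))"
      using c False unfolding product_model_def by (intro disjI1 exI[of _ "\<bar>c\<bar>"] conjI exI[of _ "1 / \<bar>\<kappa>\<bar>"]) auto
    ultimately show ?thesis using k(1) by blast
  qed
qed

text \<open>
For \<open>W = 0\<close> let \<open>N\<close> be the unit tangent of \<open>\<gamma>\<close> in the direction of increasing \<open>l / c\<close>. With respect to
this parameter \<open>\<gamma>' = N\<close> and \<open>N' = i k N - \<gamma>\<close>, where \<open>k = c \<kappa>\<close>. The eigenvalues \<open>i \<mu>1\<close>, \<open>i \<mu>2\<close> are
given by the roots of \<open>\<mu>^2 - k \<mu> - 1\<close>, which are real and distinct with product \<open>-1\<close>. That the product
is \<open>-1\<close> is also what makes the eigenvectors \<open>N - i \<mu>2 \<gamma>\<close> and \<open>N - i \<mu>1 \<gamma>\<close> orthogonal; \<open>\<gamma>\<close> is a multiple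
of their difference.
\<close>

lemma normal_form_fixed_center:
  assumes z: "\<And>s. s \<in> {u<..<v} \<Longrightarrow> W s = 0 \<and> a s \<noteq> 0"
  shows "\<exists>k H \<Phi>. congruence k \<and> product_model \<Phi> \<and> continuous_on ({u<..<v} \<times> UNIV) H \<and>
    inj_on H ({u<..<v} \<times> UNIV) \<and> (\<forall>x\<in>{u<..<v} \<times> UNIV. k (Y x) = \<Phi> (H x))"
proof -
  have "((\<lambda>s. 0) has_vector_derivative cscale (W s) (hperp (\<gamma> s))) (at s)" if s: "s \<in> {u<..<v}" for s
    using z[OF s] by (simp add: cscale_def flip: zero_prod_def)
  then obtain m where m: "\<And>s. s \<in> {u<..<v} \<Longrightarrow> Z s = m"
    using Z_determined_by_derivative[of "\<lambda>s. 0"] by auto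
  have mid: "(u + v) / 2 \<in> {u<..<v}" using uv by auto
  obtain \<kappa> where \<kappa>: "\<And>s. s \<in> {u<..<v} \<Longrightarrow> m0 s = \<kappa> * sqrt (l0 s) ^ 3" using curvature_constant by blast
  have curv: "Im (a' s * cnj (a s)) = \<kappa> * cmod (a s) ^ 3" if s: "s \<in> {u<..<v}" for s
  proof -
    have "complex_of_real (l0 s) = a s * cnj (a s)" using z[OF s] by (simp add: l0_def complex_eq_iff)
    then have "l0 s = (cmod (a s))\<^sup>2" unfolding complex_norm_square[symmetric] by (simp only: of_real_eq_iff)
    then have "sqrt (l0 s) = cmod (a s)" by simp
    then show ?thesis using \<kappa>[OF s] z[OF s] by (simp add: m0_def)
  qed
  obtain T l where l: "cmod T = 1" "\<And>s. s \<in> {u<..<v} \<Longrightarrow> (l has_vector_derivative cmod (a s)) (at s)"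
    "\<And>s. s \<in> {u<..<v} \<Longrightarrow> a s = of_real (cmod (a s)) * (T * cis (\<kappa> * l s))"
  proof (rule constant_curvature[OF uv da[OF inI] conjunct2[OF z] curv])
  qed (assumption | rule that)+
  have li: "inj_on l {u<..<v}" "continuous_on {u<..<v} l"
    using positive_derivative_inj[OF l(2)] z by auto
  define \<tau> where "\<tau> = (\<lambda>s. T * cis (\<kappa> * l s))"
  have \<tau>: "a s = of_real (cmod (a s)) * \<tau> s" "\<tau> s * cnj (\<tau> s) = 1" if "s \<in> {u<..<v}" for s
    using l(3)[OF that] complex_norm_square[of "\<tau> s"] l(1) by (simp_all add: \<tau>_def norm_mult)
  define N where "N = (\<lambda>s. cscale (\<tau> s) (hperp (\<gamma> s)))"
  define k where "k = c * \<kappa>"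
  have dg: "(\<gamma> has_vector_derivative (cmod (a s) / c) *\<^sub>R N s) (at s)" if s: "s \<in> {u<..<v}" for s
  proof -
    have "cscale (a s / c) (hperp (\<gamma> s)) = (cmod (a s) / c) *\<^sub>R N s"
      by (subst \<tau>(1)[OF s]) (simp add: N_def cscale_def scaleR_conv_of_real)
    then show ?thesis using d\<gamma>[OF inI[OF s]] by simp
  qed
  have dN: "(N has_vector_derivative (cmod (a s) / c) *\<^sub>R (cscale (\<i> * k) (N s) - \<gamma> s)) (at s)" if s: "s \<in> {u<..<v}" for s
  proof -
    have d\<tau>: "(\<tau> has_vector_derivative T * ((\<kappa> * cmod (a s)) *\<^sub>R (\<i> * cis (\<kappa> * l s)))) (at s)"
      unfolding \<tau>_def has_vector_derivative_def
      by (rule has_derivative_eq_rhs[OF has_derivative_mult_right[OF has_derivative_cis[OF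
          has_derivative_mult_right[OF l(2)[OF s, unfolded has_vector_derivative_def], of \<kappa>]]]])
         (simp add: fun_eq_iff scaleR_conv_of_real)
    note D = has_vector_derivative_cscale[OF d\<tau> hperp_vector_derivative[OF dg[OF s]]]
    have h: "hperp ((cmod (a s) / c) *\<^sub>R N s) = - ((cmod (a s) / c) *\<^sub>R cscale (cnj (\<tau> s)) (\<gamma> s))"
      by (simp add: N_def hperp_def cscale_def scaleR_conv_of_real prod_eq_iff)
    have "cscale (\<tau> s) (hperp ((cmod (a s) / c) *\<^sub>R N s)) = - ((cmod (a s) / c) *\<^sub>R cscale (\<tau> s * cnj (\<tau> s)) (\<gamma> s))"
      unfolding h by (simp add: cscale_def scaleR_conv_of_real)
    moreover have "cscale (T * ((\<kappa> * cmod (a s)) *\<^sub>R (\<i> * cis (\<kappa> * l s)))) (hperp (\<gamma> s)) = (cmod (a s) / c) *\<^sub>R cscale (\<i> * k) (N s)"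
      using c by (simp add: N_def k_def \<tau>_def cscale_def scaleR_conv_of_real)
    ultimately have "cscale (\<tau> s) (hperp ((cmod (a s) / c) *\<^sub>R N s))
        + cscale (T * ((\<kappa> * cmod (a s)) *\<^sub>R (\<i> * cis (\<kappa> * l s)))) (hperp (\<gamma> s))
       = (cmod (a s) / c) *\<^sub>R (cscale (\<i> * k) (N s) - \<gamma> s)"
      unfolding \<tau>(2)[OF s] by (simp add: cscale_def scaleR_diff_right)
    then show ?thesis using D unfolding N_def[symmetric] by simp
  qed
  define \<mu>1 \<mu>2 where "\<mu>1 = (k + sqrt (k\<^sup>2 + 4)) / 2" and "\<mu>2 = (k - sqrt (k\<^sup>2 + 4)) / 2"
  have sq: "sqrt (k\<^sup>2 + 4) > 0" "sqrt (k\<^sup>2 + 4) * sqrt (k\<^sup>2 + 4) = k\<^sup>2 + 4"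
    using zero_le_power2[of k] by (auto intro: add_nonneg_pos)
  have \<mu>: "\<mu>1 + \<mu>2 = k" "\<mu>1 * \<mu>2 = -1" "\<mu>1 - \<mu>2 > 0"
    using sq by (simp_all add: \<mu>1_def \<mu>2_def field_simps power2_eq_square)
  have eigen: "\<exists>p. \<forall>s\<in>{u<..<v}. N s - cscale (\<i> * \<nu>) (\<gamma> s) = cscale (cis (\<mu> * (l s / c))) p"
    if mn: "\<mu> + \<nu> = k" "\<mu> * \<nu> = -1" for \<mu> \<nu> :: real
  proof -
    define P where "P = (\<lambda>s. cscale (cis (- (\<mu> * (l s / c)))) (N s - cscale (\<i> * \<nu>) (\<gamma> s)))"
    have "(P has_vector_derivative 0) (at s within {u<..<v})" if s: "s \<in> {u<..<v}" for s
    proof -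
      define r where "r = cmod (a s) / c"
      have dc: "((\<lambda>s. cis (- (\<mu> * (l s / c)))) has_vector_derivative
          (- (\<mu> * r)) *\<^sub>R (\<i> * cis (- (\<mu> * (l s / c))))) (at s)"
        unfolding has_vector_derivative_def
        by (rule has_derivative_eq_rhs[OF has_derivative_cis[OF has_derivative_minus[OF
          has_derivative_mult_right[OF bounded_linear.has_derivative[OF bounded_linear_divide l(2)[OF s, unfolded has_vector_derivative_def]]]]]])
         (simp add: fun_eq_iff r_def)
      have dv: "((\<lambda>s. N s - cscale (\<i> * \<nu>) (\<gamma> s)) has_vector_derivative
          r *\<^sub>R (cscale (\<i> * k) (N s) - \<gamma> s) - (cscale (\<i> * \<nu>) (r *\<^sub>R N s) + cscale 0 (\<gamma> s))) (at s)"
        unfolding r_def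
        by (intro has_vector_derivative_diff dN[OF s] has_vector_derivative_cscale dg[OF s] has_vector_derivative_const)
      have k: "complex_of_real k = of_real \<mu> + of_real \<nu>" and mn': "complex_of_real \<mu> * of_real \<nu> = -1"
        using mn by (metis of_real_add, metis of_real_mult of_real_minus of_real_1)
      have ab: "of_real r * (\<i> * (of_real \<mu> + of_real \<nu>) * x - y) - \<i> * of_real \<nu> * (of_real r * x)
          = \<i> * (of_real \<mu> * of_real r) * (x - \<i> * of_real \<nu> * y)" for x y :: complex
      proof -
        have "\<i> * (of_real \<mu> * of_real r) * (x - \<i> * of_real \<nu> * y)
          = \<i> * of_real \<mu> * of_real r * x - (\<i> * \<i>) * (of_real \<mu> * of_real \<nu>) * (of_real r * y)"
          by (simp only: right_diff_distrib mult_ac)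
        then show ?thesis unfolding mn' by (simp add: algebra_simps)
      qed
      have e: "r *\<^sub>R (cscale (\<i> * k) (N s) - \<gamma> s) - (cscale (\<i> * \<nu>) (r *\<^sub>R N s) + cscale 0 (\<gamma> s))
          = cscale (\<i> * of_real (\<mu> * r)) (N s - cscale (\<i> * \<nu>) (\<gamma> s))"
      proof (rule prod_eqI)
        show "fst (r *\<^sub>R (cscale (\<i> * k) (N s) - \<gamma> s) - (cscale (\<i> * \<nu>) (r *\<^sub>R N s) + cscale 0 (\<gamma> s)))
          = fst (cscale (\<i> * of_real (\<mu> * r)) (N s - cscale (\<i> * \<nu>) (\<gamma> s)))"
          by (simp add: k scaleR_conv_of_real ab)
        show "snd (r *\<^sub>R (cscale (\<i> * k) (N s) - \<gamma> s) - (cscale (\<i> * \<nu>) (r *\<^sub>R N s) + cscale 0 (\<gamma> s)))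
          = snd (cscale (\<i> * of_real (\<mu> * r)) (N s - cscale (\<i> * \<nu>) (\<gamma> s)))"
          by (simp add: k scaleR_conv_of_real ab)
      qed
      have "(P has_vector_derivative 0) (at s)"
        unfolding P_def using has_vector_derivative_cscale[OF dc dv] unfolding e
        by (simp add: cscale_cscale scaleR_conv_of_real flip: cscale_add_left) (simp add: cscale_def mult_ac flip: zero_prod_def)
      then show ?thesis by (rule has_vector_derivative_at_within)
    qed
    from has_vector_derivative_zero_constant[OF convex_real_interval(8) this]
    obtain p where p: "\<And>s. s \<in> {u<..<v} \<Longrightarrow> P s = p" by blast
    have "N s - cscale (\<i> * \<nu>) (\<gamma> s) = cscale (cis (\<mu> * (l s / c))) p" if s: "s \<in> {u<..<v}" for s
      unfolding p[OF s, symmetric] P_def cscale_cscale cis_mult by (simp add: prod_eq_iff)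
    then show ?thesis by blast
  qed
  obtain p1 where p1: "\<And>s. s \<in> {u<..<v} \<Longrightarrow> N s - cscale (\<i> * \<mu>2) (\<gamma> s) = cscale (cis (\<mu>1 * (l s / c))) p1"
    using eigen[OF \<mu>(1,2)] by blast
  obtain p2 where p2: "\<And>s. s \<in> {u<..<v} \<Longrightarrow> N s - cscale (\<i> * \<mu>1) (\<gamma> s) = cscale (cis (\<mu>2 * (l s / c))) p2"
    using eigen[of \<mu>2 \<mu>1] \<mu>(1,2) by (auto simp: add.commute mult.commute)
  let ?s = "(u + v) / 2"
  have hN: "hprod (N ?s) (N ?s) = 1" "hprod (N ?s) (\<gamma> ?s) = 0" "hprod (\<gamma> ?s) (N ?s) = 0" "hprod (\<gamma> ?s) (\<gamma> ?s) = 1"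
  proof -
    have "cmod (\<tau> ?s) = 1" using l(1) by (simp add: \<tau>_def norm_mult)
    then show "hprod (N ?s) (N ?s) = 1" "hprod (\<gamma> ?s) (\<gamma> ?s) = 1"
      using norm_\<gamma>[OF inI[OF mid]] by (simp_all add: N_def hprod_self norm_cscale)
  qed (simp_all add: N_def hprod_cscale)
  have "hprod (cscale (cis (\<mu>1 * (l ?s / c))) p1) (cscale (cis (\<mu>2 * (l ?s / c))) p2) = 0"
    unfolding p1[OF mid, symmetric] p2[OF mid, symmetric] hprod_minus hprod_cscale hN
    using arg_cong[OF \<mu>(2), of complex_of_real] by (simp add: algebra_simps)
  then have orth: "hprod p1 p2 = 0" by (simp add: hprod_cscale cis_neq_zero)
  have "hprod (cscale (cis (\<mu>1 * (l ?s / c))) p1) (cscale (cis (\<mu>1 * (l ?s / c))) p1) \<noteq> 0"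
    unfolding p1[OF mid, symmetric] hprod_minus hprod_cscale hN
    by (simp add: complex_eq_iff) (smt (verit) zero_le_square)
  then have "p1 \<noteq> 0" by (auto simp: hprod_def)
  have "hprod (cscale (cis (\<mu>2 * (l ?s / c))) p2) (cscale (cis (\<mu>2 * (l ?s / c))) p2) \<noteq> 0"
    unfolding p2[OF mid, symmetric] hprod_minus hprod_cscale hN
    by (simp add: complex_eq_iff) (smt (verit) zero_le_square)
  then have "p2 \<noteq> 0" by (auto simp: hprod_def)
  define w where "w = c / (\<i> * (\<mu>1 - \<mu>2))"
  have w0: "w \<noteq> 0" using c \<mu>(3) by (auto simp: w_def)
  define u1 u2 where "u1 = cscale w p1" and "u2 = cscale (- w) p2"
  have u12: "u1 \<noteq> 0" "u2 \<noteq> 0" "hprod u1 u2 = 0"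
    using w0 \<open>p1 \<noteq> 0\<close> \<open>p2 \<noteq> 0\<close> by (auto simp: u1_def u2_def prod_eq_iff)
      (simp_all add: hprod_cscale orth)
  from unitary_normal_form[OF this] obtain g where g: "congruence g"
      "\<And>z w. g (m + cscale z u1 + cscale w u2) = (of_real (norm u1) * z, of_real (norm u2) * w)" by blast
  define H where "H = (\<lambda>x::real\<times>real. (snd x + \<mu>1 * (l (fst x) / c), snd x + \<mu>2 * (l (fst x) / c)))"
  have "g (Y x) = torus_map (norm u1) (norm u2) (H x)" if x: "x \<in> {u<..<v} \<times> UNIV" for x
  proof -
    have s: "fst x \<in> {u<..<v}" using x by auto
    have "cscale (\<i> * (\<mu>1 - \<mu>2)) (\<gamma> (fst x)) = cscale (cis (\<mu>1 * (l (fst x) / c))) p1 - cscale (cis (\<mu>2 * (l (fst x) / c))) p2"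
      unfolding p1[OF s, symmetric] p2[OF s, symmetric] by (simp add: cscale_def algebra_simps)
    then have "cscale w (cscale (\<i> * (\<mu>1 - \<mu>2)) (\<gamma> (fst x)))
       = cscale w (cscale (cis (\<mu>1 * (l (fst x) / c))) p1 - cscale (cis (\<mu>2 * (l (fst x) / c))) p2)"
      by (rule arg_cong)
    moreover have "cscale w (cscale (\<i> * (\<mu>1 - \<mu>2)) (\<gamma> (fst x))) = cscale c (\<gamma> (fst x))"
      unfolding cscale_cscale w_def using \<mu>(3) by (simp flip: of_real_diff)
    ultimately have g: "cscale c (\<gamma> (fst x)) = cscale (cis (\<mu>1 * (l (fst x) / c))) u1 + cscale (cis (\<mu>2 * (l (fst x) / c))) u2"
      by (simp add: u1_def u2_def cscale_def algebra_simps)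
    have "Y x = m + cscale (cis (snd x)) (cscale c (\<gamma> (fst x)))"
      unfolding Y_def m[OF s] cscale_cscale by (simp add: mult.commute)
    also have "\<dots> = m + cscale (cis (snd x + \<mu>1 * (l (fst x) / c))) u1 + cscale (cis (snd x + \<mu>2 * (l (fst x) / c))) u2"
      unfolding g by (simp add: cscale_add_right cscale_cscale cis_mult)
    finally show ?thesis by (simp add: \<open>\<And>z w. g (m + cscale z u1 + cscale w u2) = _\<close> torus_map_def H_def)
  qed
  moreover have "continuous_on ({u<..<v} \<times> UNIV) H"
  proof -
    have "continuous_on ({u<..<v} \<times> UNIV) (\<lambda>x::real\<times>real. l (fst x))"
      by (rule continuous_on_compose2[OF li(2) continuous_on_fst]) auto
    then show ?thesis unfolding H_def using c by (intro continuous_intros) auto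
  qed
  moreover have "inj_on H ({u<..<v} \<times> UNIV)"
  proof (rule inj_onI)
    fix x y assume xy: "x \<in> {u<..<v} \<times> UNIV" "y \<in> {u<..<v} \<times> UNIV" "H x = H y"
    then have "snd x + \<mu>1 * (l (fst x) / c) = snd y + \<mu>1 * (l (fst y) / c)"
      "snd x + \<mu>2 * (l (fst x) / c) = snd y + \<mu>2 * (l (fst y) / c)" by (auto simp: H_def)
    then have "(\<mu>1 - \<mu>2) * (l (fst x) / c) = (\<mu>1 - \<mu>2) * (l (fst y) / c)"
      unfolding left_diff_distrib by linarith
    then have ll: "l (fst x) = l (fst y)" using \<mu>(3) c by simp
    have "fst x \<in> {u<..<v}" "fst y \<in> {u<..<v}" using xy(1,2) by auto
    then have "fst x = fst y" by (rule inj_onD[OF li(1) ll])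
    moreover have "snd x = snd y" using xy(3) ll by (simp add: H_def)
    ultimately show "x = y" by (rule prod_eqI)
  qed
  moreover have "product_model (torus_map (norm u1) (norm u2))"
    using u12 unfolding product_model_def by (intro disjI1 exI[of _ "norm u1"] conjI exI[of _ "norm u2"]) auto
  ultimately show ?thesis using g(1) by blast
qed

lemma normal_form:
  "\<exists>k H \<Phi>. congruence k \<and> product_model \<Phi> \<and> continuous_on ({u<..<v} \<times> UNIV) H \<and>
    inj_on H ({u<..<v} \<times> UNIV) \<and> (\<forall>x\<in>{u<..<v} \<times> UNIV. k (Y x) = \<Phi> (H x))"
  using a_or_W_vanishes normal_form_fixed_frame normal_form_fixed_center by blast

end

end

section \<open>Products of circles and lines as models\<close>

text \<open>
The exponential is an open map, and an open set of angles, thickened in the real direction, has an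
image whose trace on the circle is the arc in question.
\<close>

lemma openin_circle_image:
  assumes "r > 0" "open T"
  shows "openin (top_of_set (sphere 0 r)) ((\<lambda>x. of_real r * cis x) ` T)"
proof -
  have "open {w. Im w \<in> T}"
    using open_vimage[OF assms(2), of Im] by (simp add: vimage_def continuous_on_Im)
  then have "openin (top_of_set (- {0})) (exp ` {w::complex. Im w \<in> T})"
    using covering_space_open_map[OF covering_space_exp_punctured_plane] by simp
  then have "open (exp ` {w::complex. Im w \<in> T})"
    using openin_open_trans by blast
  then have "open ((\<lambda>z. r *\<^sub>R z) ` exp ` {w::complex. Im w \<in> T})"
    using assms(1) by (intro open_scaling) auto
  moreover have "(\<lambda>x. of_real r * cis x) ` T = sphere 0 r \<inter> (\<lambda>z. r *\<^sub>R z) ` exp ` {w::complex. Im w \<in> T}"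
  proof (intro equalityI subsetI)
    fix z assume "z \<in> (\<lambda>x. of_real r * cis x) ` T"
    then obtain x where x: "x \<in> T" "z = of_real r * cis x" by blast
    then have "z = r *\<^sub>R exp (\<i> * of_real x)" by (simp add: cis_conv_exp scaleR_conv_of_real)
    moreover have "\<i> * of_real x \<in> {w. Im w \<in> T}" using x by simp
    moreover have "z \<in> sphere 0 r" using x assms(1) by (simp add: norm_mult)
    ultimately show "z \<in> sphere 0 r \<inter> (\<lambda>z. r *\<^sub>R z) ` exp ` {w::complex. Im w \<in> T}" by blast
  next
    fix z assume z: "z \<in> sphere 0 r \<inter> (\<lambda>z. r *\<^sub>R z) ` exp ` {w::complex. Im w \<in> T}"
    then obtain w where w: "Im w \<in> T" "z = r *\<^sub>R exp w" by blast
    then have "exp (Re w) = 1" using z assms(1) by simp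
    then have "exp w = cis (Im w)" by (simp add: exp_eq_polar)
    then show "z \<in> (\<lambda>x. of_real r * cis x) ` T" using w by (auto simp: scaleR_conv_of_real)
  qed
  ultimately show ?thesis by (auto simp: openin_open)
qed

lemma openin_line_image:
  assumes "open T"
  shows "openin (top_of_set (\<real>::complex set)) (of_real ` T)"
proof -
  have "open (Re -` T)" using open_vimage[OF assms, of Re] by (simp add: continuous_on_Re)
  moreover have "of_real ` T = \<real> \<inter> Re -` T"
    by (auto simp: Reals_def image_iff)
  ultimately show ?thesis by (auto simp: openin_open)
qed

lemma openin_product_image:
  fixes f :: "real \<Rightarrow> 'a::topological_space" and g :: "real \<Rightarrow> 'b::topological_space"
  assumes f: "\<And>A. open A \<Longrightarrow> openin (top_of_set S1) (f ` A)"
    and g: "\<And>A. open A \<Longrightarrow> openin (top_of_set S2) (g ` A)" and T: "open T"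
  shows "openin (top_of_set (S1 \<times> S2)) ((\<lambda>z. (f (fst z), g (snd z))) ` T)"
proof (subst openin_subopen, rule ballI)
  fix y assume "y \<in> (\<lambda>z. (f (fst z), g (snd z))) ` T"
  then obtain z where z: "z \<in> T" "y = (f (fst z), g (snd z))" by blast
  obtain A B where AB: "open A" "open B" "z \<in> A \<times> B" "A \<times> B \<subseteq> T" using open_prod_elim[OF T z(1)] by blast
  have "openin (top_of_set (S1 \<times> S2)) (f ` A \<times> g ` B)"
    using openin_Times[OF f[OF AB(1)] g[OF AB(2)]] by (simp add: subtopology_Times)
  moreover have "y \<in> f ` A \<times> g ` B" using z AB by auto
  moreover have "f ` A \<times> g ` B \<subseteq> (\<lambda>z. (f (fst z), g (snd z))) ` T"
    using AB(4) by force
  ultimately show "\<exists>T'. openin (top_of_set (S1 \<times> S2)) T' \<and> y \<in> T' \<and> T' \<subseteq> (\<lambda>z. (f (fst z), g (snd z))) ` T"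
    by blast
qed

lemma circle_range: "r > 0 \<Longrightarrow> range (\<lambda>x. of_real r * cis x) = sphere (0::complex) r"
proof (intro equalityI subsetI)
  fix z :: complex assume "r > 0" "z \<in> sphere 0 r"
  then have "z = of_real r * cis (Arg z)" using rcis_cmod_Arg[of z] by (simp add: rcis_def)
  then show "z \<in> range (\<lambda>x. of_real r * cis x)" by blast
qed (auto simp: norm_mult)

lemma range_pair: "range (\<lambda>z. (f (fst z), g (snd z))) = range f \<times> range g"
proof -
  have "(f x, g y) \<in> range (\<lambda>z. (f (fst z), g (snd z)))" for x y
    by (rule image_eqI[of _ _ "(x, y)"]) simp_all
  then show ?thesis by auto
qed

lemma range_torus_map: "r1 > 0 \<Longrightarrow> r2 > 0 \<Longrightarrow> range (torus_map r1 r2) = sphere 0 r1 \<times> sphere 0 r2"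
  unfolding torus_map_def[abs_def]
  by (simp only: range_pair[of "\<lambda>x. of_real r1 * cis x" "\<lambda>x. of_real r2 * cis x"] circle_range)

lemma range_cylinder_map: "r > 0 \<Longrightarrow> range (cylinder_map r) = sphere 0 r \<times> \<real>"
  unfolding cylinder_map_def[abs_def] Reals_def
  by (simp only: range_pair[of "\<lambda>x. of_real r * cis x" of_real] circle_range)

lemma product_model_open_map:
  assumes "product_model \<Phi>" "open T"
  shows "openin (top_of_set (range \<Phi>)) (\<Phi> ` T)"
  using assms(1) unfolding product_model_def
proof (elim disjE exE conjE)
  fix r1 r2 :: real assume r: "r1 > 0" "r2 > 0" "\<Phi> = torus_map r1 r2"
  show ?thesis
    unfolding r(3) range_torus_map[OF r(1,2)] unfolding torus_map_def[abs_def]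
    by (rule openin_product_image[OF openin_circle_image[OF r(1)] openin_circle_image[OF r(2)] assms(2)])
next
  fix r :: real assume r: "r > 0" "\<Phi> = cylinder_map r"
  show ?thesis
    unfolding r(2) range_cylinder_map[OF r(1)] unfolding cylinder_map_def[abs_def]
    by (rule openin_product_image[OF openin_circle_image[OF r(1)] openin_line_image assms(2)])
qed

lemma product_model_continuous: "product_model \<Phi> \<Longrightarrow> continuous_on S \<Phi>"
proof -
  have "continuous_on UNIV cis" using continuous_on_cis[OF continuous_on_id] by simp
  then have "continuous_on S (\<lambda>x::real\<times>real. cis (fst x))" "continuous_on S (\<lambda>x::real\<times>real. cis (snd x))"
    by (auto intro!: continuous_intros)
  then show "product_model \<Phi> \<Longrightarrow> continuous_on S \<Phi>"
    unfolding product_model_def torus_map_def[abs_def] cylinder_map_def[abs_def]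
    by (auto intro!: continuous_intros)
qed

text \<open>
A piece of the surface is congruent to an open piece of \<open>S\<close>, and so is every open part of it. The
second clause allows restriction to the overlap of two charts; openness of the image of \<open>V\<close> alone
would not suffice for this, because \<open>X\<close> need not be injective.
\<close>

definition modelled_at ::
  "(real \<times> real) set \<Rightarrow> (real \<times> real \<Rightarrow> complex \<times> complex) \<Rightarrow> real \<times> real \<Rightarrow> (complex \<times> complex) set \<Rightarrow> bool" where
  "modelled_at U X p S \<longleftrightarrow> (\<exists>V k. open V \<and> p \<in> V \<and> V \<subseteq> U \<and> congruence k \<and>
     (\<forall>V'. open V' \<and> V' \<subseteq> V \<longrightarrow> openin (top_of_set S) (k ` X ` V')))"

lemma congruence_continuous:
  assumes "congruence g" shows "continuous_on S g"
proof -
  obtain A b where A: "orthogonal_transformation A" "g = (\<lambda>p. A p + b)"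
    using assms unfolding congruence_def by blast
  then have "linear A" using orthogonal_transformation_linear by blast
  then show ?thesis unfolding A(2) by (intro continuous_intros linear_continuous_on) (simp add: linear_conv_bounded_linear)
qed

lemma congruence_openin:
  assumes "congruence g" "openin (top_of_set S) T"
  shows "openin (top_of_set (g ` S)) (g ` T)"
proof -
  obtain h where h: "congruence h" "\<And>p. h (g p) = p" "\<And>p. g (h p) = p"
    using congruence_inverse[OF assms(1)] by blast
  obtain O' where O': "open O'" "T = S \<inter> O'" using assms(2) by (auto simp: openin_open)
  have "open (h -` O')" using open_vimage[OF O'(1) congruence_continuous[OF h(1)]] .
  moreover have "g ` T = g ` S \<inter> h -` O'" unfolding O'(2) using h(2) by auto
  ultimately show ?thesis by (auto simp: openin_open)
qed

lemma modelled_at_congruent: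
  assumes "modelled_at U X p S" "congruence g"
  shows "modelled_at U X p (g ` S)"
proof -
  obtain V k where V: "open V" "p \<in> V" "V \<subseteq> U" "congruence k"
     "\<And>V'. open V' \<Longrightarrow> V' \<subseteq> V \<Longrightarrow> openin (top_of_set S) (k ` X ` V')"
    using assms(1) unfolding modelled_at_def by blast
  have "openin (top_of_set (g ` S)) ((\<lambda>p. g (k p)) ` X ` V')" if "open V'" "V' \<subseteq> V" for V'
    using congruence_openin[OF assms(2) V(5)[OF that]] by (simp add: image_image)
  then show ?thesis
    unfolding modelled_at_def using V(1-3) congruence_compose[OF assms(2) V(4)] by blast
qed

section \<open>Rigidity of the models\<close>

text \<open>
The squared modulus is a trigonometric polynomial in \<open>x\<close> with frequency one coefficient
\<open>2 u cnj v\<close>.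
\<close>

lemma circle_in_circle:
  assumes ab: "x0 < x1" and u: "u \<noteq> 0" and eq: "\<And>x. x \<in> {x0<..<x1} \<Longrightarrow> cmod (u * cis x + v) = \<rho>"
  shows "v = 0" "cmod u = \<rho>"
proof -
  have "Re (u * cnj v * cis x) = (\<rho>\<^sup>2 - (cmod u)\<^sup>2 - (cmod v)\<^sup>2) / 2" if x: "x \<in> {x0<..<x1}" for x
  proof -
    have "(cmod (u * cis x + v))\<^sup>2 = (cmod (u * cis x))\<^sup>2 + (cmod v)\<^sup>2 + 2 * Re (u * cis x * cnj v)"
      unfolding cmod_power2 by (simp add: algebra_simps power2_eq_square)
    then show ?thesis using eq[OF x] by (simp add: norm_mult algebra_simps)
  qed
  from Re_cis_const_imp_zero[OF ab this] show v: "v = 0" using u by simp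
  have "(x0 + x1) / 2 \<in> {x0<..<x1}" using ab by auto
  from eq[OF this] v show "cmod u = \<rho>" by (simp add: norm_mult)
qed

lemma cis_affine_const:
  assumes "x0 < x1" "\<And>x. x \<in> {x0<..<x1} \<Longrightarrow> u * cis x + v = 0"
  shows "u = 0"
proof (rule Re_cis_const_imp_zero[OF assms(1)])
  show "Re (u * cis x) = - Re v" if "x \<in> {x0<..<x1}" for x
    using arg_cong[OF assms(2)[OF that], of Re] by simp
qed

lemma Im_cis_affine_const:
  assumes "x0 < x1" "\<And>x. x \<in> {x0<..<x1} \<Longrightarrow> Im (u * cis x + v) = 0"
  shows "u = 0"
proof -
  have "- \<i> * u = 0"
  proof (rule Re_cis_const_imp_zero[OF assms(1)])
    show "Re (- \<i> * u * cis x) = - Im v" if "x \<in> {x0<..<x1}" for x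
      using assms(2)[OF that] by simp
  qed
  then show ?thesis by simp
qed

text \<open>
The matrix of a congruence is unitary. The last three facts are all that is used of this: a zero entry
forces the matrix to be diagonal or antidiagonal with unimodular entries.
\<close>

lemma congruence_coordinates:
  assumes "congruence g"
  obtains \<alpha>1 \<alpha>2 \<beta>1 \<beta>2 b1 b2 where
    "\<And>z w. g (z, w) = (\<alpha>1 * z + \<beta>1 * w + b1, \<alpha>2 * z + \<beta>2 * w + b2)"
    "\<alpha>1 = 0 \<Longrightarrow> \<beta>2 = 0 \<and> cmod \<alpha>2 = 1 \<and> cmod \<beta>1 = 1"
    "\<alpha>2 = 0 \<Longrightarrow> \<beta>1 = 0 \<and> cmod \<alpha>1 = 1 \<and> cmod \<beta>2 = 1"
    "\<beta>1 = 0 \<Longrightarrow> \<alpha>2 = 0 \<and> cmod \<alpha>1 = 1 \<and> cmod \<beta>2 = 1"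
proof -
  obtain A b where A: "g = (\<lambda>p. A p + b)" "orthogonal_transformation A" "\<And>z p. A (cscale z p) = cscale z (A p)"
    using congruence_cscale[OF assms] by blast
  have linA: "linear A" and isoA: "\<And>u v. A u \<bullet> A v = u \<bullet> v"
    using A(2) by (auto simp: orthogonal_transformation_def)
  define a where "a = A (1, 0)"
  define d where "d = A (0, 1)"
  have Aeq: "A (z, w) = cscale z a + cscale w d" for z w
  proof -
    have "(z, w) = cscale z (1, 0) + cscale w (0, 1)" by (simp add: cscale_def)
    then have "A (z, w) = A (cscale z (1, 0) + cscale w (0, 1))" by (rule arg_cong)
    then show ?thesis unfolding a_def d_def by (simp only: linear_add[OF linA] A(3))
  qed
  have h: "hprod (A p) (A q) = hprod p q" for p q
  proof (rule complex_eqI)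
    show "Re (hprod (A p) (A q)) = Re (hprod p q)" using isoA[of p q] by (simp add: inner_eq_hprod)
    have "Im x = Re (- \<i> * x)" for x by simp
    then show "Im (hprod (A p) (A q)) = Im (hprod p q)"
      using isoA[of "cscale (- \<i>) p" q] unfolding A(3) inner_eq_hprod hprod_cscale by (simp only:)
  qed
  have ad: "hprod a d = 0" "hprod a a = 1" "hprod d d = 1"
    unfolding a_def d_def h by (simp_all add: hprod_def)
  have na: "(cmod (fst a))\<^sup>2 + (cmod (snd a))\<^sup>2 = 1" "(cmod (fst d))\<^sup>2 + (cmod (snd d))\<^sup>2 = 1"
  proof -
    have "complex_of_real ((cmod (fst a))\<^sup>2 + (cmod (snd a))\<^sup>2) = 1"
      "complex_of_real ((cmod (fst d))\<^sup>2 + (cmod (snd d))\<^sup>2) = 1"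
      using ad(2,3) by (simp_all only: hprod_def complex_norm_square of_real_add)
    then show "(cmod (fst a))\<^sup>2 + (cmod (snd a))\<^sup>2 = 1" "(cmod (fst d))\<^sup>2 + (cmod (snd d))\<^sup>2 = 1"
      by (simp_all only: of_real_eq_1_iff)
  qed
  have o: "fst a * cnj (fst d) + snd a * cnj (snd d) = 0" using ad(1) by (simp add: hprod_def)
  have sq1: "x = 1" if "x\<^sup>2 = 1" "x \<ge> 0" for x :: real using that by (simp add: power2_eq_1_iff)
  show ?thesis
  proof (rule that[of "fst a" "fst d" "fst b" "snd a" "snd d" "snd b"])
    show "g (z, w) = (fst a * z + fst d * w + fst b, snd a * z + snd d * w + snd b)" for z w
      by (simp add: A(1) Aeq prod_eq_iff mult.commute)
    show "fst a = 0 \<Longrightarrow> snd d = 0 \<and> cmod (snd a) = 1 \<and> cmod (fst d) = 1"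
      using na o sq1[of "cmod (snd a)"] sq1[of "cmod (fst d)"] by auto
    show "snd a = 0 \<Longrightarrow> fst d = 0 \<and> cmod (fst a) = 1 \<and> cmod (snd d) = 1"
      using na o sq1[of "cmod (fst a)"] sq1[of "cmod (snd d)"] by auto
    show "fst d = 0 \<Longrightarrow> snd a = 0 \<and> cmod (fst a) = 1 \<and> cmod (snd d) = 1"
      using na o sq1[of "cmod (fst a)"] sq1[of "cmod (snd d)"] by auto
  qed
qed

lemma swap_congruence: "congruence (\<lambda>p. (snd p, fst p))"
proof -
  define A where "A = (\<lambda>p::complex\<times>complex. (snd p, fst p))"
  have "linear A" by (rule linearI) (simp_all add: A_def)
  moreover have "norm (A p) = norm p" for p by (simp add: A_def norm_prod_def add.commute)
  ultimately have "orthogonal_transformation A" by (simp add: orthogonal_transformation)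
  moreover have "A (J p) = J (A p)" for p by (simp add: A_def J_def)
  moreover have "(\<lambda>p. (snd p, fst p)) = (\<lambda>p. A p + 0)" by (simp add: A_def)
  ultimately show ?thesis unfolding congruence_def by blast
qed

lemma id_congruence: "congruence (\<lambda>p. p)"
proof -
  have "orthogonal_transformation (\<lambda>p::complex\<times>complex. p)" by simp
  moreover have "(\<lambda>p::complex\<times>complex. p) = (\<lambda>p. p + 0)" by simp
  ultimately show ?thesis unfolding congruence_def by metis
qed

text \<open>
In each coordinate the image of a product of arcs has constant modulus (torus) or constant imaginary
part (cylinder). Varying one angle at a time shows that each row of the matrix has a zero entry, so the
congruence preserves the two factors or exchanges them. In a cylinder the second row would
vanish altogether, which is impossible.
\<close>

lemma torus_rigid:
  assumes r: "r1 > 0" "r2 > 0" and g: "congruence g"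
    and box: "x0 < x1" "y0 < y1"
    and sub: "\<And>x y. x \<in> {x0<..<x1} \<Longrightarrow> y \<in> {y0<..<y1} \<Longrightarrow> g (torus_map r1 r2 (x, y)) \<in> range \<Psi>"
    and \<Psi>: "product_model \<Psi>"
  shows "\<exists>k. congruence k \<and> k ` range (torus_map r1 r2) = range \<Psi>"
proof -
  obtain \<alpha>1 \<alpha>2 \<beta>1 \<beta>2 b1 b2 where
    g: "\<And>z w. g (z, w) = (\<alpha>1 * z + \<beta>1 * w + b1, \<alpha>2 * z + \<beta>2 * w + b2)"
    and a1: "\<alpha>1 = 0 \<Longrightarrow> \<beta>2 = 0 \<and> cmod \<alpha>2 = 1 \<and> cmod \<beta>1 = 1"
    and a2: "\<alpha>2 = 0 \<Longrightarrow> \<beta>1 = 0 \<and> cmod \<alpha>1 = 1 \<and> cmod \<beta>2 = 1"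
    and be1: "\<beta>1 = 0 \<Longrightarrow> \<alpha>2 = 0 \<and> cmod \<alpha>1 = 1 \<and> cmod \<beta>2 = 1"
    using congruence_coordinates[OF g] by (metis (no_types, lifting))
  have midx: "(x0 + x1) / 2 \<in> {x0<..<x1}" and midy: "(y0 + y1) / 2 \<in> {y0<..<y1}" using box by auto
  from \<Psi> consider (torus) s1 s2 where "s1 > 0" "s2 > 0" "\<Psi> = torus_map s1 s2"
    | (cyl) s where "s > 0" "\<Psi> = cylinder_map s"
    unfolding product_model_def by blast
  then show ?thesis
  proof cases
    case torus
    have e: "cmod (\<alpha>1 * r1 * cis x + (\<beta>1 * r2 * cis y + b1)) = s1"
       "cmod (\<alpha>2 * r1 * cis x + (\<beta>2 * r2 * cis y + b2)) = s2"
      if "x \<in> {x0<..<x1}" "y \<in> {y0<..<y1}" for x y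
      using sub[OF that] unfolding torus(3) range_torus_map[OF torus(1,2)]
      by (simp_all add: torus_map_def g mult.assoc add.assoc)
    show ?thesis
    proof (cases "\<alpha>1 = 0")
      case False
      have "\<beta>1 * r2 * cis y + b1 = 0" if "y \<in> {y0<..<y1}" for y
        by (rule circle_in_circle(1)[OF box(1) _ e(1)[OF _ that]]) (use False r in auto)
      from cis_affine_const[OF box(2) this] have b0: "\<beta>1 = 0" using r by simp
      then have u: "\<alpha>2 = 0" "cmod \<alpha>1 = 1" "cmod \<beta>2 = 1" using be1 by auto
      have "cmod (\<alpha>1 * r1) = s1"
        by (rule circle_in_circle(2)[OF box(1) _ e(1)[OF _ midy]]) (use False r in auto)
      moreover have "cmod (\<beta>2 * r2) = s2"
        by (rule circle_in_circle(2)[OF box(2), of _ b2])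
           (use u r e(2)[OF midx] in \<open>auto simp: norm_mult\<close>)
      ultimately have "s1 = r1" "s2 = r2" using u r by (auto simp: norm_mult)
      then show ?thesis using id_congruence torus(3) by (intro exI[of _ "\<lambda>p. p"]) simp
    next
      case True
      then have u: "\<beta>2 = 0" "cmod \<alpha>2 = 1" "cmod \<beta>1 = 1" using a1 by auto
      have "cmod (\<beta>1 * r2) = s1"
        by (rule circle_in_circle(2)[OF box(2), of _ b1])
           (use u r True e(1)[OF midx] in \<open>auto simp: norm_mult\<close>)
      moreover have "cmod (\<alpha>2 * r1) = s2"
        by (rule circle_in_circle(2)[OF box(1), of _ b2])
           (use u r e(2)[OF _ midy] in \<open>auto simp: norm_mult\<close>)
      ultimately have s: "s1 = r2" "s2 = r1" using u r by (auto simp: norm_mult)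
      have "(\<lambda>p. (snd p, fst p)) ` range (torus_map r1 r2) = range \<Psi>"
        unfolding torus(3) s range_torus_map[OF r] range_torus_map[OF r(2,1)] by force
      then show ?thesis using swap_congruence by blast
    qed
  next
    case cyl
    have e: "Im (\<alpha>2 * r1 * cis x + (\<beta>2 * r2 * cis y + b2)) = 0"
      if "x \<in> {x0<..<x1}" "y \<in> {y0<..<y1}" for x y
    proof -
      have "\<alpha>2 * r1 * cis x + (\<beta>2 * r2 * cis y + b2) \<in> \<real>"
        using sub[OF that] unfolding cyl(2) range_cylinder_map[OF cyl(1)]
        by (simp add: torus_map_def g mult.assoc add.assoc)
      then show ?thesis using complex_is_Real_iff by blast
    qed
    have "\<alpha>2 * r1 = 0" by (rule Im_cis_affine_const[OF box(1) e[OF _ midy]])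
    then have z: "\<alpha>2 = 0" using r by simp
    have "\<beta>2 * r2 = 0"
    proof (rule Im_cis_affine_const[OF box(2)])
      show "Im (\<beta>2 * r2 * cis y + b2) = 0" if "y \<in> {y0<..<y1}" for y
        using e[OF midx that] z by simp
    qed
    then show ?thesis using a2[OF z] r by simp
  qed
qed

lemma cylinder_rigid:
  assumes r: "r > 0" "s > 0" and g: "congruence g"
    and box: "x0 < x1" "y0 < y1"
    and sub: "\<And>x y. x \<in> {x0<..<x1} \<Longrightarrow> y \<in> {y0<..<y1} \<Longrightarrow> g (cylinder_map r (x, y)) \<in> range (cylinder_map s)"
  shows "r = s"
proof -
  obtain \<alpha>1 \<alpha>2 \<beta>1 \<beta>2 b1 b2 where
    g: "\<And>z w. g (z, w) = (\<alpha>1 * z + \<beta>1 * w + b1, \<alpha>2 * z + \<beta>2 * w + b2)"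
    and a1: "\<alpha>1 = 0 \<Longrightarrow> \<beta>2 = 0 \<and> cmod \<alpha>2 = 1 \<and> cmod \<beta>1 = 1"
    and a2: "\<alpha>2 = 0 \<Longrightarrow> \<beta>1 = 0 \<and> cmod \<alpha>1 = 1 \<and> cmod \<beta>2 = 1"
    using congruence_coordinates[OF g] by (metis (no_types, lifting))
  have midy: "(y0 + y1) / 2 \<in> {y0<..<y1}" using box by auto
  let ?y = "of_real ((y0 + y1) / 2) :: complex"
  have e: "cmod (\<alpha>1 * r * cis x + (\<beta>1 * ?y + b1)) = s" "\<alpha>2 * r * cis x + (\<beta>2 * ?y + b2) \<in> \<real>"
    if "x \<in> {x0<..<x1}" for x
    using sub[OF that midy] unfolding range_cylinder_map[OF r(2)]
    by (simp_all add: cylinder_map_def g mult.assoc add.assoc)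
  have "\<alpha>2 * r = 0"
    by (rule Im_cis_affine_const[OF box(1)]) (use e(2) complex_is_Real_iff in blast)
  then have "\<alpha>2 = 0" using r by simp
  then have u: "\<beta>1 = 0" "cmod \<alpha>1 = 1" using a2 by auto
  have "cmod (\<alpha>1 * r) = s"
    by (rule circle_in_circle(2)[OF box(1) _ e(1)]) (use u r in auto)
  then show ?thesis using u r by (simp add: norm_mult)
qed

text \<open>
If \<open>X\<close> is modelled on \<open>\<Phi>\<close> and on \<open>S\<close> near the same point, the two comparison congruences combine to
one that carries a small coordinate rectangle of \<open>\<Phi>\<close> into \<open>S\<close>.
\<close>

lemma common_patch:
  assumes \<Phi>: "product_model \<Phi>" and m1: "modelled_at U X p (range \<Phi>)" and m2: "modelled_at U X p S"
  obtains g x0 x1 y0 y1 where "congruence g" "x0 < x1" "y0 < y1"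
    "\<And>x y. x \<in> {x0<..<x1} \<Longrightarrow> y \<in> {y0<..<y1} \<Longrightarrow> g (\<Phi> (x, y)) \<in> S"
proof -
  obtain V k where V: "open V" "p \<in> V" "congruence k"
     "\<And>V'. open V' \<Longrightarrow> V' \<subseteq> V \<Longrightarrow> openin (top_of_set (range \<Phi>)) (k ` X ` V')"
    using m1 unfolding modelled_at_def by blast
  obtain V2 k2 where V2: "open V2" "p \<in> V2" "congruence k2"
     "\<And>V'. open V' \<Longrightarrow> V' \<subseteq> V2 \<Longrightarrow> openin (top_of_set S) (k2 ` X ` V')"
    using m2 unfolding modelled_at_def by blast
  obtain h where h: "congruence h" "\<And>p. h (k p) = p" "\<And>p. k (h p) = p"
    using congruence_inverse[OF V(3)] by blast
  have o1: "openin (top_of_set (range \<Phi>)) (k ` X ` (V \<inter> V2))"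
    and o2: "openin (top_of_set S) (k2 ` X ` (V \<inter> V2))"
    using V(1,4) V2(1,4) by (simp_all add: open_Int)
  obtain O' where O': "open O'" "k ` X ` (V \<inter> V2) = range \<Phi> \<inter> O'" using o1 by (auto simp: openin_open)
  have T: "open (\<Phi> -` O')" using open_vimage[OF O'(1) product_model_continuous[OF \<Phi>]] .
  have "k (X p) \<in> range \<Phi> \<inter> O'" unfolding O'(2)[symmetric] using V(2) V2(2) by blast
  then obtain z where z: "z \<in> \<Phi> -` O'" by auto
  obtain A B where AB: "open A" "open B" "z \<in> A \<times> B" "A \<times> B \<subseteq> \<Phi> -` O'" using open_prod_elim[OF T z] by blast
  have zAB: "fst z \<in> A" "snd z \<in> B" using AB(3) by (simp_all add: mem_Times_iff)
  obtain d1 where d1: "d1 > 0" "ball (fst z) d1 \<subseteq> A" using openE[OF AB(1) zAB(1)] by blast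
  obtain d2 where d2: "d2 > 0" "ball (snd z) d2 \<subseteq> B" using openE[OF AB(2) zAB(2)] by blast
  show ?thesis
  proof (rule that)
    show "congruence (\<lambda>p. k2 (h p))" using congruence_compose[OF V2(3) h(1)] .
    show "fst z - d1 < fst z + d1" "snd z - d2 < snd z + d2" using d1 d2 by auto
    fix x y assume "x \<in> {fst z - d1<..<fst z + d1}" "y \<in> {snd z - d2<..<snd z + d2}"
    then have "x \<in> ball (fst z) d1" "y \<in> ball (snd z) d2" by (auto simp: dist_real_def)
    then have "(x, y) \<in> \<Phi> -` O'" using d1 d2 AB by blast
    then have "\<Phi> (x, y) \<in> k ` X ` (V \<inter> V2)" unfolding O'(2) by simp
    then obtain v where v: "v \<in> V \<inter> V2" "\<Phi> (x, y) = k (X v)" by blast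
    have "k2 (h (\<Phi> (x, y))) \<in> k2 ` X ` (V \<inter> V2)" using v h(2) by auto
    then show "k2 (h (\<Phi> (x, y))) \<in> S" using openin_imp_subset[OF o2] by blast
  qed
qed

lemma model_unique:
  assumes \<Phi>: "product_model \<Phi>" "modelled_at U X p (range \<Phi>)" and \<Psi>: "product_model \<Psi>" "modelled_at U X p (range \<Psi>)"
  shows "\<exists>k. congruence k \<and> k ` range \<Phi> = range \<Psi>"
proof -
  obtain g x0 x1 y0 y1 where g: "congruence g" "x0 < x1" "y0 < y1"
    "\<And>x y. x \<in> {x0<..<x1} \<Longrightarrow> y \<in> {y0<..<y1} \<Longrightarrow> g (\<Phi> (x, y)) \<in> range \<Psi>"
    using common_patch[OF \<Phi> \<Psi>(2)] by metis
  obtain g' x0' x1' y0' y1' where g': "congruence g'" "x0' < x1'" "y0' < y1'"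
    "\<And>x y. x \<in> {x0'<..<x1'} \<Longrightarrow> y \<in> {y0'<..<y1'} \<Longrightarrow> g' (\<Psi> (x, y)) \<in> range \<Phi>"
    using common_patch[OF \<Psi> \<Phi>(2)] by metis
  from \<Phi>(1) consider (torus) r1 r2 where "r1 > 0" "r2 > 0" "\<Phi> = torus_map r1 r2"
    | (cyl) r where "r > 0" "\<Phi> = cylinder_map r"
    unfolding product_model_def by blast
  then show ?thesis
  proof cases
    case torus
    then show ?thesis using torus_rigid[OF torus(1,2) g(1-3) _ \<Psi>(1)] g(4) by blast
  next
    case cyl
    from \<Psi>(1) consider (torus') s1 s2 where "s1 > 0" "s2 > 0" "\<Psi> = torus_map s1 s2"
      | (cyl') s where "s > 0" "\<Psi> = cylinder_map s"
      unfolding product_model_def by blast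
    then show ?thesis
    proof cases
      case torus'
      then obtain k where k: "congruence k" "k ` range \<Psi> = range \<Phi>"
        using torus_rigid[OF torus'(1,2) g'(1-3) _ \<Phi>(1)] g'(4) by blast
      obtain h where h: "congruence h" "\<And>p. h (k p) = p" "\<And>p. k (h p) = p"
        using congruence_inverse[OF k(1)] by blast
      have "h ` range \<Phi> = range \<Psi>" unfolding k(2)[symmetric] image_image h(2) by simp
      then show ?thesis using h(1) by blast
    next
      case cyl'
      then have "r = s" using cylinder_rigid[OF cyl(1) cyl'(1) g(1-3)] g(4) cyl(2) by blast
      then show ?thesis using cyl(2) cyl'(2) id_congruence by (intro exI[of _ "\<lambda>p. p"]) simp
    qed
  qed
qed

section \<open>From local to global\<close>

text \<open>
The set of points modelled on a fixed model is open, and so is its complement, by uniqueness of the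
model up to congruence.
\<close>

lemma model_globally_constant:
  assumes "connected U" and loc: "\<And>p. p \<in> U \<Longrightarrow> \<exists>\<Phi>. product_model \<Phi> \<and> modelled_at U X p (range \<Phi>)"
  shows "\<exists>\<Phi>. product_model \<Phi> \<and> (\<forall>p\<in>U. modelled_at U X p (range \<Phi>))"
proof (cases "U = {}")
  case True
  have "product_model (cylinder_map 1)" unfolding product_model_def by (intro disjI2 exI[of _ 1]) simp
  with True show ?thesis by blast
next
  case False
  then obtain p0 where p0: "p0 \<in> U" by blast
  obtain \<Phi> where \<Phi>: "product_model \<Phi>" "modelled_at U X p0 (range \<Phi>)" using loc[OF p0] by blast
  define A where "A = {p. modelled_at U X p (range \<Phi>)}"
  define B where "B = {p. \<exists>\<Psi>. product_model \<Psi> \<and> modelled_at U X p (range \<Psi>) \<and> \<not> modelled_at U X p (range \<Phi>)}"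
  have nb: "\<exists>V. open V \<and> p \<in> V \<and> (\<forall>p'\<in>V. modelled_at U X p' S)" if m: "modelled_at U X p S" for p S
  proof -
    obtain V k where "open V" "p \<in> V" "V \<subseteq> U" "congruence k"
     "\<forall>V'. open V' \<and> V' \<subseteq> V \<longrightarrow> openin (top_of_set S) (k ` X ` V')"
      using m unfolding modelled_at_def by blast
    then show ?thesis unfolding modelled_at_def by blast
  qed
  have "open A"
  proof (subst open_subopen, rule ballI)
    fix p assume "p \<in> A"
    then have "modelled_at U X p (range \<Phi>)" by (simp add: A_def)
    from nb[OF this] obtain V where V: "open V" "p \<in> V" "\<forall>p'\<in>V. modelled_at U X p' (range \<Phi>)" by blast
    then have "V \<subseteq> A" by (auto simp: A_def)
    with V show "\<exists>T. open T \<and> p \<in> T \<and> T \<subseteq> A" by blast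
  qed
  moreover have "open B"
  proof (subst open_subopen, rule ballI)
    fix p assume "p \<in> B"
    then obtain \<Psi> where \<Psi>: "product_model \<Psi>" "modelled_at U X p (range \<Psi>)"
      and no: "\<not> modelled_at U X p (range \<Phi>)" unfolding B_def by blast
    obtain V where V: "open V" "p \<in> V" "\<And>p'. p' \<in> V \<Longrightarrow> modelled_at U X p' (range \<Psi>)" using nb[OF \<Psi>(2)] by blast
    have "p' \<in> B" if p': "p' \<in> V" for p'
    proof -
      have "\<not> modelled_at U X p' (range \<Phi>)"
      proof
        assume "modelled_at U X p' (range \<Phi>)"
        then obtain k where "congruence k" "k ` range \<Psi> = range \<Phi>"
          using model_unique[OF \<Psi>(1) V(3)[OF p'] \<Phi>(1)] by blast
        then show False using modelled_at_congruent[OF \<Psi>(2)] no by metis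
      qed
      then show ?thesis using \<Psi>(1) V(3)[OF p'] unfolding B_def by blast
    qed
    then show "\<exists>T. open T \<and> p \<in> T \<and> T \<subseteq> B" using V(1,2) by blast
  qed
  moreover have "A \<inter> B \<inter> U = {}" unfolding A_def B_def by blast
  moreover have "U \<subseteq> A \<union> B" using loc unfolding A_def B_def by blast
  ultimately have "A \<inter> U = {} \<or> B \<inter> U = {}" using connectedD[OF assms(1), of A B] by blast
  moreover have "p0 \<in> A \<inter> U" using p0 \<Phi>(2) by (simp add: A_def)
  ultimately have "U \<subseteq> A" using \<open>U \<subseteq> A \<union> B\<close> by blast
  then show ?thesis using \<Phi>(1) unfolding A_def by blast
qed

text \<open>
Restriction to smaller sets is needed because the coordinates of type II and the branch of the angle
live on different neighbourhoods.
\<close>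

lemma Ck_on_subset: "Ck_on k S f \<Longrightarrow> T \<subseteq> S \<Longrightarrow> Ck_on k T f"
  by (induction k arbitrary: f) (auto intro: continuous_on_subset)

lemma smooth_on_subset: "smooth_on S f \<Longrightarrow> T \<subseteq> S \<Longrightarrow> smooth_on T f"
  unfolding smooth_on_def using Ck_on_subset by blast

lemma lagrangian_angle_on_subset:
  "lagrangian_angle_on S X \<beta> \<Longrightarrow> T \<subseteq> S \<Longrightarrow> lagrangian_angle_on T X \<beta>"
  unfolding lagrangian_angle_on_def orthonormal_tangent_frame_def
  by (meson smooth_on_subset subsetD)

text \<open>
The normal form of \<open>Y\<close> on a strip is pulled back by the coordinates \<open>\<phi>\<close>. Both \<open>\<phi>\<close> and the
parameter change \<open>H\<close> are continuous and injective between open sets of the plane, so openness of the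
image comes from invariance of domain and openness of the model map.
\<close>

lemma (in type_II_frame) modelled_near:
  assumes V: "open V" "p \<in> V" "V \<subseteq> U" and \<phi>: "smooth_on V \<phi>" "\<phi> ` V \<subseteq> I \<times> UNIV" "inj_on \<phi> V"
    and g: "congruence g" and X: "\<And>x. x \<in> V \<Longrightarrow> X x = g (Y (\<phi> x))"
    and imm: "\<And>x. x \<in> V \<Longrightarrow> inj (frechet_derivative X (at x))"
    and ang: "lagrangian_angle_on V X \<beta>" and lap: "\<And>x. x \<in> V \<Longrightarrow> laplacian X \<beta> x = 0"
  shows "\<exists>\<Phi>. product_model \<Phi> \<and> modelled_at U X p (range \<Phi>)"
proof -
  have c\<phi>: "continuous_on V \<phi>" using \<phi>(1) by (rule smooth_on_imp_continuous_on)
  have "open (\<phi> ` V)" using invariance_of_domain[OF c\<phi> V(1) \<phi>(3)] .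
  then obtain A B where AB: "open A" "open B" "\<phi> p \<in> A \<times> B" "A \<times> B \<subseteq> \<phi> ` V"
    using open_prod_elim V(2) by (metis imageI)
  have zAB: "fst (\<phi> p) \<in> A" "snd (\<phi> p) \<in> B" using AB(3) by (simp_all add: mem_Times_iff)
  obtain d1 where d1: "d1 > 0" "ball (fst (\<phi> p)) d1 \<subseteq> A" using openE[OF AB(1) zAB(1)] by blast
  obtain d2 where d2: "d2 > 0" "ball (snd (\<phi> p)) d2 \<subseteq> B" using openE[OF AB(2) zAB(2)] by blast
  define u v t0 t1 where "u = fst (\<phi> p) - d1" and "v = fst (\<phi> p) + d1"
    and "t0 = snd (\<phi> p) - d2" and "t1 = snd (\<phi> p) + d2"
  note defs = this
  have uv: "u < v" "t0 < t1" using d1 d2 by (simp_all add: defs)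
  have sA: "{u<..<v} \<subseteq> A" and sB: "{t0<..<t1} \<subseteq> B"
    using d1(2) d2(2) by (auto simp: defs dist_real_def intro!: subsetD[OF d1(2)] subsetD[OF d2(2)])
  have box: "{u<..<v} \<times> {t0<..<t1} \<subseteq> \<phi> ` V" using sA sB AB(4) by blast
  have sub: "{u<..<v} \<subseteq> I"
  proof
    fix s assume "s \<in> {u<..<v}"
    then have "(s, (t0 + t1) / 2) \<in> \<phi> ` V" using box uv(2) by auto
    then show "s \<in> I" using \<phi>(2) by blast
  qed
  have bal: "balanced s t" if s: "s \<in> {u<..<v}" and t: "t \<in> {t0<..<t1}" for s t
  proof -
    obtain x where x: "x \<in> V" "\<phi> x = (s, t)" using s t box by (metis (no_types, lifting) SigmaI imageE subsetD)
    have sI: "s \<in> I" using s sub by blast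
    show ?thesis
      unfolding balanced_def
      by (rule stationary_equation[OF V(1) x(1) \<phi>(1,2) g X imm ang lap[OF x(1)] x(2)
            coefficients_differentiable(2)[OF sI] coefficients_differentiable(1)[OF sI]
            coefficients_differentiable(4)[OF sI] coefficients_differentiable(5)[OF sI]
            coefficients_differentiable(3)[OF sI]])
  qed
  obtain k H \<Phi> where k: "congruence k" and \<Phi>: "product_model \<Phi>"
    and H: "continuous_on ({u<..<v} \<times> UNIV) H" "inj_on H ({u<..<v} \<times> UNIV)"
    and kY: "\<And>x. x \<in> {u<..<v} \<times> UNIV \<Longrightarrow> k (Y x) = \<Phi> (H x)"
    using normal_form[OF uv sub bal] by blast
  obtain g' where g': "congruence g'" "\<And>p. g' (g p) = p" "\<And>p. g (g' p) = p"
    using congruence_inverse[OF g] by blast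
  define V0 where "V0 = V \<inter> \<phi> -` ({u<..<v} \<times> UNIV)"
  have oV0: "open V0" unfolding V0_def
    by (rule continuous_open_preimage[OF c\<phi> V(1)]) (simp add: open_Times)
  have pV0: "p \<in> V0" using V(2) d1 by (simp add: V0_def mem_Times_iff defs)
  have V0V: "V0 \<subseteq> V" and \<phi>V0: "\<phi> ` V0 \<subseteq> {u<..<v} \<times> UNIV" by (auto simp: V0_def)
  have "openin (top_of_set (range \<Phi>)) ((\<lambda>p. k (g' p)) ` X ` V')" if V': "open V'" "V' \<subseteq> V0" for V'
  proof -
    have "continuous_on V' (\<lambda>x. H (\<phi> x))"
      using V' V0V \<phi>V0 by (intro continuous_on_compose2[OF H(1) continuous_on_subset[OF c\<phi>]]) blast+
    moreover have "inj_on (\<lambda>x. H (\<phi> x)) V'"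
    proof (rule inj_onI)
      fix x y assume xy: "x \<in> V'" "y \<in> V'" "H (\<phi> x) = H (\<phi> y)"
      then have "\<phi> x = \<phi> y" using H(2) \<phi>V0 V'(2) by (meson image_subset_iff inj_onD subsetD)
      then show "x = y" using xy \<phi>(3) V'(2) V0V by (meson inj_onD subsetD)
    qed
    ultimately have "open ((\<lambda>x. H (\<phi> x)) ` V')" using invariance_of_domain V'(1) by blast
    then have "openin (top_of_set (range \<Phi>)) (\<Phi> ` (\<lambda>x. H (\<phi> x)) ` V')"
      by (rule product_model_open_map[OF \<Phi>])
    moreover have "(\<lambda>p. k (g' p)) ` X ` V' = \<Phi> ` (\<lambda>x. H (\<phi> x)) ` V'"
    proof -
      have "k (g' (X x)) = \<Phi> (H (\<phi> x))" if "x \<in> V'" for x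
      proof -
        have xV: "x \<in> V" "\<phi> x \<in> {u<..<v} \<times> UNIV" using that V' V0V \<phi>V0 by blast+
        show ?thesis unfolding X[OF xV(1)] g'(2) using kY[OF xV(2)] .
      qed
      then show ?thesis by (simp add: image_image)
    qed
    ultimately show ?thesis by simp
  qed
  then have "modelled_at U X p (range \<Phi>)"
    unfolding modelled_at_def using oV0 pV0 V0V V(3) congruence_compose[OF k g'(1)] by blast
  with \<Phi> show ?thesis by blast
qed

lemma type_II_modelled:
  assumes imm: "immersion_on U X" and II: "type_II_on U X" and st: "hamiltonian_stationary_on U X" and p: "p \<in> U"
  shows "\<exists>\<Phi>. product_model \<Phi> \<and> modelled_at U X p (range \<Phi>)"
proof -
  obtain V1 \<phi> g I s0 c \<gamma> W where V1: "open V1" "p \<in> V1" "V1 \<subseteq> U"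
    and I: "open I" "is_interval I" "s0 \<in> I" and leg: "legendrian_on I \<gamma>" and smW: "smooth_on I W"
    and immY: "immersion_on (I \<times> UNIV) (type_II_map c \<gamma> W s0)"
    and \<phi>: "diffeo_on V1 \<phi>" "\<phi> ` V1 \<subseteq> I \<times> UNIV" and g: "congruence g"
    and X: "\<And>q. q \<in> V1 \<Longrightarrow> X q = g (type_II_map c \<gamma> W s0 (\<phi> q))"
    using II p unfolding type_II_on_def by metis
  obtain V2 \<beta> where V2: "open V2" "p \<in> V2" "V2 \<subseteq> U" "lagrangian_angle_on V2 X \<beta>"
    "\<And>q. q \<in> V2 \<Longrightarrow> laplacian X \<beta> q = 0"
    using st p unfolding hamiltonian_stationary_on_def by metis
  obtain b b' b'' where b:
    "\<And>s. s \<in> I \<Longrightarrow> (\<gamma> has_vector_derivative cscale (b s) (hperp (\<gamma> s))) (at s)"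
    "\<And>s. s \<in> I \<Longrightarrow> (b has_vector_derivative b' s) (at s)"
    "\<And>s. s \<in> I \<Longrightarrow> (b' has_vector_derivative b'' s) (at s)"
    using legendrian_frame[OF I(1) leg] by metis
  obtain W' where W': "smooth_on I W'" "\<And>s. s \<in> I \<Longrightarrow> (W has_vector_derivative W' s) (at s)"
    using smooth_on_has_vector_derivative[OF smW] by metis
  obtain W'' where W'': "\<And>s. s \<in> I \<Longrightarrow> (W' has_vector_derivative W'' s) (at s)"
    using smooth_on_has_vector_derivative[OF W'(1)] by metis
  define Z where "Z = (\<lambda>s. LBINT u=ereal s0..ereal s. (W u * cnj (snd (\<gamma> u)), W u * - cnj (fst (\<gamma> u))))"
  have c\<gamma>: "continuous_on I \<gamma>" and cW: "continuous_on I W"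
    using leg smW by (auto simp: legendrian_on_def intro: smooth_on_imp_continuous_on)
  have dZ: "(Z has_vector_derivative cscale (W s) (hperp (\<gamma> s))) (at s)" if "s \<in> I" for s
    using type_II_integral_derivative[OF I(1,2,3) that, of "\<lambda>u. (W u * cnj (snd (\<gamma> u)), W u * - cnj (fst (\<gamma> u)))"]
    unfolding Z_def by (simp add: cscale_def hperp_def continuous_intros c\<gamma> cW)
  interpret P: legendrian_profile I c \<gamma> Z b b' b'' W W' W''
    using leg by unfold_locales (auto simp: legendrian_on_def b dZ W' W'')
  have Yeq: "type_II_map c \<gamma> W s0 = P.Y"
  proof
    show "type_II_map c \<gamma> W s0 z = P.Y z" for z
      unfolding type_II_map_def P.Y_def unfolding Z_def
      by (cases z) (simp add: cscale_def scaleR_conv_of_real mult_ac)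
  qed
  interpret F: type_II_frame I c \<gamma> Z b b' b'' W W' W''
    by unfold_locales (use P.immersion_nondegenerate[OF immY[unfolded Yeq]] I(3) in blast)+
  show ?thesis
  proof (rule F.modelled_near[of "V1 \<inter> V2" p U \<phi> g X \<beta>])
    show "open (V1 \<inter> V2)" "p \<in> V1 \<inter> V2" "V1 \<inter> V2 \<subseteq> U" using V1 V2 by auto
    show "smooth_on (V1 \<inter> V2) \<phi>" "inj_on \<phi> (V1 \<inter> V2)"
      using \<phi>(1) unfolding diffeo_on_def by (auto intro: smooth_on_subset inj_on_subset)
    show "\<phi> ` (V1 \<inter> V2) \<subseteq> I \<times> UNIV" using \<phi>(2) by blast
    show "lagrangian_angle_on (V1 \<inter> V2) X \<beta>" using V2(4) by (rule lagrangian_angle_on_subset) simp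
    show "X x = g (P.Y (\<phi> x))" if "x \<in> V1 \<inter> V2" for x using X that Yeq by simp
    show "inj (frechet_derivative X (at x))" if "x \<in> V1 \<inter> V2" for x
      using imm that V1(3) unfolding immersion_on_def by blast
  qed (use g V2(5) in auto)
qed

theorem proposition3:
  fixes U :: "(real \<times> real) set" and X :: "real \<times> real \<Rightarrow> complex \<times> complex"
  assumes "open U" and "connected U"
    and "immersion_on U X"
    and "lagrangian_on U X"
    and "cyclic_on U X"
    and "type_II_on U X"
    and "hamiltonian_stationary_on U X"
  shows "(\<exists>r\<^sub>1 > 0. \<exists>r\<^sub>2 > 0. locally_congruent_on U X (sphere 0 r\<^sub>1 \<times> sphere 0 r\<^sub>2)) \<or>
         (\<exists>r > 0. locally_congruent_on U X (sphere 0 r \<times> \<real>))"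
proof -
  obtain \<Phi> where \<Phi>: "product_model \<Phi>" "\<And>p. p \<in> U \<Longrightarrow> modelled_at U X p (range \<Phi>)"
    using model_globally_constant[OF assms(2) type_II_modelled[OF assms(3,6,7)]] by blast
  have lc: "locally_congruent_on U X (range \<Phi>)"
    unfolding locally_congruent_on_def
  proof
    fix p assume "p \<in> U"
    from \<Phi>(2)[OF this] show "\<exists>V g. open V \<and> p \<in> V \<and> V \<subseteq> U \<and> congruence g \<and> openin (top_of_set (range \<Phi>)) (g ` X ` V)"
      unfolding modelled_at_def by blast
  qed
  from \<Phi>(1) show ?thesis
    unfolding product_model_def
  proof (elim disjE exE conjE)
    fix r1 r2 :: real assume "r1 > 0" "r2 > 0" "\<Phi> = torus_map r1 r2"
    then show ?thesis using lc range_torus_map by metis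
  next
    fix r :: real assume "r > 0" "\<Phi> = cylinder_map r"
    then show ?thesis using lc range_cylinder_map by metis
  qed
qed

end
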